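(* Let $M$ be a closed manifold of dimension $n$ with Riemannian metrics $g(t)$ evolving by $\frac{\partial}{\partial t}g(t)=2h(t)$ for $t\in[0,T]$ and satisfying $$\mathrm{Ric}\ge -K_1 g,\quad -K_2 g\le h\le K_3 g,\quad |\nabla h|\le K_4$$ on $M\times[0,T]$, with constants $K_1,K_2,K_3,K_4\ge0$. Let $u$ be a positive solution on $M\times[0,T]$ of $$(\Delta-q(x,t)-\partial_t)u(x,t)=A(u(x,t)),$$ where $q$ satisfies $|\nabla q|\le\gamma$ and $\Delta q\le\theta$ on $M\times[0,T]$ with constants $\gamma,\theta\ge0$. Then for any $\alpha>1$, $$\begin{aligned} &\frac{|\nabla u|^2}{u^2}-\alpha\frac{u_t}{u}-\alpha q-\alpha\frac{A(u)}{u}\\ \le{}&\frac{n\alpha^2}{2t}+\frac{n\alpha^2}{\alpha-1}\big(K_1+(\alpha-1)K_3+K_4\big)+n\alpha^2\left(\max\{K_2,K_3\}+\frac34\sqrt{2K_4}\right)\\ &+\alpha^{3/2}\sqrt{n\theta}+\left(\frac{n\alpha^2}{2}(\alpha-1)^{1/2}+\sqrt n\,\alpha(\alpha-1)^{1/4}\right)\gamma^{2/3}+\frac{n\alpha^2}{2}(\lambda+\Lambda)+\frac{n\alpha^3}{2(\alpha-1)}\Sigma \end{aligned}$$ on $M\times(0,T]$.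
   Context: $g(t)$, $t\in[0,T]$, is a smooth family of Riemannian metrics on $M$, and $h(t)$ is a time-dependent symmetric $(0,2)$-tensor field on $M$. $\nabla$, $\Delta$, $\mathrm{Ric}$, $|\cdot|$ at time $t$ are taken with respect to $g(t)$. $q(x,t)$ is a function on $M\times[0,T]$ which is $C^2$ in $x$ and $C^1$ in $t$; $A$ is a $C^2$ function of $u$. Solutions $u$ are smooth in $x$ and $t$; $u_t=\partial_tu$. The following nonnegative numbers (finite since $M$ is compact) depend on $u$ and $A$: $$\lambda=-\min\Big\{0,\inf_{M\times[0,T]}\big(A'(u)-A(u)/u\big)\Big\},\quad \Lambda=\max\Big\{0,\sup_{M\times[0,T]}\big(A'(u)-A(u)/u\big)\Big\},$$ $$\Sigma=\max\Big\{0,\sup_{M\times[0,T]}\big(uA''(u)-A'(u)+A(u)/u\big)\Big\}.$$ *)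

theory Defs
  imports "HOL-Analysis.Analysis"
begin

section \<open>Functions of class \<open>C\<^sup>k\<close>\<close>

text \<open>The derivative is taken within \<open>S\<close>, so that for \<open>S = V \<times> {0..T}\<close> with \<open>V\<close> open this is the
  usual notion of a function that is \<open>C\<^sup>k\<close> up to the boundary (one-sided in time at the end points).
  On the sets used below (\<open>V\<close>, \<open>V \<times> {0..T}\<close> and intervals) the derivative within \<open>S\<close> is unique.\<close>

primrec Ck_on :: "nat \<Rightarrow> 'a::real_normed_vector set \<Rightarrow> ('a \<Rightarrow> 'b::real_normed_vector) \<Rightarrow> bool" where
  "Ck_on 0 S f \<longleftrightarrow> continuous_on S f"
| "Ck_on (Suc k) S f \<longleftrightarrow>
     (\<exists>f'. (\<forall>x\<in>S. (f has_derivative f' x) (at x within S)) \<and> (\<forall>v. Ck_on k S (\<lambda>x. f' x v)))"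

definition smooth_on :: "'a::real_normed_vector set \<Rightarrow> ('a \<Rightarrow> 'b::real_normed_vector) \<Rightarrow> bool" where
  "smooth_on S f \<longleftrightarrow> (\<forall>k. Ck_on k S f)"


section \<open>Smooth manifolds\<close>

text \<open>A chart is a pair of a domain and a coordinate map; the values of the coordinate map
  outside the domain are irrelevant.\<close>

type_synonym ('a, 'n) chart = "'a set \<times> ('a \<Rightarrow> real^'n)"

abbreviation chart_dom :: "('a, 'n::finite) chart \<Rightarrow> 'a set" where
  "chart_dom c \<equiv> fst c"

abbreviation chart_map :: "('a, 'n::finite) chart \<Rightarrow> 'a \<Rightarrow> real^'n" where
  "chart_map c \<equiv> snd c"

definition chart_inv :: "('a, 'n::finite) chart \<Rightarrow> real^'n \<Rightarrow> 'a" where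
  "chart_inv c = inv_into (chart_dom c) (chart_map c)"

definition is_chart :: "'a topology \<Rightarrow> ('a, 'n::finite) chart \<Rightarrow> bool" where
  "is_chart X c \<longleftrightarrow> openin X (chart_dom c) \<and> open (chart_map c ` chart_dom c) \<and>
     homeomorphic_map (subtopology X (chart_dom c)) (top_of_set (chart_map c ` chart_dom c)) (chart_map c)"

definition smooth_transition :: "('a, 'n::finite) chart \<Rightarrow> ('a, 'n) chart \<Rightarrow> bool" where
  "smooth_transition c d \<longleftrightarrow>
     smooth_on (chart_map c ` (chart_dom c \<inter> chart_dom d)) (chart_map d \<circ> chart_inv c)"

definition smooth_structure :: "'a topology \<Rightarrow> ('a, 'n::finite) chart set \<Rightarrow> bool" where
  "smooth_structure X \<A> \<longleftrightarrow>
     (\<forall>c\<in>\<A>. is_chart X c) \<and>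
     (\<Union>c\<in>\<A>. chart_dom c) = topspace X \<and>
     (\<forall>c\<in>\<A>. \<forall>d\<in>\<A>. smooth_transition c d) \<and>
     (\<forall>c. is_chart X c \<and> (\<forall>d\<in>\<A>. smooth_transition c d \<and> smooth_transition d c) \<longrightarrow> c \<in> \<A>)"

definition closed_manifold :: "'a topology \<Rightarrow> ('a, 'n::finite) chart set \<Rightarrow> bool" where
  "closed_manifold X \<A> \<longleftrightarrow>
     Hausdorff_space X \<and> second_countable X \<and> compact_space X \<and> smooth_structure X \<A>"


section \<open>Tensor fields\<close>

text \<open>A covariant 2-tensor field \<open>S\<close> is given by its components: \<open>S c p $ i $ j\<close> is the value of the
  tensor at \<open>p\<close> on the \<open>i\<close>-th and \<open>j\<close>-th coordinate vectors of the chart \<open>c\<close>.\<close>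

type_synonym ('a, 'n) tensor2 = "('a, 'n) chart \<Rightarrow> 'a \<Rightarrow> real^'n^'n"

definition jacobian :: "('a, 'n::finite) chart \<Rightarrow> ('a, 'n) chart \<Rightarrow> 'a \<Rightarrow> real^'n^'n" where
  "jacobian c d p = matrix (frechet_derivative (chart_map d \<circ> chart_inv c) (at (chart_map c p)))"

definition symmetric_tensor_field :: "('a, 'n::finite) chart set \<Rightarrow> ('a, 'n) tensor2 \<Rightarrow> bool" where
  "symmetric_tensor_field \<A> S \<longleftrightarrow>
     (\<forall>c\<in>\<A>. \<forall>p\<in>chart_dom c. transpose (S c p) = S c p) \<and>
     (\<forall>c\<in>\<A>. \<forall>d\<in>\<A>. \<forall>p\<in>chart_dom c \<inter> chart_dom d.
        S c p = transpose (jacobian c d p) ** S d p ** jacobian c d p)"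

definition smooth_metric_family ::
  "('a, 'n::finite) chart set \<Rightarrow> real \<Rightarrow> (real \<Rightarrow> ('a, 'n) tensor2) \<Rightarrow> bool" where
  "smooth_metric_family \<A> T g \<longleftrightarrow>
     (\<forall>t\<in>{0..T}. symmetric_tensor_field \<A> (g t) \<and>
        (\<forall>c\<in>\<A>. \<forall>p\<in>chart_dom c. \<forall>v. v \<noteq> 0 \<longrightarrow> v \<bullet> (g t c p *v v) > 0)) \<and>
     (\<forall>c\<in>\<A>. smooth_on (chart_map c ` chart_dom c \<times> {0..T}) (\<lambda>(x, t). g t c (chart_inv c x)))"

definition tensor_le :: "real^'n^'n \<Rightarrow> real^'n^'n \<Rightarrow> bool" where
  "tensor_le R S \<longleftrightarrow> (\<forall>v. v \<bullet> (R *v v) \<le> v \<bullet> (S *v v))"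


section \<open>Riemannian geometry in local coordinates\<close>

text \<open>All formulas are for one metric \<open>G\<close>, in the coordinates of the chart \<open>c\<close>, at the point \<open>p\<close>.
  \<open>pd c i f\<close> is the \<open>i\<close>-th coordinate vector field of \<open>c\<close> applied to \<open>f\<close>.\<close>

definition pd :: "('a, 'n::finite) chart \<Rightarrow> 'n \<Rightarrow> ('a \<Rightarrow> real) \<Rightarrow> 'a \<Rightarrow> real" where
  "pd c i f p = frechet_derivative (f \<circ> chart_inv c) (at (chart_map c p)) (axis i 1)"

definition ginv :: "('a, 'n::finite) tensor2 \<Rightarrow> ('a, 'n) chart \<Rightarrow> 'n \<Rightarrow> 'n \<Rightarrow> 'a \<Rightarrow> real" where
  "ginv G c i j p = matrix_inv (G c p) $ i $ j"

text \<open>Christoffel symbol of the Levi-Civita connection, with upper index \<open>k\<close>.\<close>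

definition christoffel :: "('a, 'n::finite) tensor2 \<Rightarrow> ('a, 'n) chart \<Rightarrow> 'n \<Rightarrow> 'n \<Rightarrow> 'n \<Rightarrow> 'a \<Rightarrow> real" where
  "christoffel G c k i j p =
     (\<Sum>l\<in>UNIV. ginv G c k l p *
        (pd c i (\<lambda>x. G c x $ j $ l) p + pd c j (\<lambda>x. G c x $ i $ l) p - pd c l (\<lambda>x. G c x $ i $ j) p)) / 2"

text \<open>\<open>riemann G c l i j k\<close> is the \<open>l\<close>-th component of \<open>R(\<partial>\<^sub>i, \<partial>\<^sub>j)\<partial>\<^sub>k\<close>, where
  \<open>R(X, Y)Z = \<nabla>\<^sub>X\<nabla>\<^sub>Y Z - \<nabla>\<^sub>Y\<nabla>\<^sub>X Z - \<nabla>\<^bsub>[X, Y]\<^esub> Z\<close>;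
  \<open>Ric(Y, Z)\<close> is the trace of \<open>X \<mapsto> R(X, Y)Z\<close>, which is positive on round spheres.\<close>

definition riemann ::
  "('a, 'n::finite) tensor2 \<Rightarrow> ('a, 'n) chart \<Rightarrow> 'n \<Rightarrow> 'n \<Rightarrow> 'n \<Rightarrow> 'n \<Rightarrow> 'a \<Rightarrow> real" where
  "riemann G c l i j k p =
     pd c i (christoffel G c l j k) p - pd c j (christoffel G c l i k) p +
     (\<Sum>m\<in>UNIV. christoffel G c m j k p * christoffel G c l i m p
              - christoffel G c m i k p * christoffel G c l j m p)"

definition ricci :: "('a, 'n::finite) tensor2 \<Rightarrow> ('a, 'n) tensor2" where
  "ricci G c p = (\<chi> j k. \<Sum>i\<in>UNIV. riemann G c i i j k p)"

definition grad_norm :: "('a, 'n::finite) tensor2 \<Rightarrow> ('a, 'n) chart \<Rightarrow> ('a \<Rightarrow> real) \<Rightarrow> 'a \<Rightarrow> real" where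
  "grad_norm G c f p = sqrt (\<Sum>i\<in>UNIV. \<Sum>j\<in>UNIV. ginv G c i j p * pd c i f p * pd c j f p)"

definition hessian ::
  "('a, 'n::finite) tensor2 \<Rightarrow> ('a, 'n) chart \<Rightarrow> ('a \<Rightarrow> real) \<Rightarrow> 'n \<Rightarrow> 'n \<Rightarrow> 'a \<Rightarrow> real" where
  "hessian G c f i j p = pd c i (pd c j f) p - (\<Sum>k\<in>UNIV. christoffel G c k i j p * pd c k f p)"

definition laplacian :: "('a, 'n::finite) tensor2 \<Rightarrow> ('a, 'n) chart \<Rightarrow> ('a \<Rightarrow> real) \<Rightarrow> 'a \<Rightarrow> real" where
  "laplacian G c f p = (\<Sum>i\<in>UNIV. \<Sum>j\<in>UNIV. ginv G c i j p * hessian G c f i j p)"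

text \<open>\<open>cov_deriv G c S k i j\<close> is \<open>(\<nabla>\<^bsub>\<partial>\<^sub>k\<^esub> S)(\<partial>\<^sub>i, \<partial>\<^sub>j)\<close>.\<close>

definition cov_deriv ::
  "('a, 'n::finite) tensor2 \<Rightarrow> ('a, 'n) chart \<Rightarrow> ('a, 'n) tensor2 \<Rightarrow> 'n \<Rightarrow> 'n \<Rightarrow> 'n \<Rightarrow> 'a \<Rightarrow> real" where
  "cov_deriv G c S k i j p = pd c k (\<lambda>x. S c x $ i $ j) p
     - (\<Sum>l\<in>UNIV. christoffel G c l k i p * S c p $ l $ j + christoffel G c l k j p * S c p $ i $ l)"

definition cov_deriv_norm ::
  "('a, 'n::finite) tensor2 \<Rightarrow> ('a, 'n) chart \<Rightarrow> ('a, 'n) tensor2 \<Rightarrow> 'a \<Rightarrow> real" where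
  "cov_deriv_norm G c S p = sqrt (\<Sum>k\<in>UNIV. \<Sum>k'\<in>UNIV. \<Sum>i\<in>UNIV. \<Sum>i'\<in>UNIV. \<Sum>j\<in>UNIV. \<Sum>j'\<in>UNIV.
     ginv G c k k' p * ginv G c i i' p * ginv G c j j' p *
     cov_deriv G c S k i j p * cov_deriv G c S k' i' j' p)"


section \<open>Functions on space-time\<close>

text \<open>Derivative in \<open>t\<close> on \<open>[0, T]\<close>, one-sided at the end points.\<close>

definition time_deriv :: "real \<Rightarrow> ('a \<Rightarrow> real \<Rightarrow> real) \<Rightarrow> 'a \<Rightarrow> real \<Rightarrow> real" where
  "time_deriv T u p t = vector_derivative (u p) (at t within {0..T})"

definition smooth_spacetime ::
  "('a, 'n::finite) chart set \<Rightarrow> real \<Rightarrow> ('a \<Rightarrow> real \<Rightarrow> real) \<Rightarrow> bool" where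
  "smooth_spacetime \<A> T u \<longleftrightarrow>
     (\<forall>c\<in>\<A>. smooth_on (chart_map c ` chart_dom c \<times> {0..T}) (\<lambda>(x, t). u (chart_inv c x) t))"

text \<open>\<open>C\<^sup>2\<close> in space at each time and \<open>C\<^sup>1\<close> in time at each point.\<close>

definition C21_spacetime ::
  "'a topology \<Rightarrow> ('a, 'n::finite) chart set \<Rightarrow> real \<Rightarrow> ('a \<Rightarrow> real \<Rightarrow> real) \<Rightarrow> bool" where
  "C21_spacetime X \<A> T q \<longleftrightarrow>
     (\<forall>t\<in>{0..T}. \<forall>c\<in>\<A>. Ck_on 2 (chart_map c ` chart_dom c) (\<lambda>x. q (chart_inv c x) t)) \<and>
     (\<forall>p\<in>topspace X. Ck_on 1 {0..T} (q p))"

end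

theory Submission
  imports Defs
begin

text \<open>
  With \<open>f = ln u\<close> and \<open>w = \<Delta>f + |\<nabla>f|\<^sup>2 = f\<^sub>t + q + A(u)/u\<close> the left-hand side is
  \<open>P = |\<nabla>f|\<^sup>2 - \<alpha>w\<close>, which is smooth even though \<open>q\<close> is not. The function \<open>(t - \<epsilon>)P\<close> is
  maximised over \<open>M \<times> [\<epsilon>, t\<^sub>1]\<close> with \<open>t\<^sub>1 < T\<close>, so that a positive maximum is attained at an
  interior time. Since the atlas is maximal, it has a chart that is normal at the maximum point:
  there \<open>g\<close> is the identity matrix and its first derivatives vanish, and all hypotheses hold in this
  chart. The Bochner formula and the variation of \<open>\<Delta>\<close> under \<open>g\<^sub>t = 2h\<close> bound \<open>P\<close> there by a
  quadratic inequality; then \<open>\<epsilon> \<rightarrow> 0\<close> and \<open>t\<^sub>1 \<rightarrow> T\<close>.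
\<close>

section \<open>Calculus of \<open>C\<^sup>k\<close> functions\<close>

text \<open>Space and time derivatives are directional derivatives of one function on the open set
  chart image times (0, T). They therefore commute by a single lemma, and the end point T has to be
  left out until the last step. The residual r = w - f_t equals q + A(u)/u, hence is smooth although
  q need not be; q enters only through the first and second space derivatives of r at the time of
  the maximum. In the evolution of P the term \<Delta> f_t coming from \<Delta> P cancels against
  the time derivative of \<Delta> f, up to terms in h and its first derivatives. The mixed term of h
  with the Hessian of f is absorbed by completing a square. This requires B = -\<Delta> f to be at
  least \<alpha> n K / 2 with K = max K2 K3; if it is smaller, P \<le> \<alpha> B is already within
  the bound. The remaining inequality is quadratic in S = P + (\<alpha> - 1) |grad f|^2 = \<alpha>
  B. The terms linear in |grad f| are split by weighted AM-GM; this is the origin of the power 2/3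
  of \<gamma>, and of K4 occurring both linearly and under a root.\<close>

lemma Ck_on_cong:
  assumes "\<And>x. x \<in> S \<Longrightarrow> f x = g x"
  shows "Ck_on k S f \<longleftrightarrow> Ck_on k S g"
proof (cases k)
  case 0
  then show ?thesis using assms by (simp cong: continuous_on_cong)
next
  case (Suc m)
  have "(f has_derivative D) (at x within S) \<longleftrightarrow> (g has_derivative D) (at x within S)"
    if "x \<in> S" for x D
    using assms that by (metis has_derivative_transform)
  then show ?thesis using Suc by simp
qed

lemma Ck_on_SucI:
  assumes "\<And>x. x \<in> S \<Longrightarrow> (f has_derivative f' x) (at x within S)" "\<And>v. Ck_on k S (\<lambda>x. f' x v)"
  shows "Ck_on (Suc k) S f"
  using assms by auto

lemma Ck_on_SucE:
  assumes "Ck_on (Suc k) S f"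
  obtains f' where "\<And>x. x \<in> S \<Longrightarrow> (f has_derivative f' x) (at x within S)" "\<And>v. Ck_on k S (\<lambda>x. f' x v)"
  using assms by auto

lemma Ck_on_Suc_continuous: "Ck_on (Suc k) S f \<Longrightarrow> continuous_on S f"
  by (elim Ck_on_SucE) (rule has_derivative_continuous_on)

lemma Ck_on_SucD: "Ck_on (Suc k) S f \<Longrightarrow> Ck_on k S f"
proof (induction k arbitrary: f)
  case 0
  then show ?case using Ck_on_Suc_continuous by (metis Ck_on.simps(1))
next
  case (Suc k)
  then obtain f' where f': "\<And>x. x\<in>S \<Longrightarrow> (f has_derivative f' x) (at x within S)"
    "\<And>v. Ck_on (Suc k) S (\<lambda>x. f' x v)"
    by (subst (asm) Ck_on.simps(2)) blast
  then show ?case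
    using Suc.IH by (subst Ck_on.simps(2)) blast
qed

lemma Ck_on_mono: "Ck_on k S f \<Longrightarrow> m \<le> k \<Longrightarrow> Ck_on m S f"
  by (induction k arbitrary: m) (auto simp: le_Suc_eq simp del: Ck_on.simps dest: Ck_on_SucD)

lemma Ck_on_continuous: "Ck_on k S f \<Longrightarrow> continuous_on S f"
  using Ck_on_mono[of k S f 0] by simp

lemma Ck_on_subset: "Ck_on k S f \<Longrightarrow> U \<subseteq> S \<Longrightarrow> Ck_on k U f"
proof (induction k arbitrary: f)
  case 0
  then show ?case by (simp add: continuous_on_subset)
next
  case (Suc k)
  then obtain f' where f': "\<And>x. x\<in>S \<Longrightarrow> (f has_derivative f' x) (at x within S)"
    "\<And>v. Ck_on k S (\<lambda>x. f' x v)" using Ck_on_SucE by blast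
  show ?case
    using f' Suc.IH Suc.prems(2) by (intro Ck_on_SucI[of _ _ f']) (blast intro: has_derivative_subset)+
qed

lemma Ck_on_const: "Ck_on k S (\<lambda>x. c)"
  by (induction k arbitrary: c) (auto intro!: exI[of _ "\<lambda>x v. 0"])

lemma Ck_on_bounded_linear:
  assumes "bounded_linear L" shows "Ck_on k S L"
proof (cases k)
  case 0
  then show ?thesis using assms by (simp add: linear_continuous_on)
next
  case (Suc m)
  then show ?thesis using assms
    by (auto intro!: exI[of _ "\<lambda>x. L"] Ck_on_const bounded_linear_imp_has_derivative)
qed

lemma Ck_on_linear_compose:
  assumes "bounded_linear L" "Ck_on k S f" shows "Ck_on k S (\<lambda>x. L (f x))"
  using assms(2)
proof (induction k arbitrary: f)
  case 0
  then show ?case using assms(1) by (simp add: bounded_linear.continuous_on)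
next
  case (Suc k)
  then obtain f' where f': "\<And>x. x\<in>S \<Longrightarrow> (f has_derivative f' x) (at x within S)"
    "\<And>v. Ck_on k S (\<lambda>x. f' x v)" using Ck_on_SucE by blast
  show ?case
    by (intro Ck_on_SucI[of _ _ "\<lambda>x v. L (f' x v)"] bounded_linear.has_derivative[OF assms(1)] Suc.IH f')
qed

lemma Ck_on_add:
  "Ck_on k S f \<Longrightarrow> Ck_on k S g \<Longrightarrow> Ck_on k S (\<lambda>x. f x + g x)"
proof (induction k arbitrary: f g)
  case 0
  then show ?case by (simp add: continuous_on_add)
next
  case (Suc k)
  obtain f' where f': "\<And>x. x\<in>S \<Longrightarrow> (f has_derivative f' x) (at x within S)"
    "\<And>v. Ck_on k S (\<lambda>x. f' x v)" using Ck_on_SucE[OF Suc.prems(1)] by blast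
  obtain g' where g': "\<And>x. x\<in>S \<Longrightarrow> (g has_derivative g' x) (at x within S)"
    "\<And>v. Ck_on k S (\<lambda>x. g' x v)" using Ck_on_SucE[OF Suc.prems(2)] by blast
  show ?case
    by (intro Ck_on_SucI[of _ _ "\<lambda>x v. f' x v + g' x v"] has_derivative_add Suc.IH f' g')
qed

lemma Ck_on_sum:
  "(\<And>i. i \<in> I \<Longrightarrow> Ck_on k S (f i)) \<Longrightarrow> Ck_on k S (\<lambda>x. \<Sum>i\<in>I. f i x)"
  by (induction I rule: infinite_finite_induct) (auto intro: Ck_on_add Ck_on_const)

lemma (in bounded_bilinear) Ck_on_prod:
  "Ck_on k S f \<Longrightarrow> Ck_on k S g \<Longrightarrow> Ck_on k S (\<lambda>x. prod (f x) (g x))"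
proof (induction k arbitrary: f g)
  case 0
  then show ?case by (simp add: continuous_on)
next
  case (Suc k)
  obtain f' where f': "\<And>x. x\<in>S \<Longrightarrow> (f has_derivative f' x) (at x within S)"
    "\<And>v. Ck_on k S (\<lambda>x. f' x v)" using Ck_on_SucE[OF Suc.prems(1)] by blast
  obtain g' where g': "\<And>x. x\<in>S \<Longrightarrow> (g has_derivative g' x) (at x within S)"
    "\<And>v. Ck_on k S (\<lambda>x. g' x v)" using Ck_on_SucE[OF Suc.prems(2)] by blast
  have "Ck_on k S f" "Ck_on k S g" using Suc.prems Ck_on_SucD by blast+
  then show ?case
    by (intro Ck_on_SucI[of _ _ "\<lambda>x v. prod (f x) (g' x v) + prod (f' x v) (g x)"]
        FDERIV Ck_on_add Suc.IH f' g')
qed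

lemmas Ck_on_mult = bounded_bilinear.Ck_on_prod[OF bounded_bilinear_mult]
lemmas Ck_on_scaleR = bounded_bilinear.Ck_on_prod[OF bounded_bilinear_scaleR]

text \<open>The derivative \<open>g' (f x) (f' x v)\<close> varies in its direction as well as in
  its point, whereas \<open>Ck_on\<close> speaks of fixed directions. Expanding
  \<open>f' x v\<close> in the basis of the intermediate space reduces it to fixed directions, hence
  the euclidean codomain of \<open>f\<close>.\<close>

lemma Ck_on_compose:
  fixes f :: "'a::real_normed_vector \<Rightarrow> 'b::euclidean_space"
  assumes "Ck_on k S f" "Ck_on k U g" "f ` S \<subseteq> U"
  shows "Ck_on k S (\<lambda>x. g (f x))"
  using assms
proof (induction k arbitrary: f g)
  case 0
  then show ?case by (auto intro: continuous_on_compose2)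
next
  case (Suc k)
  obtain f' where f': "\<And>x. x\<in>S \<Longrightarrow> (f has_derivative f' x) (at x within S)"
    "\<And>v. Ck_on k S (\<lambda>x. f' x v)" using Ck_on_SucE[OF Suc.prems(1)] by blast
  obtain g' where g': "\<And>x. x\<in>U \<Longrightarrow> (g has_derivative g' x) (at x within U)"
    "\<And>v. Ck_on k U (\<lambda>x. g' x v)" using Ck_on_SucE[OF Suc.prems(2)] by blast
  have fk: "Ck_on k S f" using Suc.prems Ck_on_SucD by blast
  have eq: "g' (f x) (f' x v) = (\<Sum>b\<in>Basis. (f' x v \<bullet> b) *\<^sub>R g' (f x) b)" if "x \<in> S" for x v
  proof -
    have "linear (g' (f x))"
      using g'(1)[of "f x"] that Suc.prems(3) has_derivative_linear by blast
    then have "(\<Sum>b\<in>Basis. (f' x v \<bullet> b) *\<^sub>R g' (f x) b) = g' (f x) (\<Sum>b\<in>Basis. (f' x v \<bullet> b) *\<^sub>R b)"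
      by (simp add: linear_sum linear_cmul)
    then show ?thesis by (simp add: euclidean_representation)
  qed
  have "Ck_on k S (\<lambda>x. g' (f x) (f' x v))" for v
  proof -
    have "Ck_on k S (\<lambda>x. \<Sum>b\<in>Basis. (f' x v \<bullet> b) *\<^sub>R g' (f x) b)"
      using Suc.IH[OF fk g'(2) Suc.prems(3)] f'(2)
      by (intro Ck_on_sum Ck_on_scaleR Ck_on_linear_compose[OF bounded_linear_inner_left]) auto
    then show ?thesis using eq by (subst Ck_on_cong) auto
  qed
  moreover have "((\<lambda>x. g (f x)) has_derivative (\<lambda>v. g' (f x) (f' x v))) (at x within S)" if "x \<in> S" for x
    using has_derivative_in_compose2[OF g'(1) Suc.prems(3) that f'(1)[OF that]] by blast
  ultimately show ?case
    by (auto intro!: exI[of _ "\<lambda>x v. g' (f x) (f' x v)"])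
qed

text \<open>The derivative is a product of two copies of \<open>inverse\<close> and a constant, so
  the product rule drives the induction.\<close>

lemma Ck_on_inverse: "Ck_on k (- {0::real}) inverse"
proof (induction k)
  case 0
  then show ?case by (auto intro!: continuous_intros)
next
  case (Suc k)
  have "Ck_on k (- {0::real}) (\<lambda>x. - (inverse x * v * inverse x))" for v
    using Ck_on_mult[OF Ck_on_mult[OF Suc Ck_on_const[of _ _ "-v"]] Suc] by simp
  then show ?case
    by (auto intro!: exI[of _ "\<lambda>x v. - (inverse x * v * inverse x)"] has_derivative_inverse')
qed

lemma Ck_on_ln: "Ck_on k {0::real<..} ln"
proof (cases k)
  case 0
  then show ?thesis by (auto intro!: continuous_intros)
next
  case (Suc m)
  have "Ck_on m {0::real<..} (\<lambda>x. inverse x * v)" for v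
    by (rule Ck_on_subset[OF Ck_on_mult[OF Ck_on_inverse Ck_on_const]]) auto
  moreover have "(ln has_derivative (\<lambda>v. inverse x * v)) (at x within {0::real<..})" if "x > 0" for x
    using DERIV_ln[OF that] has_field_derivative_at_within
    by (auto simp: has_field_derivative_def intro: has_derivative_at_withinI)
  ultimately show ?thesis
    using Suc by (auto intro!: exI[of _ "\<lambda>x v. inverse x * v"])
qed

section \<open>Closure properties of smooth functions, up to inversion of matrices\<close>

named_theorems smooth_intros

lemma smooth_on_const [smooth_intros]: "smooth_on S (\<lambda>x. c)"
  by (simp add: smooth_on_def Ck_on_const)

lemma smooth_on_bounded_linear: "bounded_linear L \<Longrightarrow> smooth_on S L"
  by (simp add: smooth_on_def Ck_on_bounded_linear)

lemma smooth_on_ident [smooth_intros]: "smooth_on S (\<lambda>x. x)"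
  by (intro smooth_on_bounded_linear bounded_linear_ident)

lemma smooth_on_linear_compose: "bounded_linear L \<Longrightarrow> smooth_on S f \<Longrightarrow> smooth_on S (\<lambda>x. L (f x))"
  by (simp add: smooth_on_def Ck_on_linear_compose)

lemma smooth_on_add [smooth_intros]: "smooth_on S f \<Longrightarrow> smooth_on S g \<Longrightarrow> smooth_on S (\<lambda>x. f x + g x)"
  by (simp add: smooth_on_def Ck_on_add)

lemma smooth_on_mult [smooth_intros]:
  fixes f g :: "_ \<Rightarrow> 'b::real_normed_algebra"
  shows "smooth_on S f \<Longrightarrow> smooth_on S g \<Longrightarrow> smooth_on S (\<lambda>x. f x * g x)"
  by (simp add: smooth_on_def Ck_on_mult)

lemma smooth_on_minus [smooth_intros]: "smooth_on S f \<Longrightarrow> smooth_on S (\<lambda>x. - f x)"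
  by (rule smooth_on_linear_compose[OF bounded_linear_minus[OF bounded_linear_ident]])

lemma smooth_on_diff [smooth_intros]: "smooth_on S f \<Longrightarrow> smooth_on S g \<Longrightarrow> smooth_on S (\<lambda>x. f x - g x)"
  using smooth_on_add[OF _ smooth_on_minus] by fastforce

lemma smooth_on_sum [smooth_intros]:
  "(\<And>i. i \<in> I \<Longrightarrow> smooth_on S (f i)) \<Longrightarrow> smooth_on S (\<lambda>x. \<Sum>i\<in>I. f i x)"
  by (simp add: smooth_on_def Ck_on_sum)

lemma smooth_on_prod [smooth_intros]:
  fixes f :: "_ \<Rightarrow> _ \<Rightarrow> real"
  shows "(\<And>i. i \<in> I \<Longrightarrow> smooth_on S (f i)) \<Longrightarrow> smooth_on S (\<lambda>x. \<Prod>i\<in>I. f i x)"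
  by (induction I rule: infinite_finite_induct) (auto intro: smooth_intros)

lemma smooth_on_compose:
  fixes f :: "'a::real_normed_vector \<Rightarrow> 'b::euclidean_space"
  assumes "smooth_on S f" "smooth_on U g" "f ` S \<subseteq> U"
  shows "smooth_on S (\<lambda>x. g (f x))"
  using assms Ck_on_compose unfolding smooth_on_def by blast

lemma smooth_on_subset: "smooth_on S f \<Longrightarrow> U \<subseteq> S \<Longrightarrow> smooth_on U f"
  using Ck_on_subset unfolding smooth_on_def by blast

lemma smooth_on_slice:
  fixes F :: "'a::euclidean_space \<times> 'b::euclidean_space \<Rightarrow> 'c::real_normed_vector"
  assumes "smooth_on (S \<times> J) F" "t \<in> J" shows "smooth_on S (\<lambda>x. F (x, t))"
proof -
  have "smooth_on S (\<lambda>x. (x, 0) + (0, t) :: 'a \<times> 'b)"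
    by (intro smooth_intros smooth_on_bounded_linear)
      (intro bounded_linear_Pair bounded_linear_ident bounded_linear_zero)
  then have "smooth_on S (\<lambda>x. (x, t))" by simp
  from smooth_on_compose[OF this assms(1)] assms(2) show ?thesis by force
qed

lemma smooth_on_cong: "(\<And>x. x \<in> S \<Longrightarrow> f x = g x) \<Longrightarrow> smooth_on S f \<longleftrightarrow> smooth_on S g"
  unfolding smooth_on_def using Ck_on_cong by blast

lemma smooth_on_divide [smooth_intros]:
  fixes f g :: "_ \<Rightarrow> real"
  assumes "smooth_on S f" "smooth_on S g" "\<And>x. x \<in> S \<Longrightarrow> g x \<noteq> 0"
  shows "smooth_on S (\<lambda>x. f x / g x)"
proof -
  have "smooth_on S (\<lambda>x. inverse (g x))"
    by (rule smooth_on_compose[OF assms(2), of "- {0}"]) (use assms(3) in \<open>auto simp: smooth_on_def Ck_on_inverse\<close>)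
  from smooth_on_mult[OF assms(1) this] show ?thesis by (simp add: divide_inverse)
qed

lemma smooth_on_ln [smooth_intros]:
  assumes "smooth_on S f" "\<And>x. x \<in> S \<Longrightarrow> f x > 0"
  shows "smooth_on S (\<lambda>x. ln (f x) :: real)"
  by (rule smooth_on_compose[OF assms(1), of "{0<..}"]) (use assms(2) in \<open>auto simp: smooth_on_def Ck_on_ln\<close>)

lemma smooth_on_vec_nth [smooth_intros]: "smooth_on S f \<Longrightarrow> smooth_on S (\<lambda>x. f x $ i)"
  by (rule smooth_on_linear_compose[OF bounded_linear_vec_nth])

lemma smooth_on_vec_lambda [smooth_intros]:
  fixes f :: "_ \<Rightarrow> 'n::finite \<Rightarrow> 'b::real_normed_vector"
  assumes "\<And>i. smooth_on S (\<lambda>x. f x i)"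
  shows "smooth_on S (\<lambda>x. \<chi> i. f x i)"
proof -
  have bl: "bounded_linear (axis i :: 'b \<Rightarrow> 'b^'n)" for i
    by (intro bounded_linear_intro[of _ 1])
      (auto simp: vec_eq_iff axis_def norm_vec_def L2_set_def if_distrib[of norm] if_distrib[of "\<lambda>x. x^2"] cong: if_cong)
  have "smooth_on S (\<lambda>x. \<Sum>i\<in>UNIV. axis i (f x i))"
    by (intro smooth_on_sum smooth_on_linear_compose[OF bl] assms)
  moreover have "(\<Sum>i\<in>UNIV. axis i (f x i)) = (\<chi> i. f x i)" for x
    by (simp add: vec_eq_iff axis_def if_distrib cong: if_cong)
  ultimately show ?thesis by simp
qed

lemma smooth_on_det [smooth_intros]:
  fixes M :: "_ \<Rightarrow> real^'n^'n"
  assumes "smooth_on S M" shows "smooth_on S (\<lambda>x. det (M x))"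
  unfolding det_def by (intro smooth_intros assms)

lemma matrix_inv_mult:
  fixes M :: "real^'n^'n"
  assumes "invertible M"
  shows "M ** matrix_inv M = mat 1" "matrix_inv M ** M = mat 1"
  using someI_ex[OF assms[unfolded invertible_def]] by (auto simp: matrix_inv_def)

text \<open>By Cramer's rule every entry of the inverse is a quotient of determinants, hence a
  rational function of the entries of \<open>M\<close>.\<close>

lemma smooth_on_matrix_inv [smooth_intros]:
  fixes M :: "_ \<Rightarrow> real^'n^'n"
  assumes "smooth_on S M" and inv: "\<And>x. x \<in> S \<Longrightarrow> invertible (M x)"
  shows "smooth_on S (\<lambda>x. matrix_inv (M x))"
proof -
  have nz: "det (M x) \<noteq> 0" if "x \<in> S" for x
    using inv[OF that] invertible_det_nz by blast
  have eq: "matrix_inv (M x) = (\<chi> i j. det (\<chi> a b. if b = i then axis j 1 $ a else M x $ a $ b) / det (M x))"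
    if "x \<in> S" for x
  proof -
    have "M x ** matrix_inv (M x) = mat 1"
      using inv[OF that] by (rule matrix_inv_mult)
    then have "M x *v (column j (matrix_inv (M x))) = axis j 1" for j
      by (metis matrix_vector_mul_assoc matrix_vector_mul_lid matrix_vector_mult_basis)
    then have "column j (matrix_inv (M x)) = (\<chi> i. det (\<chi> a b. if b = i then axis j 1 $ a else M x $ a $ b) / det (M x))" for j
      using cramer[OF nz[OF that]] by blast
    then show ?thesis by (simp add: vec_eq_iff column_def)
  qed
  have "smooth_on S (\<lambda>x. \<chi> i j. det (\<chi> a b. if b = i then axis j 1 $ a else M x $ a $ b) / det (M x))"
  proof -
    have "smooth_on S (\<lambda>x. if b = i then axis j 1 $ a else M x $ a $ b)" for a b i and j :: 'n
      by (cases "b = i") (auto intro!: smooth_intros assms)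
    then show ?thesis
      using nz by (intro smooth_intros assms) auto
  qed
  then show ?thesis using eq by (subst smooth_on_cong) auto
qed

lemma smooth_on_continuous: "smooth_on S f \<Longrightarrow> continuous_on S f"
  unfolding smooth_on_def using Ck_on_continuous by blast

section \<open>Directional derivatives\<close>

text \<open>Based on the full filter \<open>at x\<close>, so it is meant for interior points. The
  direction comes first so that \<open>dd v\<close> is an operator that can be iterated.\<close>

definition dd :: "'a::real_normed_vector \<Rightarrow> ('a \<Rightarrow> real) \<Rightarrow> 'a \<Rightarrow> real" where
  "dd v f x = frechet_derivative f (at x) v"

lemma dd_eqI: "(f has_derivative D) (at x) \<Longrightarrow> dd v f x = D v"
  unfolding dd_def using frechet_derivative_at by metis

lemma dd_cong:
  assumes "open W" "x \<in> W" "\<And>y. y \<in> W \<Longrightarrow> f y = g y"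
  shows "dd v f x = dd v g x"
proof -
  have "(f has_derivative D) (at x) \<longleftrightarrow> (g has_derivative D) (at x)" for D
    using assms by (metis has_derivative_transform_within_open)
  then show ?thesis unfolding dd_def frechet_derivative_def by simp
qed

lemma dd_const [simp]: "dd v (\<lambda>x. c) x = 0"
  by (rule dd_eqI) simp

lemma differentiable_has_dd: "f differentiable (at x) \<Longrightarrow> (f has_derivative (\<lambda>v. dd v f x)) (at x)"
  unfolding dd_def using frechet_derivative_works by blast

lemma dd_add: "f differentiable (at x) \<Longrightarrow> g differentiable (at x) \<Longrightarrow>
    dd v (\<lambda>x. f x + g x) x = dd v f x + dd v g x"
  by (intro dd_eqI[where D = "\<lambda>v. dd v f x + dd v g x"] has_derivative_add differentiable_has_dd)

lemma dd_diff: "f differentiable (at x) \<Longrightarrow> g differentiable (at x) \<Longrightarrow>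
    dd v (\<lambda>x. f x - g x) x = dd v f x - dd v g x"
  by (intro dd_eqI[where D = "\<lambda>v. dd v f x - dd v g x"] has_derivative_diff differentiable_has_dd)

lemma dd_mult:
  assumes "f differentiable (at x)" "g differentiable (at x)"
  shows "dd v (\<lambda>x. f x * g x) x = dd v f x * g x + f x * dd v g x"
  using dd_eqI[OF has_derivative_mult[OF assms[THEN differentiable_has_dd]], of v]
  by simp

lemma dd_sum: "(\<And>i. i \<in> I \<Longrightarrow> f i differentiable (at x)) \<Longrightarrow>
    dd v (\<lambda>x. \<Sum>i\<in>I. f i x) x = (\<Sum>i\<in>I. dd v (f i) x)"
  by (intro dd_eqI[where D = "\<lambda>v. \<Sum>i\<in>I. dd v (f i) x"] has_derivative_sum differentiable_has_dd)

lemma dd_cmult: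
  assumes "f differentiable (at x)" shows "dd v (\<lambda>x. c * f x) x = c * dd v f x"
  using dd_mult[OF differentiable_const assms] by simp

lemma dd_divide_const:
  assumes "f differentiable (at x)" shows "dd v (\<lambda>x. f x / c) x = dd v f x / c"
  using dd_cmult[OF assms, of v "inverse c"] by (simp add: divide_inverse mult.commute)

lemma dd_compose:
  assumes "f differentiable (at x)" "(F has_real_derivative D) (at (f x))"
  shows "dd v (\<lambda>x. F (f x)) x = D * dd v f x"
  using dd_eqI[OF has_derivative_compose[OF differentiable_has_dd[OF assms(1)]
    assms(2)[unfolded has_field_derivative_def]], of v] by simp

lemma dd_scaleR: "f differentiable (at x) \<Longrightarrow> dd (c *\<^sub>R v) f x = c * dd v f x"
  unfolding dd_def by (simp add: linear_cmul linear_frechet_derivative)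

text \<open>On an open set the derivative within the set is the derivative itself, so the
  existential witness in \<open>Ck_on\<close> is unique there and can be replaced by
  \<open>frechet_derivative\<close>.\<close>

lemma Ck_on_Suc_frechet:
  fixes f :: "'a::real_normed_vector \<Rightarrow> 'b::real_normed_vector"
  assumes "open W" "Ck_on (Suc k) W f"
  shows "\<And>x. x \<in> W \<Longrightarrow> (f has_derivative frechet_derivative f (at x)) (at x)"
    "\<And>v. Ck_on k W (\<lambda>x. frechet_derivative f (at x) v)"
proof -
  obtain f' where f': "\<And>x. x \<in> W \<Longrightarrow> (f has_derivative f' x) (at x within W)"
    "\<And>v. Ck_on k W (\<lambda>x. f' x v)" using Ck_on_SucE[OF assms(2)] by blast
  have d: "(f has_derivative f' x) (at x)" if "x \<in> W" for x
    using f'(1)[OF that] at_within_open[OF that assms(1)] by simp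
  have eq: "frechet_derivative f (at x) = f' x" if "x \<in> W" for x
    using frechet_derivative_at[OF d[OF that]] by simp
  show "(f has_derivative frechet_derivative f (at x)) (at x)" if "x \<in> W" for x
    using d[OF that] eq[OF that] by simp
  show "Ck_on k W (\<lambda>x. frechet_derivative f (at x) v)" for v
    using f'(2)[of v] eq by (subst Ck_on_cong) auto
qed

lemma Ck_on_Suc_differentiable:
  assumes "open W" "Ck_on (Suc k) W f" "x \<in> W" shows "f differentiable (at x)"
  using Ck_on_Suc_frechet(1)[OF assms] unfolding differentiable_def by blast

lemma Ck_on_dd:
  assumes "open W" "Ck_on (Suc k) W f" shows "Ck_on k W (dd v f)"
  using Ck_on_Suc_frechet(2)[OF assms, of v] by (simp add: dd_def[abs_def])

lemma smooth_on_differentiable: "open W \<Longrightarrow> smooth_on W f \<Longrightarrow> x \<in> W \<Longrightarrow> f differentiable (at x)"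
  unfolding smooth_on_def by (rule Ck_on_Suc_differentiable) auto

lemma smooth_on_dd: "open W \<Longrightarrow> smooth_on W f \<Longrightarrow> smooth_on W (dd v f)"
  unfolding smooth_on_def using Ck_on_dd by blast

text \<open>Reduces directional derivatives to one real variable, where the mean value theorem and
  the tests for extrema apply.\<close>

lemma DERIV_along_line:
  assumes "f differentiable (at (x + a *\<^sub>R v))"
  shows "((\<lambda>a. f (x + a *\<^sub>R v)) has_real_derivative dd v f (x + a *\<^sub>R v)) (at a)"
proof -
  have "((\<lambda>a. x + a *\<^sub>R v) has_derivative (\<lambda>h. h *\<^sub>R v)) (at a)"
    by (auto intro!: derivative_eq_intros)
  from has_derivative_compose[OF this differentiable_has_dd[OF assms]]
  show ?thesis using assms
    by (simp add: has_field_derivative_def dd_scaleR mult.commute[of _ "dd v f _"])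
qed

text \<open>Two applications of the mean value theorem turn the second difference quotient into a
  value of the iterated derivative near \<open>x\<close>. The quotient is symmetric in
  \<open>v\<close> and \<open>w\<close>, which the iterated derivative is not by its
  definition.\<close>

lemma second_difference_tendsto:
  assumes W: "open W" "x \<in> W" and f: "Ck_on 2 W f" and "\<epsilon> > 0"
  obtains \<delta> where "\<delta> > 0" "\<And>s. 0 < s \<Longrightarrow> s < \<delta> \<Longrightarrow>
    \<bar>(f (x + s *\<^sub>R v + s *\<^sub>R w) - f (x + s *\<^sub>R v) - f (x + s *\<^sub>R w) + f x) / s\<^sup>2 - dd w (dd v f) x\<bar> < \<epsilon>"
proof -
  have f2: "Ck_on (Suc (Suc 0)) W f" using f by (simp add: numeral_2_eq_2 del: Ck_on.simps)
  have "continuous_on W (dd w (dd v f))"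
    using Ck_on_dd[OF W(1) Ck_on_dd[OF W(1) f2]] by simp
  then have "isCont (dd w (dd v f)) x"
    using W continuous_on_eq_continuous_at by blast
  then obtain d1 where d1: "d1 > 0" "\<And>y. dist y x < d1 \<Longrightarrow> \<bar>dd w (dd v f) y - dd w (dd v f) x\<bar> < \<epsilon>"
    using \<open>\<epsilon> > 0\<close> unfolding continuous_at_eps_delta dist_real_def by blast
  obtain d2 where d2: "d2 > 0" "ball x d2 \<subseteq> W" using W open_contains_ball by blast
  define d where "d = min d1 d2"
  have d: "d > 0" "\<And>y. dist y x < d \<Longrightarrow> y \<in> W \<and> \<bar>dd w (dd v f) y - dd w (dd v f) x\<bar> < \<epsilon>"
    using d1 d2 by (auto simp: d_def dist_commute subset_eq)
  \<comment> \<open>For steps below \<open>\<delta>\<close> the whole parallelogram spanned from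
    \<open>x\<close> stays within distance \<open>d\<close>; the summand 1 keeps the denominator
    positive when both directions vanish.\<close>
  define \<delta> where "\<delta> = d / (norm v + norm w + 1)"
  have \<delta>: "\<delta> > 0" using d(1) by (simp add: \<delta>_def add_nonneg_pos)
  have near: "dist (x + a *\<^sub>R v + b *\<^sub>R w) x < d" if "0 \<le> a" "a \<le> s" "0 \<le> b" "b \<le> s" "0 < s" "s < \<delta>" for a b s
  proof -
    have "norm (a *\<^sub>R v + b *\<^sub>R w) \<le> a * norm v + b * norm w"
      using that norm_triangle_ineq[of "a *\<^sub>R v" "b *\<^sub>R w"] by simp
    also have "\<dots> \<le> s * norm v + s * norm w"
      using that by (intro add_mono mult_right_mono) auto
    also have "\<dots> < s * (norm v + norm w + 1)" using that by (simp add: algebra_simps)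
    also have "\<dots> \<le> \<delta> * (norm v + norm w + 1)" using that by (intro mult_right_mono) auto
    also have "\<dots> = d" unfolding \<delta>_def by (smt (verit) nonzero_eq_divide_eq norm_ge_zero)
    finally show ?thesis by (simp add: dist_norm add.assoc)
  qed
  have diff: "f differentiable (at y)" "dd v f differentiable (at y)" if "y \<in> W" for y
    using that Ck_on_Suc_differentiable[OF W(1)] f2 Ck_on_dd[OF W(1) f2] by blast+
  show ?thesis
  proof (rule that[OF \<delta>])
    fix s assume s: "0 < s" "s < \<delta>"
    \<comment> \<open>The function under the mean value theorem is the increment in direction
      \<open>w\<close>, depending on the step in direction \<open>v\<close>. Its derivative is again
      an increment in direction \<open>w\<close>, to which the theorem applies a second
      time.\<close>
    have "\<exists>z. 0 < z \<and> z < s \<and> (f (x + s *\<^sub>R w + s *\<^sub>R v) - f (x + s *\<^sub>R v)) - (f (x + s *\<^sub>R w + 0 *\<^sub>R v) - f (x + 0 *\<^sub>R v))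
        = (s - 0) * (dd v f (x + s *\<^sub>R w + z *\<^sub>R v) - dd v f (x + z *\<^sub>R v))"
    proof (rule MVT2[OF s(1)])
      fix a assume a: "0 \<le> a" "a \<le> s"
      have "x + s *\<^sub>R w + a *\<^sub>R v \<in> W" "x + a *\<^sub>R v \<in> W"
        using d(2) near[of a s s] near[of a s 0] a s by (auto simp: algebra_simps)
      then show "((\<lambda>a. f (x + s *\<^sub>R w + a *\<^sub>R v) - f (x + a *\<^sub>R v)) has_real_derivative
          dd v f (x + s *\<^sub>R w + a *\<^sub>R v) - dd v f (x + a *\<^sub>R v)) (at a)"
        using diff by (intro DERIV_diff DERIV_along_line)
    qed
    then obtain z where z: "0 < z" "z < s" and z_eq:
      "f (x + s *\<^sub>R v + s *\<^sub>R w) - f (x + s *\<^sub>R v) - f (x + s *\<^sub>R w) + f x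
        = s * (dd v f (x + z *\<^sub>R v + s *\<^sub>R w) - dd v f (x + z *\<^sub>R v))"
      by (auto simp: algebra_simps)
    have "\<exists>y. 0 < y \<and> y < s \<and> dd v f (x + z *\<^sub>R v + s *\<^sub>R w) - dd v f (x + z *\<^sub>R v + 0 *\<^sub>R w)
        = (s - 0) * dd w (dd v f) (x + z *\<^sub>R v + y *\<^sub>R w)"
    proof (rule MVT2[OF s(1)])
      fix b assume b: "0 \<le> b" "b \<le> s"
      have "x + z *\<^sub>R v + b *\<^sub>R w \<in> W"
        using d(2) near[of z s b] b s z by auto
      then show "((\<lambda>b. dd v f (x + z *\<^sub>R v + b *\<^sub>R w)) has_real_derivative
          dd w (dd v f) (x + z *\<^sub>R v + b *\<^sub>R w)) (at b)"
        using diff by (intro DERIV_along_line)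
    qed
    then obtain y where y: "0 < y" "y < s" and "dd v f (x + z *\<^sub>R v + s *\<^sub>R w) - dd v f (x + z *\<^sub>R v)
        = s * dd w (dd v f) (x + z *\<^sub>R v + y *\<^sub>R w)" by auto
    then have "(f (x + s *\<^sub>R v + s *\<^sub>R w) - f (x + s *\<^sub>R v) - f (x + s *\<^sub>R w) + f x) / s\<^sup>2
        = dd w (dd v f) (x + z *\<^sub>R v + y *\<^sub>R w)"
      using z_eq s(1) by (simp add: power2_eq_square)
    then show "\<bar>(f (x + s *\<^sub>R v + s *\<^sub>R w) - f (x + s *\<^sub>R v) - f (x + s *\<^sub>R w) + f x) / s\<^sup>2
        - dd w (dd v f) x\<bar> < \<epsilon>"
      using d(2)[OF near[of z s y]] z y s by simp
  qed
qed

text \<open>Both mixed derivatives are limits of the same second difference quotient. If they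
  differed, half their distance taken as \<open>\<epsilon>\<close> for both limits would contradict
  the triangle inequality.\<close>

lemma dd_commute:
  assumes W: "open W" "x \<in> W" and f: "Ck_on 2 W f"
  shows "dd v (dd w f) x = dd w (dd v f) x"
proof (rule ccontr)
  assume neq: "dd v (dd w f) x \<noteq> dd w (dd v f) x"
  define \<epsilon> where "\<epsilon> = \<bar>dd v (dd w f) x - dd w (dd v f) x\<bar> / 2"
  have \<epsilon>: "\<epsilon> > 0" using neq by (simp add: \<epsilon>_def)
  obtain d1 where d1: "d1 > 0" "\<And>s. 0 < s \<Longrightarrow> s < d1 \<Longrightarrow>
    \<bar>(f (x + s *\<^sub>R v + s *\<^sub>R w) - f (x + s *\<^sub>R v) - f (x + s *\<^sub>R w) + f x) / s\<^sup>2 - dd w (dd v f) x\<bar> < \<epsilon>"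
    using second_difference_tendsto[OF W f \<epsilon>] by metis
  obtain d2 where d2: "d2 > 0" "\<And>s. 0 < s \<Longrightarrow> s < d2 \<Longrightarrow>
    \<bar>(f (x + s *\<^sub>R w + s *\<^sub>R v) - f (x + s *\<^sub>R w) - f (x + s *\<^sub>R v) + f x) / s\<^sup>2 - dd v (dd w f) x\<bar> < \<epsilon>"
    using second_difference_tendsto[OF W f \<epsilon>] by metis
  define s where "s = min d1 d2 / 2"
  have s: "0 < s" "s < d1" "s < d2" using d1(1) d2(1) by (auto simp: s_def)
  define Q where "Q = (f (x + s *\<^sub>R v + s *\<^sub>R w) - f (x + s *\<^sub>R v) - f (x + s *\<^sub>R w) + f x) / s\<^sup>2"
  have "(f (x + s *\<^sub>R w + s *\<^sub>R v) - f (x + s *\<^sub>R w) - f (x + s *\<^sub>R v) + f x) / s\<^sup>2 = Q"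
    by (simp add: Q_def add.assoc add.commute[of "s *\<^sub>R w"])
  then have "\<bar>Q - dd w (dd v f) x\<bar> < \<epsilon>" "\<bar>Q - dd v (dd w f) x\<bar> < \<epsilon>"
    using d1(2)[OF s(1,2)] d2(2)[OF s(1,3)] unfolding Q_def by metis+
  moreover have "2 * \<epsilon> = \<bar>dd v (dd w f) x - dd w (dd v f) x\<bar>" by (simp add: \<epsilon>_def)
  ultimately show False by linarith
qed

lemma smooth_on_dd_commute:
  "open W \<Longrightarrow> smooth_on W f \<Longrightarrow> x \<in> W \<Longrightarrow> dd v (dd w f) x = dd w (dd v f) x"
  unfolding smooth_on_def using dd_commute by blast

lemma dd_slice_fst:
  assumes "f differentiable (at (x, t))"
  shows "(\<lambda>x. f (x, t)) differentiable (at x)" "dd v (\<lambda>x. f (x, t)) x = dd (v, 0) f (x, t)"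
proof -
  have "((\<lambda>x. (x, t)) has_derivative (\<lambda>v. (v, 0))) (at x)"
    by (auto intro!: derivative_eq_intros)
  from has_derivative_compose[OF this differentiable_has_dd[OF assms]]
  show "(\<lambda>x. f (x, t)) differentiable (at x)" "dd v (\<lambda>x. f (x, t)) x = dd (v, 0) f (x, t)"
    by (auto simp: differentiable_def intro: dd_eqI)
qed

lemma has_derivative_slice_snd:
  assumes "f differentiable (at (x, t))"
  shows "((\<lambda>t. f (x, t)) has_real_derivative dd (0, 1) f (x, t)) (at t)"
  using DERIV_along_line[of f "(x, 0)" t "(0, 1)"] assms by simp

section \<open>Smooth changes of coordinates\<close>

lemma frechet_derivative_matrix:
  fixes f :: "real^'n \<Rightarrow> real^'m"
  assumes "f differentiable (at x)"
  shows "matrix (frechet_derivative f (at x)) *v v = frechet_derivative f (at x) v"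
  using linear_frechet_derivative[OF assms] by simp

lemma smooth_on_frechet:
  assumes "open W" "smooth_on W f"
  shows "\<And>x. x \<in> W \<Longrightarrow> (f has_derivative frechet_derivative f (at x)) (at x)"
    "\<And>v. smooth_on W (\<lambda>x. frechet_derivative f (at x) v)"
  using Ck_on_Suc_frechet[OF assms(1)] assms(2) unfolding smooth_on_def by blast+

lemma smooth_on_jacobi_matrix:
  fixes f :: "real^'n \<Rightarrow> real^'m"
  assumes "open W" "smooth_on W f"
  shows "smooth_on W (\<lambda>x. matrix (frechet_derivative f (at x)))"
  unfolding matrix_def by (intro smooth_intros smooth_on_frechet[OF assms])

text \<open>The inverse function theorem gives a differentiable inverse \<open>g\<close> whose
  derivative at \<open>y\<close> is the inverse Jacobi matrix at \<open>g y\<close>. Smoothness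
  follows by bootstrapping: if \<open>g\<close> is of class C^k, so is this derivative, hence
  \<open>g\<close> is of class C^(k+1).\<close>

lemma smooth_local_inverse:
  fixes f :: "real^'n \<Rightarrow> real^'n"
  assumes S: "open S" "x0 \<in> S" and f: "smooth_on S f"
    and inv: "invertible (matrix (frechet_derivative f (at x0)))"
  obtains U V g where "open U" "U \<subseteq> S" "x0 \<in> U" "open V" "f x0 \<in> V" "homeomorphism U V f g" "smooth_on V g"
proof -
  define f' where "f' x = Blinfun (frechet_derivative f (at x))" for x
  have bl: "bounded_linear (frechet_derivative f (at x))" if "x \<in> S" for x
    using smooth_on_frechet(1)[OF S(1) f that] has_derivative_bounded_linear by blast
  have f': "blinfun_apply (f' x) = frechet_derivative f (at x)" if "x \<in> S" for x
    unfolding f'_def by (simp add: bounded_linear_Blinfun_apply bl that)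
  have der: "(f has_derivative blinfun_apply (f' x)) (at x)" if "x \<in> S" for x
    using smooth_on_frechet(1)[OF S(1) f that] f'[OF that] by simp
  have cont: "continuous_on S f'"
  proof (rule continuous_on_blinfun_componentwise)
    fix i :: "real^'n"
    have "continuous_on S (\<lambda>x. frechet_derivative f (at x) i)"
      by (rule smooth_on_continuous[OF smooth_on_frechet(2)[OF S(1) f]])
    then show "continuous_on S (\<lambda>x. blinfun_apply (f' x) i)"
      by (subst continuous_on_cong[OF refl]) (auto simp: f')
  qed
  define J where "J x = matrix (frechet_derivative f (at x))" for x
  have dJ: "f differentiable (at x)" if "x \<in> S" for x
    using der[OF that] differentiable_def by blast
  have J: "J x *v v = frechet_derivative f (at x) v" if "x \<in> S" for x v
    unfolding J_def using frechet_derivative_matrix[OF dJ[OF that]] .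
  define invf where "invf = Blinfun (\<lambda>v. matrix_inv (J x0) *v v)"
  have "invf o\<^sub>L f' x0 = id_blinfun"
  proof (rule blinfun_eqI)
    fix v
    have "blinfun_apply (invf o\<^sub>L f' x0) v = matrix_inv (J x0) *v (J x0 *v v)"
      using S(2) by (simp add: invf_def bounded_linear_Blinfun_apply f' J)
    also have "\<dots> = v"
      using matrix_inv_mult(2)[OF inv] by (simp add: matrix_vector_mul_assoc J_def)
    finally show "blinfun_apply (invf o\<^sub>L f' x0) v = blinfun_apply id_blinfun v" by simp
  qed
  from inverse_function_theorem[OF S(1) der cont S(2) this]
  obtain U V g g' where U: "open U" "U \<subseteq> S" "x0 \<in> U" and V: "open V" "f x0 \<in> V" and h: "homeomorphism U V f g"
    and g: "\<And>y. y \<in> V \<Longrightarrow> (g has_derivative (g' y)) (at y)"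
    "\<And>y. y \<in> V \<Longrightarrow> g' y = Hilbert_Choice.inv (blinfun_apply (f' (g y)))"
    "\<And>y. y \<in> V \<Longrightarrow> bij (blinfun_apply (f' (g y)))" by metis
  have gU: "g y \<in> U" if "y \<in> V" for y using h that unfolding homeomorphism_def by blast
  have fgU: "f x \<in> V" "g (f x) = x" if "x \<in> U" for x using h that unfolding homeomorphism_def by blast+
  \<comment> \<open>The derivative is bijective on all of \<open>U\<close>, not only at
    \<open>x0\<close>, so the matrix inverse is available wherever \<open>g\<close> takes its
    values.\<close>
  have inv': "invertible (J x)" if "x \<in> U" for x
  proof -
    have "x \<in> S" using that U by blast
    have "bij ((*v) (J x))"
    proof -
      have "(*v) (J x) = blinfun_apply (f' x)" using J[OF \<open>x \<in> S\<close>] f'[OF \<open>x \<in> S\<close>] by auto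
      then show ?thesis using g(3)[of "f x"] fgU[OF that] by simp
    qed
    then show ?thesis using invertible_eq_bij by blast
  qed
  have g'_eq: "g' y = (\<lambda>v. matrix_inv (J (g y)) *v v)" if "y \<in> V" for y
  proof
    fix v
    have gS: "g y \<in> S" using gU[OF that] U by blast
    have "blinfun_apply (f' (g y)) (matrix_inv (J (g y)) *v v) = v"
      using matrix_inv_mult(1)[OF inv'[OF gU[OF that]]] by (simp add: f'[OF gS] J[OF gS, symmetric] matrix_vector_mul_assoc)
    then show "g' y v = matrix_inv (J (g y)) *v v"
      using g(2,3)[OF that] by (metis bij_inv_eq_iff)
  qed
  have sJ: "smooth_on U (\<lambda>x. matrix_inv (J x))"
    unfolding J_def
    by (intro smooth_intros smooth_on_subset[OF smooth_on_jacobi_matrix[OF S(1) f] U(2)] inv'[unfolded J_def])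
  have "Ck_on k V g" for k
  proof (induction k)
    case 0
    then show ?case using h by (simp add: homeomorphism_def)
  next
    case (Suc k)
    have "Ck_on k V (\<lambda>y. matrix_inv (J (g y)))"
      using Ck_on_compose[OF Suc, of U "\<lambda>x. matrix_inv (J x)"] sJ gU unfolding smooth_on_def by blast
    then have "Ck_on k V (\<lambda>y. matrix_inv (J (g y)) *v v)" for v
    proof -
      have "bounded_linear (\<lambda>M :: real^'n^'n. M *v v)"
        unfolding linear_conv_bounded_linear[symmetric]
        by (intro linearI) (simp_all add: matrix_vector_mult_add_rdistrib scaleR_matrix_vector_assoc)
      then show ?thesis
        by (rule Ck_on_linear_compose) fact
    qed
    then show ?case
      using g(1) g'_eq by (intro Ck_on_SucI[of V g "\<lambda>y v. matrix_inv (J (g y)) *v v"])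
        (auto intro: has_derivative_at_withinI)
  qed
  then have "smooth_on V g" by (simp add: smooth_on_def)
  then show ?thesis using that U V h by blast
qed

section \<open>Charts, their inverses and their reparametrizations\<close>

abbreviation chart_image :: "('a, 'n::finite) chart \<Rightarrow> (real^'n) set" where
  "chart_image c \<equiv> chart_map c ` chart_dom c"

lemma is_chartD:
  assumes "is_chart X c"
  shows "openin X (chart_dom c)" "open (chart_image c)" "inj_on (chart_map c) (chart_dom c)"
    "continuous_map (subtopology X (chart_dom c)) euclidean (chart_map c)"
    "continuous_map (top_of_set (chart_image c)) X (chart_inv c)"
proof -
  have hm: "homeomorphic_map (subtopology X (chart_dom c)) (top_of_set (chart_image c)) (chart_map c)"
    using assms by (simp add: is_chart_def)
  show o: "openin X (chart_dom c)" "open (chart_image c)" using assms by (auto simp: is_chart_def)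
  have ts: "topspace (subtopology X (chart_dom c)) = chart_dom c"
    using openin_subset[OF o(1)] by auto
  show inj: "inj_on (chart_map c) (chart_dom c)"
    using homeomorphic_imp_injective_map[OF hm] ts by simp
  show "continuous_map (subtopology X (chart_dom c)) euclidean (chart_map c)"
    using homeomorphic_imp_continuous_map[OF hm] continuous_map_in_subtopology by blast
  obtain g where g: "homeomorphic_maps (subtopology X (chart_dom c)) (top_of_set (chart_image c)) (chart_map c) g"
    using hm by (auto simp: homeomorphic_map_maps)
  have "continuous_map (top_of_set (chart_image c)) X g"
    using g unfolding homeomorphic_maps_def continuous_map_in_subtopology by blast
  moreover have "g x = chart_inv c x" if "x \<in> topspace (top_of_set (chart_image c))" for x
  proof -
    have "g x \<in> chart_dom c" "chart_map c (g x) = x"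
      using g that ts unfolding homeomorphic_maps_def continuous_map_in_subtopology continuous_map_def by auto
    then show ?thesis unfolding chart_inv_def using inj by (metis inv_into_f_f)
  qed
  ultimately show "continuous_map (top_of_set (chart_image c)) X (chart_inv c)"
    by (rule continuous_map_eq)
qed

lemma chart_inv_in [simp]: "x \<in> chart_image c \<Longrightarrow> chart_inv c x \<in> chart_dom c"
  and chart_map_inv [simp]: "x \<in> chart_image c \<Longrightarrow> chart_map c (chart_inv c x) = x"
  unfolding chart_inv_def by (auto simp: inv_into_into f_inv_into_f)

lemma chart_inv_map: "is_chart X c \<Longrightarrow> p \<in> chart_dom c \<Longrightarrow> chart_inv c (chart_map c p) = p"
  unfolding chart_inv_def using is_chartD(3) inv_into_f_f by fast

lemma open_chart_overlap:
  assumes "is_chart X c" "is_chart X d"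
  shows "open (chart_map c ` (chart_dom c \<inter> chart_dom d))"
proof -
  have "openin (top_of_set (chart_image c)) (chart_map c ` (chart_dom c \<inter> chart_dom d))"
  proof -
    have "homeomorphic_map (subtopology X (chart_dom c)) (top_of_set (chart_image c)) (chart_map c)"
      using assms by (simp add: is_chart_def)
    moreover have "openin (subtopology X (chart_dom c)) (chart_dom c \<inter> chart_dom d)"
      using is_chartD(1)[OF assms(2)] openin_subtopology_Int2 by blast
    ultimately show ?thesis using homeomorphic_imp_open_map open_map_def by blast
  qed
  then show ?thesis using is_chartD(2)[OF assms(1)] openin_open_trans by blast
qed

lemma smooth_structureD:
  assumes "smooth_structure X \<A>"
  shows "c \<in> \<A> \<Longrightarrow> is_chart X c" "(\<Union>c\<in>\<A>. chart_dom c) = topspace X"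
    "c \<in> \<A> \<Longrightarrow> d \<in> \<A> \<Longrightarrow> smooth_transition c d"
    "is_chart X c \<Longrightarrow> (\<And>d. d \<in> \<A> \<Longrightarrow> smooth_transition c d \<and> smooth_transition d c) \<Longrightarrow> c \<in> \<A>"
  using assms unfolding smooth_structure_def by blast+

text \<open>The new coordinate map is \<open>\<phi>\<close> after the old one. Its transition maps
  to and from a chart of the atlas are those of \<open>c\<close> composed with \<open>\<psi>\<close>
  or \<open>\<phi>\<close>, hence smooth, and maximality of the atlas makes the new chart a
  member.\<close>

lemma reparametrized_chart:
  fixes c :: "('a, 'n::finite) chart" and \<psi> \<phi> :: "real^'n \<Rightarrow> real^'n"
  assumes A: "smooth_structure X \<A>" and c: "c \<in> \<A>"
    and UV: "open U" "open V" "V \<subseteq> chart_image c" and h: "homeomorphism U V \<psi> \<phi>"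
    and s: "smooth_on U \<psi>" "smooth_on V \<phi>"
  defines "c' \<equiv> ({p \<in> chart_dom c. chart_map c p \<in> V}, \<lambda>p. \<phi> (chart_map c p))"
  shows "c' \<in> \<A>" "chart_image c' = U" "\<And>z. z \<in> U \<Longrightarrow> chart_inv c' z = chart_inv c (\<psi> z)"
proof -
  have ch: "is_chart X c" using smooth_structureD(1)[OF A c] .
  have \<psi>: "\<psi> z \<in> V" "\<phi> (\<psi> z) = z" if "z \<in> U" for z
    using h that unfolding homeomorphism_def by blast+
  have \<phi>: "\<phi> y \<in> U" "\<psi> (\<phi> y) = y" if "y \<in> V" for y
    using h that unfolding homeomorphism_def by blast+
  have inj: "inj_on \<phi> V" by (rule inj_on_inverseI) (rule \<phi>(2))
  have Vc: "y \<in> chart_image c" if "y \<in> V" for y using that UV by blast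
  show im: "chart_image c' = U"
  proof
    show "chart_image c' \<subseteq> U" using \<phi> by (auto simp: c'_def)
    show "U \<subseteq> chart_image c'"
    proof
      fix z assume z: "z \<in> U"
      then have "chart_inv c (\<psi> z) \<in> chart_dom c'" "chart_map c' (chart_inv c (\<psi> z)) = z"
        using \<psi>[OF z] Vc[OF \<psi>(1)[OF z]] by (auto simp: c'_def)
      then show "z \<in> chart_image c'" by (metis imageI)
    qed
  qed
  have dom: "chart_dom c' \<subseteq> chart_dom c" by (auto simp: c'_def)
  have inj': "inj_on (chart_map c') (chart_dom c')"
    using is_chartD(3)[OF ch] inj unfolding c'_def inj_on_def by auto
  show inv: "chart_inv c' z = chart_inv c (\<psi> z)" if z: "z \<in> U" for z
  proof -
    have "chart_inv c (\<psi> z) \<in> chart_dom c'" "chart_map c' (chart_inv c (\<psi> z)) = z"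
      using \<psi>[OF z] Vc[OF \<psi>(1)[OF z]] by (auto simp: c'_def)
    then show ?thesis unfolding chart_inv_def[of c'] using inj' by (metis inv_into_f_f)
  qed
  have op: "openin X (chart_dom c')"
  proof -
    have "openin (subtopology X (chart_dom c)) {x \<in> topspace (subtopology X (chart_dom c)). chart_map c x \<in> V}"
      by (rule openin_continuous_map_preimage[OF is_chartD(4)[OF ch]]) (use UV in simp)
    moreover have "topspace (subtopology X (chart_dom c)) = chart_dom c"
      using openin_subset[OF is_chartD(1)[OF ch]] by auto
    ultimately show ?thesis
      using is_chartD(1)[OF ch] openin_trans_full by (fastforce simp: c'_def)
  qed
  have hm: "homeomorphic_maps (subtopology X (chart_dom c')) (top_of_set U) (chart_map c') (\<lambda>z. chart_inv c (\<psi> z))"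
    unfolding homeomorphic_maps_def
  proof (intro conjI ballI)
    have c1: "continuous_map (subtopology X (chart_dom c')) (top_of_set V) (chart_map c)"
      using continuous_map_from_subtopology_mono[OF is_chartD(4)[OF ch] dom]
      by (auto simp: continuous_map_in_subtopology c'_def)
    have "continuous_map (top_of_set V) (top_of_set U) \<phi>"
      using h by (auto simp: homeomorphism_def)
    from continuous_map_compose[OF c1 this]
    show "continuous_map (subtopology X (chart_dom c')) (top_of_set U) (chart_map c')"
      by (simp add: c'_def o_def)
    have c2: "continuous_map (top_of_set U) (top_of_set (chart_image c)) \<psi>"
      using h UV by (auto simp: homeomorphism_def)
    from continuous_map_compose[OF c2 is_chartD(5)[OF ch]]
    have "continuous_map (top_of_set U) X (\<lambda>z. chart_inv c (\<psi> z))" by (simp add: o_def)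
    then show "continuous_map (top_of_set U) (subtopology X (chart_dom c')) (\<lambda>z. chart_inv c (\<psi> z))"
      using \<psi> Vc by (auto simp: continuous_map_in_subtopology c'_def)
    show "chart_inv c (\<psi> (chart_map c' x)) = x" if "x \<in> topspace (subtopology X (chart_dom c'))" for x
      using that \<phi> chart_inv_map[OF ch] by (auto simp: c'_def)
    show "chart_map c' (chart_inv c (\<psi> y)) = y" if "y \<in> topspace (top_of_set U)" for y
      using that \<psi> Vc by (auto simp: c'_def)
  qed
  have ch': "is_chart X c'"
    unfolding is_chart_def using op hm UV im by (auto simp: homeomorphic_map_maps)
  show "c' \<in> \<A>"
  proof (rule smooth_structureD(4)[OF A ch'], intro conjI)
    fix d assume d: "d \<in> \<A>"
    have chd: "is_chart X d" using smooth_structureD(1)[OF A d] .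
    have cd: "smooth_on (chart_map c ` (chart_dom c \<inter> chart_dom d)) (chart_map d \<circ> chart_inv c)"
      using smooth_structureD(3)[OF A c d] by (simp add: smooth_transition_def)
    have dc: "smooth_on (chart_map d ` (chart_dom d \<inter> chart_dom c)) (chart_map c \<circ> chart_inv d)"
      using smooth_structureD(3)[OF A d c] by (simp add: smooth_transition_def)
    show "smooth_transition c' d"
      unfolding smooth_transition_def
    proof (subst smooth_on_cong)
      let ?S = "chart_map c' ` (chart_dom c' \<inter> chart_dom d)"
      have S: "?S \<subseteq> U" using im by blast
      show "(chart_map d \<circ> chart_inv c') x = (chart_map d \<circ> chart_inv c) (\<psi> x)" if "x \<in> ?S" for x
        using inv[of x] that S by auto
      show "smooth_on ?S (\<lambda>x. (chart_map d \<circ> chart_inv c) (\<psi> x))"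
      proof (rule smooth_on_compose[OF smooth_on_subset[OF s(1) S] cd])
        show "\<psi> ` ?S \<subseteq> chart_map c ` (chart_dom c \<inter> chart_dom d)"
          using \<phi> by (auto simp: c'_def)
      qed
    qed
    show "smooth_transition d c'"
      unfolding smooth_transition_def
    proof (subst smooth_on_cong)
      let ?S = "chart_map d ` (chart_dom d \<inter> chart_dom c')"
      show "(chart_map c' \<circ> chart_inv d) x = \<phi> ((chart_map c \<circ> chart_inv d) x)" if "x \<in> ?S" for x
        by (simp add: c'_def)
      show "smooth_on ?S (\<lambda>x. \<phi> ((chart_map c \<circ> chart_inv d) x))"
      proof (rule smooth_on_compose[OF smooth_on_subset[OF dc] s(2)])
        show "?S \<subseteq> chart_map d ` (chart_dom d \<inter> chart_dom c)" using dom by blast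
        show "(chart_map c \<circ> chart_inv d) ` ?S \<subseteq> V"
          using chart_inv_map[OF chd] by (auto simp: c'_def)
      qed
    qed
  qed
qed

text \<open>Lets a chart be prescribed by a formula for the inverse change of coordinates
  \<open>\<psi>\<close>; the inverse function theorem supplies the neighbourhood of 0. As
  \<open>\<psi>\<close> is the transition map from \<open>c'\<close> to \<open>c\<close>, the
  transformation law of tensors involves just its derivative.\<close>

lemma reparametrized_chart_exists:
  fixes c :: "('a, 'n::finite) chart" and \<psi> :: "real^'n \<Rightarrow> real^'n"
  assumes A: "smooth_structure X \<A>" and c: "c \<in> \<A>" and p: "p \<in> chart_dom c"
    and \<psi>: "smooth_on UNIV \<psi>" "\<psi> 0 = chart_map c p"
    and inv: "invertible (matrix (frechet_derivative \<psi> (at 0)))"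
  obtains c' where "c' \<in> \<A>" "p \<in> chart_dom c'" "chart_map c' p = 0" "chart_dom c' \<subseteq> chart_dom c"
    "\<And>z. z \<in> chart_image c' \<Longrightarrow> chart_inv c' z = chart_inv c (\<psi> z)"
    "\<And>z. z \<in> chart_image c' \<Longrightarrow> \<psi> z \<in> chart_image c"
    "\<And>z. z \<in> chart_image c' \<Longrightarrow> jacobian c' c (chart_inv c' z) = matrix (frechet_derivative \<psi> (at z))"
proof -
  have ch: "is_chart X c" using smooth_structureD(1)[OF A c] .
  define S where "S = \<psi> -` chart_image c"
  have S: "open S" "0 \<in> S"
    unfolding S_def using is_chartD(2)[OF ch] smooth_on_continuous[OF \<psi>(1)] p \<psi>(2)
    by (auto intro!: open_vimage)
  obtain U V \<phi> where U: "open U" "U \<subseteq> S" "0 \<in> U" "open V" "\<psi> 0 \<in> V" and h: "homeomorphism U V \<psi> \<phi>"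
    and \<phi>: "smooth_on V \<phi>"
    using smooth_local_inverse[OF S smooth_on_subset[OF \<psi>(1)] inv] by auto
  have V: "V \<subseteq> chart_image c"
    using h U(2) unfolding homeomorphism_def S_def by blast
  define c' where "c' = ({p \<in> chart_dom c. chart_map c p \<in> V}, \<lambda>p. \<phi> (chart_map c p))"
  have sU: "smooth_on U \<psi>" using smooth_on_subset[OF \<psi>(1)] by blast
  note R = reparametrized_chart[OF A c U(1,4) V h sU \<phi>, folded c'_def]
  show ?thesis
  proof
    show "c' \<in> \<A>" by (rule R(1))
    show "p \<in> chart_dom c'" using p \<psi> U by (simp add: c'_def)
    show "chart_map c' p = 0"
      using h U(3) \<psi>(2) by (simp add: c'_def homeomorphism_def flip: \<psi>(2))
    show "chart_dom c' \<subseteq> chart_dom c" by (auto simp: c'_def)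
    show i: "chart_inv c' z = chart_inv c (\<psi> z)" if "z \<in> chart_image c'" for z
      using R(2,3) that by blast
    show im: "\<psi> z \<in> chart_image c" if "z \<in> chart_image c'" for z
      using R(2) U(2) that by (auto simp: S_def)
    show "jacobian c' c (chart_inv c' z) = matrix (frechet_derivative \<psi> (at z))" if z: "z \<in> chart_image c'" for z
    proof -
      have zU: "z \<in> U" using z R(2) by blast
      have "\<psi> differentiable at z"
        using smooth_on_frechet(1)[OF open_UNIV \<psi>(1)] differentiable_def by blast
      then have "frechet_derivative \<psi> (at z) = frechet_derivative (chart_map c \<circ> chart_inv c') (at z)"
      proof (rule frechet_derivative_transform_within_open[OF _ U(1) zU])
        show "\<psi> x = (chart_map c \<circ> chart_inv c') x" if "x \<in> U" for x
          using i[of x] im[of x] R(2) that by auto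
      qed
      then show ?thesis using z by (simp add: jacobian_def)
    qed
  qed
qed

section \<open>The evolution equation at the origin of normal coordinates\<close>

lemma delta_sum [simp]:
  fixes F :: "'n::finite \<Rightarrow> real"
  shows "(\<Sum>j\<in>UNIV. (if i = j then 1 else 0) * F j) = F i"
    "(\<Sum>j\<in>UNIV. (if j = i then 1 else 0) * F j) = F i"
    "(\<Sum>j\<in>UNIV. F j * (if i = j then 1 else 0)) = F i"
    "(\<Sum>j\<in>UNIV. F j * (if j = i then 1 else 0)) = F i"
  by (simp_all add: if_distrib[of "\<lambda>x. x * _"] if_distrib[of "\<lambda>x. _ * x"] cong: if_cong)

lemma dd_triple_product:
  assumes "f1 differentiable (at x)" "f2 differentiable (at x)" "f3 differentiable (at x)"
  shows "dd v (\<lambda>x. f1 x * f2 x * f3 x) x =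
    dd v f1 x * f2 x * f3 x + f1 x * dd v f2 x * f3 x + f1 x * f2 x * dd v f3 x"
  using assms by (simp add: dd_mult algebra_simps differentiable_mult)

text \<open>Applied with \<open>f1\<close> a component of the inverse metric: its first derivative
  vanishes at the normal point, so the only cross term left is that of \<open>f2\<close> and
  \<open>f3\<close>.\<close>

lemma dd_dd_triple_product:
  assumes W: "open W" "x \<in> W" and s: "smooth_on W f1" "smooth_on W f2" "smooth_on W f3"
    and z: "dd v f1 x = 0"
  shows "dd v (dd v (\<lambda>x. f1 x * f2 x * f3 x)) x =
    dd v (dd v f1) x * f2 x * f3 x + f1 x * dd v (dd v f2) x * f3 x
      + f1 x * f2 x * dd v (dd v f3) x + 2 * f1 x * dd v f2 x * dd v f3 x"
proof -
  note d = smooth_on_differentiable[OF W(1)] smooth_on_dd[OF W(1)]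
  have "dd v (dd v (\<lambda>x. f1 x * f2 x * f3 x)) x =
    dd v (\<lambda>x. dd v f1 x * f2 x * f3 x + f1 x * dd v f2 x * f3 x + f1 x * f2 x * dd v f3 x) x"
    using s by (intro dd_cong[OF W] dd_triple_product d(1)) auto
  also have "\<dots> = dd v (dd v f1) x * f2 x * f3 x + f1 x * dd v (dd v f2) x * f3 x
      + f1 x * f2 x * dd v (dd v f3) x + 2 * f1 x * dd v f2 x * dd v f3 x"
    by (simp add: dd_add dd_mult d(1)[OF _ W(2)] d(2) smooth_intros s z algebra_simps)
  finally show ?thesis .
qed

text \<open>Calculus in one chart on space-time, with the metric \<open>gm\<close>, its inverse
  \<open>gi\<close> and \<open>f\<close> in the role of the logarithm of the solution. Space and
  time form one variable, so that both kinds of derivative are instances of \<open>dd\<close> and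
  commute by \<open>smooth_on_dd_commute\<close>.\<close>

locale local_metric =
  fixes W :: "((real^'n::finite) \<times> real) set"
    and gm gi :: "'n \<Rightarrow> 'n \<Rightarrow> (real^'n) \<times> real \<Rightarrow> real" and f :: "(real^'n) \<times> real \<Rightarrow> real"
  assumes open_W: "open W"
    and s_gm: "smooth_on W (gm i j)" and s_gi: "smooth_on W (gi i j)" and s_f: "smooth_on W f"
    and gi_gm: "y \<in> W \<Longrightarrow> (\<Sum>j\<in>UNIV. gi i j y * gm j k y) = (if i = k then 1 else 0)"
    and gm_sym: "y \<in> W \<Longrightarrow> gm i j y = gm j i y"
begin

abbreviation "D k \<equiv> dd (axis k 1, 0)"
abbreviation "Dt \<equiv> dd (0, 1)"

definition Chr :: "'n \<Rightarrow> 'n \<Rightarrow> 'n \<Rightarrow> (real^'n) \<times> real \<Rightarrow> real" where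
  "Chr k i j y = (\<Sum>l\<in>UNIV. gi k l y * (D i (gm j l) y + D j (gm i l) y - D l (gm i j) y)) / 2"

definition gradsq :: "(real^'n) \<times> real \<Rightarrow> real" where
  "gradsq y = (\<Sum>i\<in>UNIV. \<Sum>j\<in>UNIV. gi i j y * D i f y * D j f y)"

definition Lap :: "(real^'n) \<times> real \<Rightarrow> real" where
  "Lap y = (\<Sum>i\<in>UNIV. \<Sum>j\<in>UNIV. gi i j y * (D i (D j f) y - (\<Sum>k\<in>UNIV. Chr k i j y * D k f y)))"

lemmas s_dd = smooth_on_dd[OF open_W]
lemmas s_basic = smooth_intros s_dd s_gm s_gi s_f

lemma s_Chr: "smooth_on W (Chr k i j)"
  unfolding Chr_def[abs_def] by (intro s_basic) auto

lemma s_gradsq: "smooth_on W gradsq"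
  unfolding gradsq_def[abs_def] by (intro s_basic)

lemma s_Lap: "smooth_on W Lap"
  unfolding Lap_def[abs_def] by (intro s_basic s_Chr)

end

text \<open>Only first derivatives of the metric in space vanish, and only at \<open>z\<close>: the
  second derivatives carry the curvature and the time derivative carries \<open>h\<close>.\<close>

locale normal_point = local_metric W gm gi f
  for W :: "((real^'n::finite) \<times> real) set" and gm gi f +
  fixes z :: "(real^'n) \<times> real"
  assumes z_in_W: "z \<in> W"
    and gm_z: "gm i j z = (if i = j then 1 else 0)"
    and dgm_z: "dd (axis k 1, 0) (gm i j) z = 0"
begin

lemmas W = open_W z_in_W

text \<open>The Ricci tensor at \<open>z\<close>, where the terms quadratic in the Christoffel
  symbols vanish.\<close>

definition Rc :: "'n \<Rightarrow> 'n \<Rightarrow> real" where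
  "Rc j k = (\<Sum>i\<in>UNIV. D i (Chr i j k) z - D j (Chr i i k) z)"

text \<open>Under the flow these are \<open>h\<close> and, since the Christoffel symbols vanish at
  \<open>z\<close>, the covariant derivative of \<open>h\<close>.\<close>

abbreviation "hh i j \<equiv> Dt (gm i j) z / 2"
abbreviation "dh k i j \<equiv> D k (Dt (gm i j)) z / 2"

lemmas diff = smooth_on_differentiable[OF W(1) _ W(2)]
lemmas dd_rules = dd_sum dd_add dd_diff dd_mult dd_divide_const diff s_basic

lemma gi_z: "gi i j z = (if i = j then 1 else 0)"
  using gi_gm[OF W(2), of i j] by (simp add: gm_z)

lemma D_commute: "smooth_on W \<phi> \<Longrightarrow> dd v (dd w \<phi>) z = dd w (dd v \<phi>) z"
  by (rule smooth_on_dd_commute[OF W(1) _ W(2)])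

text \<open>Differentiate \<open>gi_gm\<close>; both matrices are the identity at \<open>z\<close>.
  The direction is arbitrary, so the time derivative of the inverse metric is covered as
  well.\<close>

lemma dd_gi: "dd v (gi i k) z = - dd v (gm i k) z"
proof -
  have "dd v (\<lambda>y. \<Sum>j\<in>UNIV. gi i j y * gm j k y) z = dd v (\<lambda>y. if i = k then 1 else 0) z"
    by (rule dd_cong[OF W gi_gm])
  moreover have "dd v (\<lambda>y. \<Sum>j\<in>UNIV. gi i j y * gm j k y) z
      = (\<Sum>j\<in>UNIV. dd v (gi i j) z * gm j k z + gi i j z * dd v (gm j k) z)"
    by (simp add: dd_rules)
  ultimately show ?thesis by (simp add: gm_z gi_z sum.distrib)
qed

lemma D_gi: "D l (gi i k) z = 0"
  by (simp add: dd_gi dgm_z)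

lemma D_D_gi: "D m (D l (gi i k)) z = - D m (D l (gm i k)) z"
proof -
  \<comment> \<open>The identity differentiated once is needed on all of \<open>W\<close>, because
    it is differentiated again at \<open>z\<close>.\<close>
  have 1: "(\<Sum>j\<in>UNIV. D l (gi i j) y * gm j k y + gi i j y * D l (gm j k) y) = 0" if "y \<in> W" for y
  proof -
    note diffy = smooth_on_differentiable[OF W(1) _ that]
    have "D l (\<lambda>y. \<Sum>j\<in>UNIV. gi i j y * gm j k y) y = D l (\<lambda>y. if i = k then 1 else 0) y"
      by (rule dd_cong[OF W(1) that gi_gm])
    moreover have "D l (\<lambda>y. \<Sum>j\<in>UNIV. gi i j y * gm j k y) y
        = (\<Sum>j\<in>UNIV. D l (gi i j) y * gm j k y + gi i j y * D l (gm j k) y)"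
      by (simp add: dd_sum dd_mult diffy s_basic)
    ultimately show ?thesis by simp
  qed
  have "D m (\<lambda>y. \<Sum>j\<in>UNIV. D l (gi i j) y * gm j k y + gi i j y * D l (gm j k) y) z = D m (\<lambda>y. 0) z"
    by (rule dd_cong[OF W 1])
  moreover have "D m (\<lambda>y. \<Sum>j\<in>UNIV. D l (gi i j) y * gm j k y + gi i j y * D l (gm j k) y) z
      = (\<Sum>j\<in>UNIV. D m (D l (gi i j)) z * gm j k z + gi i j z * D m (D l (gm j k)) z)"
    by (simp add: dd_rules D_gi dgm_z)
  ultimately show ?thesis by (simp add: gm_z gi_z sum.distrib)
qed

lemma Chr_z: "Chr k i j z = 0"
  by (simp add: Chr_def dgm_z)

text \<open>The derivative of \<open>gi\<close> multiplies a bracket that vanishes at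
  \<open>z\<close>. In the time direction this is the variation of the Levi-Civita connection under
  the flow.\<close>

lemma dd_Chr: "dd v (Chr k i j) z
    = (dd v (D i (gm j k)) z + dd v (D j (gm i k)) z - dd v (D k (gm i j)) z) / 2"
proof -
  have "dd v (Chr k i j) z =
      (\<Sum>l\<in>UNIV. gi k l z * (dd v (D i (gm j l)) z + dd v (D j (gm i l)) z - dd v (D l (gm i j)) z)) / 2"
    unfolding Chr_def[abs_def] by (simp add: dd_rules dgm_z)
  then show ?thesis by (simp add: gi_z)
qed

lemma gm_swap: "dd v (dd w (gm i j)) z = dd v (dd w (gm j i)) z"
  by (intro dd_cong[OF W] dd_cong[OF W(1)] gm_sym)

text \<open>In a spatial direction the first sum vanishes; in the time direction it is -2 h(grad f,
  grad f).\<close>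

lemma dd_gradsq: "dd v gradsq z
    = (\<Sum>i\<in>UNIV. \<Sum>j\<in>UNIV. dd v (gi i j) z * D i f z * D j f z) + 2 * (\<Sum>i\<in>UNIV. D i f z * dd v (D i f) z)"
proof -
  have "dd v (\<lambda>y. gi i j y * D i f y * D j f y) z = dd v (gi i j) z * D i f z * D j f z
      + gi i j z * (dd v (D i f) z * D j f z) + gi i j z * (D i f z * dd v (D j f) z)" for i j
    by (subst dd_triple_product) (simp_all add: dd_rules)
  then have "dd v gradsq z = (\<Sum>i\<in>UNIV. \<Sum>j\<in>UNIV. dd v (gi i j) z * D i f z * D j f z
      + gi i j z * (dd v (D i f) z * D j f z) + gi i j z * (D i f z * dd v (D j f) z))"
    unfolding gradsq_def[abs_def] by (simp add: dd_sum diff s_basic)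
  then show ?thesis
    by (simp add: gi_z sum.distrib mult.commute sum_distrib_left)
qed

text \<open>The flat Bochner terms, plus the second derivatives of the inverse metric, which later
  join those of the Christoffel symbols to form the Ricci tensor.\<close>

lemma D_D_gradsq: "D k (D k gradsq) z =
    - (\<Sum>i\<in>UNIV. \<Sum>j\<in>UNIV. D k (D k (gm i j)) z * D i f z * D j f z)
    + 2 * (\<Sum>i\<in>UNIV. D i f z * D k (D k (D i f)) z) + 2 * (\<Sum>i\<in>UNIV. (D k (D i f) z)\<^sup>2)"
proof -
  have "D k (D k gradsq) z = D k (\<lambda>y. \<Sum>i\<in>UNIV. \<Sum>j\<in>UNIV. D k (\<lambda>y. gi i j y * D i f y * D j f y) y) z"
  proof (rule dd_cong[OF W])
    fix y assume y: "y \<in> W"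
    note diffy = smooth_on_differentiable[OF W(1) _ y]
    show "D k gradsq y = (\<Sum>i\<in>UNIV. \<Sum>j\<in>UNIV. D k (\<lambda>y. gi i j y * D i f y * D j f y) y)"
      unfolding gradsq_def[abs_def] by (simp add: dd_sum diffy s_basic)
  qed
  also have "\<dots> = (\<Sum>i\<in>UNIV. \<Sum>j\<in>UNIV. D k (D k (\<lambda>y. gi i j y * D i f y * D j f y)) z)"
    by (simp add: dd_sum diff s_basic)
  also have "\<dots> = (\<Sum>i\<in>UNIV. \<Sum>j\<in>UNIV. - (D k (D k (gm i j)) z * D i f z * D j f z)
     + gi i j z * (D k (D k (D i f)) z * D j f z + D i f z * D k (D k (D j f)) z
        + 2 * D k (D i f) z * D k (D j f) z))"
    by (intro sum.cong refl, subst dd_dd_triple_product[OF W s_gi s_dd[OF s_f] s_dd[OF s_f] D_gi])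
       (simp add: D_D_gi algebra_simps)
  also have "\<dots> = (\<Sum>i\<in>UNIV. \<Sum>j\<in>UNIV. - (D k (D k (gm i j)) z * D i f z * D j f z))
    + (\<Sum>i\<in>UNIV. D k (D k (D i f)) z * D i f z + D i f z * D k (D k (D i f)) z
        + 2 * D k (D i f) z * D k (D i f) z)"
    by (simp add: gi_z sum.distrib sum_subtractf sum_negf)
  finally show ?thesis
    by (simp add: gi_z sum.distrib sum_subtractf sum_negf power2_eq_square sum_distrib_left mult_ac)
qed

lemma dd_Lap: "dd v Lap z = (\<Sum>i\<in>UNIV. \<Sum>j\<in>UNIV. dd v (gi i j) z * D i (D j f) z)
    + (\<Sum>i\<in>UNIV. dd v (D i (D i f)) z) - (\<Sum>i\<in>UNIV. \<Sum>k\<in>UNIV. dd v (Chr k i i) z * D k f z)"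
proof -
  have "dd v Lap z = (\<Sum>i\<in>UNIV. \<Sum>j\<in>UNIV. dd v (gi i j) z * D i (D j f) z
      + gi i j z * (dd v (D i (D j f)) z - (\<Sum>k\<in>UNIV. dd v (Chr k i j) z * D k f z)))"
    unfolding Lap_def[abs_def] by (simp add: dd_rules s_Chr Chr_z)
  then show ?thesis
    by (simp add: gi_z sum.distrib sum_subtractf)
qed

text \<open>Here \<open>c l m i j\<close> stands for the second derivative of the metric component
  (i, j) in the directions l and m. The left side is twice the Ricci form in normal coordinates, the
  right side is what the Bochner computation leaves over.\<close>

lemma sum_curvature_identity:
  fixes c :: "'n \<Rightarrow> 'n \<Rightarrow> 'n \<Rightarrow> 'n \<Rightarrow> real" and x :: "'n \<Rightarrow> real"
  assumes c1: "\<And>l m i j. c l m i j = c m l i j" and c2: "\<And>l m i j. c l m i j = c l m j i"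
  shows "2 * (\<Sum>j\<in>UNIV. \<Sum>k\<in>UNIV. (\<Sum>i\<in>UNIV. (c i j k i + c i k j i - c i i j k) / 2
      - (c j i k i + c j k i i - c j i i k) / 2) * x j * x k)
    = 2 * (\<Sum>l\<in>UNIV. \<Sum>i\<in>UNIV. \<Sum>k\<in>UNIV. (c l i i k + c l i i k - c l k i i) / 2 * x k * x l)
     - (\<Sum>k\<in>UNIV. \<Sum>i\<in>UNIV. \<Sum>j\<in>UNIV. c k k i j * x i * x j)"
proof -
  \<comment> \<open>By the first symmetry \<open>c i j k i\<close> cancels \<open>c j i k i\<close>,
    and by both symmetries \<open>c j i i k\<close> is \<open>c i j k i\<close>; four terms
    remain.\<close>
  have e: "(c i j k i + c i k j i - c i i j k) / 2 - (c j i k i + c j k i i - c j i i k) / 2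
     = (c i k j i + c i j k i - c i i j k - c j k i i) / 2" for i j k
    using c1[of i j k i] c1[of j i i k] c2[of i j i k] by simp
  have "2 * (\<Sum>j\<in>UNIV. \<Sum>k\<in>UNIV. (\<Sum>i\<in>UNIV. (c i j k i + c i k j i - c i i j k) / 2
      - (c j i k i + c j k i i - c j i i k) / 2) * x j * x k)
    = (\<Sum>j\<in>UNIV. \<Sum>k\<in>UNIV. \<Sum>i\<in>UNIV. c i k j i * x j * x k + c i j k i * x j * x k
        - c i i j k * x j * x k - c j k i i * x j * x k)"
    unfolding e by (simp add: sum_distrib_left sum_distrib_right algebra_simps add_divide_distrib diff_divide_distrib)
  also have "\<dots> = (\<Sum>j\<in>UNIV. \<Sum>k\<in>UNIV. \<Sum>i\<in>UNIV. c i k j i * x j * x k)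
     + (\<Sum>j\<in>UNIV. \<Sum>k\<in>UNIV. \<Sum>i\<in>UNIV. c i j k i * x j * x k)
     - (\<Sum>j\<in>UNIV. \<Sum>k\<in>UNIV. \<Sum>i\<in>UNIV. c i i j k * x j * x k)
     - (\<Sum>j\<in>UNIV. \<Sum>k\<in>UNIV. \<Sum>i\<in>UNIV. c j k i i * x j * x k)"
    by (simp add: sum.distrib sum_subtractf)
  also have "(\<Sum>j\<in>UNIV. \<Sum>k\<in>UNIV. \<Sum>i\<in>UNIV. c i k j i * x j * x k)
      = (\<Sum>j\<in>UNIV. \<Sum>k\<in>UNIV. \<Sum>i\<in>UNIV. c i j k i * x j * x k)"
    by (subst sum.swap) (simp add: mult_ac)
  also have "(\<Sum>j\<in>UNIV. \<Sum>k\<in>UNIV. \<Sum>i\<in>UNIV. c i i j k * x j * x k)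
      = (\<Sum>k\<in>UNIV. \<Sum>i\<in>UNIV. \<Sum>j\<in>UNIV. c k k i j * x i * x j)"
    by (subst (2) sum.swap, subst sum.swap) simp
  also have "(\<Sum>j\<in>UNIV. \<Sum>k\<in>UNIV. \<Sum>i\<in>UNIV. c i j k i * x j * x k)
      = (\<Sum>l\<in>UNIV. \<Sum>i\<in>UNIV. \<Sum>k\<in>UNIV. c l i i k * x k * x l)"
    by (subst (2) sum.swap, simp add: mult_ac c1[of _ _ _ _] c2[of _ _ _ _])
  also have "(\<Sum>j\<in>UNIV. \<Sum>k\<in>UNIV. \<Sum>i\<in>UNIV. c j k i i * x j * x k)
      = (\<Sum>l\<in>UNIV. \<Sum>i\<in>UNIV. \<Sum>k\<in>UNIV. c l k i i * x k * x l)"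
    by (subst (2) sum.swap) (simp add: mult_ac)
  also have "(\<Sum>l\<in>UNIV. \<Sum>i\<in>UNIV. \<Sum>k\<in>UNIV. c l i i k * x k * x l)
      + (\<Sum>l\<in>UNIV. \<Sum>i\<in>UNIV. \<Sum>k\<in>UNIV. c l i i k * x k * x l)
      - (\<Sum>k\<in>UNIV. \<Sum>i\<in>UNIV. \<Sum>j\<in>UNIV. c k k i j * x i * x j)
      - (\<Sum>l\<in>UNIV. \<Sum>i\<in>UNIV. \<Sum>k\<in>UNIV. c l k i i * x k * x l)
     = 2 * (\<Sum>l\<in>UNIV. \<Sum>i\<in>UNIV. \<Sum>k\<in>UNIV. (c l i i k + c l i i k - c l k i i) / 2 * x k * x l)
     - (\<Sum>k\<in>UNIV. \<Sum>i\<in>UNIV. \<Sum>j\<in>UNIV. c k k i j * x i * x j)"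
    by (simp add: sum_distrib_left sum.distrib sum_subtractf algebra_simps diff_divide_distrib)
  finally show ?thesis .
qed

lemma Rc_sum: "2 * (\<Sum>j\<in>UNIV. \<Sum>k\<in>UNIV. Rc j k * D j f z * D k f z)
    = 2 * (\<Sum>l\<in>UNIV. \<Sum>i\<in>UNIV. \<Sum>k\<in>UNIV. D l (Chr k i i) z * D k f z * D l f z)
     - (\<Sum>k\<in>UNIV. \<Sum>i\<in>UNIV. \<Sum>j\<in>UNIV. D k (D k (gm i j)) z * D i f z * D j f z)"
  unfolding Rc_def dd_Chr
  by (rule sum_curvature_identity) (rule D_commute[OF s_gm], rule gm_swap)

text \<open>Bochner's computation for a moving metric. At \<open>z\<close> the sum of pure second
  derivatives of \<open>P\<close> is its Laplacian, so the left side is \<Delta> P minus the time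
  derivative of \<open>P\<close> plus 2 <grad f, grad P>. The heat equation enters later, through
  the derivatives of \<open>r\<close>.\<close>

lemma evolution_identity:
  fixes \<alpha> :: real
  defines "w \<equiv> \<lambda>y. Lap y + gradsq y"
  defines "r \<equiv> \<lambda>y. w y - Dt f y"
  defines "P \<equiv> \<lambda>y. gradsq y - \<alpha> * w y"
  shows "(\<Sum>k\<in>UNIV. D k (D k P) z) - Dt P z + 2 * (\<Sum>k\<in>UNIV. D k f z * D k P z) =
     2 * (\<Sum>k\<in>UNIV. \<Sum>i\<in>UNIV. (D k (D i f) z)\<^sup>2) + 2 * (\<Sum>j\<in>UNIV. \<Sum>k\<in>UNIV. Rc j k * D j f z * D k f z)
     - \<alpha> * (\<Sum>k\<in>UNIV. D k (D k r) z) - 2 * (\<alpha> - 1) * (\<Sum>k\<in>UNIV. D k f z * D k r z)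
     - 2 * (\<alpha> - 1) * (\<Sum>i\<in>UNIV. \<Sum>j\<in>UNIV. hh i j * D i f z * D j f z)
     - 2 * \<alpha> * (\<Sum>i\<in>UNIV. \<Sum>j\<in>UNIV. hh i j * D i (D j f) z)
     - 2 * \<alpha> * (\<Sum>k\<in>UNIV. ((\<Sum>i\<in>UNIV. dh i i k) - (\<Sum>i\<in>UNIV. dh k i i) / 2) * D k f z)"
proof -
  note sm = s_basic s_Lap s_gradsq
  have s_w: "smooth_on W w" unfolding w_def by (intro sm)
  have s_r: "smooth_on W r" unfolding r_def by (intro sm s_w)
  \<comment> \<open>In second derivatives \<open>w\<close> is written as \<open>r\<close> plus the
    time derivative of \<open>f\<close>, so that \<Delta> P contains the Laplacian of that time
    derivative and cancels the same term of \<open>Dt P\<close>. In first derivatives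
    \<open>w\<close> stays expanded.\<close>
  have Pr: "P y = gradsq y - \<alpha> * (r y + Dt f y)" for y by (simp add: P_def r_def)
  have DP: "dd v P z = dd v gradsq z - \<alpha> * (dd v Lap z + dd v gradsq z)" for v
    unfolding P_def w_def by (simp add: dd_rules dd_cmult s_Lap s_gradsq)
  have DDP: "D k (D k P) z = D k (D k gradsq) z - \<alpha> * (D k (D k r) z + D k (D k (Dt f)) z)" for k
  proof -
    have "D k (D k P) z = D k (\<lambda>y. D k gradsq y - \<alpha> * (D k r y + D k (Dt f) y)) z"
      unfolding Pr[abs_def]
      by (rule dd_cong[OF W])
         (simp add: dd_sum dd_add dd_diff dd_cmult smooth_on_differentiable[OF W(1)] sm s_r)
    also have "\<dots> = D k (D k gradsq) z - \<alpha> * (D k (D k r) z + D k (D k (Dt f)) z)"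
      by (simp add: dd_rules dd_cmult s_gradsq s_r)
    finally show ?thesis .
  qed
  have Dr: "D k r z = D k Lap z + D k gradsq z - D k (Dt f) z" for k
    unfolding r_def w_def by (simp add: dd_rules s_Lap s_gradsq)
  \<comment> \<open>With names for the contractions the identity becomes linear: third derivatives
    are commuted into \<open>a1\<close> and \<open>L1\<close>, then \<open>X4\<close> and
    \<open>a1\<close> are eliminated.\<close>
  define X1 where "X1 = (\<Sum>k\<in>UNIV. D k f z * D k gradsq z)"
  define X2 where "X2 = (\<Sum>k\<in>UNIV. D k f z * D k Lap z)"
  define X3 where "X3 = (\<Sum>k\<in>UNIV. D k f z * D k r z)"
  define X4 where "X4 = (\<Sum>k\<in>UNIV. D k f z * D k (Dt f) z)"
  define L1 where "L1 = (\<Sum>k\<in>UNIV. D k (D k (Dt f)) z)"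
  define Lr where "Lr = (\<Sum>k\<in>UNIV. D k (D k r) z)"
  define a1 where "a1 = (\<Sum>k\<in>UNIV. \<Sum>i\<in>UNIV. D i f z * D k (D k (D i f)) z)"
  define H where "H = (\<Sum>k\<in>UNIV. \<Sum>i\<in>UNIV. (D k (D i f) z)\<^sup>2)"
  define Q where "Q = (\<Sum>k\<in>UNIV. \<Sum>i\<in>UNIV. \<Sum>j\<in>UNIV. D k (D k (gm i j)) z * D i f z * D j f z)"
  define R2 where "R2 = (\<Sum>l\<in>UNIV. \<Sum>i\<in>UNIV. \<Sum>k\<in>UNIV. D l (Chr k i i) z * D k f z * D l f z)"
  define hff where "hff = (\<Sum>i\<in>UNIV. \<Sum>j\<in>UNIV. hh i j * D i f z * D j f z)"
  define hH where "hH = (\<Sum>i\<in>UNIV. \<Sum>j\<in>UNIV. hh i j * D i (D j f) z)"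
  define G where "G = (\<Sum>k\<in>UNIV. ((\<Sum>i\<in>UNIV. dh i i k) - (\<Sum>i\<in>UNIV. dh k i i) / 2) * D k f z)"
  have X3: "X3 = X1 + X2 - X4"
    unfolding X1_def X2_def X3_def X4_def by (simp add: Dr algebra_simps sum.distrib sum_subtractf)
  have S1: "(\<Sum>k\<in>UNIV. D k (D k gradsq) z) = - Q + 2 * a1 + 2 * H"
    by (simp add: D_D_gradsq Q_def a1_def H_def sum.distrib sum_subtractf sum_negf flip: sum_distrib_left)
  have c3: "D k (D k (D i f)) z = D i (D k (D k f)) z" for i k
  proof -
    have "D k (D k (D i f)) z = D k (D i (D k f)) z"
      by (intro dd_cong[OF W] smooth_on_dd_commute[OF W(1)] s_f)
    also have "\<dots> = D i (D k (D k f)) z" by (intro D_commute sm)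
    finally show ?thesis .
  qed
  have c4: "Dt (D k (D k f)) z = D k (D k (Dt f)) z" for k
  proof -
    have "Dt (D k (D k f)) z = D k (Dt (D k f)) z" by (intro D_commute sm)
    also have "\<dots> = D k (D k (Dt f)) z"
      by (intro dd_cong[OF W] smooth_on_dd_commute[OF W(1)] s_f)
    finally show ?thesis .
  qed
  \<comment> \<open>Commuting the gradient with the Laplacian costs the derivatives of the
    Christoffel symbols, one of the two sources of the curvature term.\<close>
  have X2: "X2 = a1 - R2"
  proof -
    have "X2 = (\<Sum>l\<in>UNIV. \<Sum>i\<in>UNIV. D l f z * D l (D i (D i f)) z) - R2"
      by (simp add: X2_def R2_def dd_Lap D_gi algebra_simps sum_distrib_left sum_subtractf)
    also have "(\<Sum>l\<in>UNIV. \<Sum>i\<in>UNIV. D l f z * D l (D i (D i f)) z) = a1"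
      unfolding a1_def by (subst sum.swap) (intro sum.cong refl arg_cong2[where f = "(*)"] c3[symmetric])
    finally show ?thesis .
  qed
  have Dtg: "Dt gradsq z = - 2 * hff + 2 * X4"
    by (simp add: dd_gradsq dd_gi hff_def X4_def sum_distrib_left sum_negf D_commute[OF s_f, of "(0,1)"])
  \<comment> \<open>The variation of the Laplacian: besides the pairing of \<open>h\<close> with the
    Hessian it contains \<open>G\<close>, the pairing of grad f with the divergence of
    \<open>h\<close> minus half the gradient of its trace.\<close>
  have DtL: "Dt Lap z = - 2 * hH + L1 - 2 * G"
  proof -
    have "Dt (Chr k i i) z = 2 * dh i i k - dh k i i" for i k
      by (simp add: dd_Chr D_commute[OF s_gm, of "(0,1)"])
    then have "(\<Sum>i\<in>UNIV. \<Sum>k\<in>UNIV. Dt (Chr k i i) z * D k f z)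
        = (\<Sum>k\<in>UNIV. \<Sum>i\<in>UNIV. (2 * dh i i k - dh k i i) * D k f z)"
      by (subst sum.swap) simp
    also have "\<dots> = 2 * G"
      by (simp add: G_def sum_distrib_left sum_distrib_right sum_subtractf sum_divide_distrib algebra_simps)
    finally show ?thesis
      by (simp add: dd_Lap dd_gi hH_def L1_def c4 sum_distrib_left sum_negf)
  qed
  have E1: "(\<Sum>k\<in>UNIV. D k (D k P) z) = (- Q + 2 * a1 + 2 * H) - \<alpha> * (Lr + L1)"
    unfolding DDP by (simp add: S1 Lr_def L1_def sum_subtractf sum.distrib distrib_left flip: sum_distrib_left)
  have E2: "(\<Sum>k\<in>UNIV. D k f z * D k P z) = X1 - \<alpha> * (X2 + X1)"
    unfolding DP X1_def X2_def by (simp add: algebra_simps sum_subtractf sum.distrib sum_distrib_left)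
  have E3: "Dt P z = (1 - \<alpha>) * (- 2 * hff + 2 * X4) - \<alpha> * (- 2 * hH + L1 - 2 * G)"
    unfolding DP Dtg DtL by (simp add: algebra_simps)
  have X4: "X4 = X1 + X2 - X3" and a1: "a1 = X2 + R2" using X2 X3 by auto
  have "- Q + 2 * a1 + 2 * H - \<alpha> * (Lr + L1)
      - ((1 - \<alpha>) * (- 2 * hff + 2 * X4) - \<alpha> * (- 2 * hH + L1 - 2 * G)) + 2 * (X1 - \<alpha> * (X2 + X1))
    = 2 * H + (2 * R2 - Q) - \<alpha> * Lr - 2 * (\<alpha> - 1) * X3 - 2 * (\<alpha> - 1) * hff - 2 * \<alpha> * hH - 2 * \<alpha> * G"
    unfolding X4 a1 by (simp add: algebra_simps)
  then show ?thesis
    unfolding Rc_sum E1 E2 E3 H_def[symmetric] R2_def[symmetric] Q_def[symmetric] Lr_def[symmetric]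
      X3_def[symmetric] hff_def[symmetric] hH_def[symmetric] G_def[symmetric] .
qed

end

section \<open>Pointwise inequalities\<close>

text \<open>Cauchy-Schwarz on the diagonal, after which the off-diagonal squares may be added. It is
  the source of the factor \<open>2 / n\<close> for the Hessian and of \<open>sqrt n\<close> in the
  divergence term.\<close>

lemma trace_square_le:
  fixes M :: "'n::finite \<Rightarrow> 'n \<Rightarrow> real"
  shows "(\<Sum>i\<in>UNIV. M i i)\<^sup>2 \<le> real CARD('n) * (\<Sum>i\<in>UNIV. \<Sum>j\<in>UNIV. (M i j)\<^sup>2)"
proof -
  have "(\<Sum>i\<in>UNIV. 1 * M i i)\<^sup>2 \<le> (\<Sum>i\<in>(UNIV :: 'n set). 1\<^sup>2) * (\<Sum>i\<in>UNIV. (M i i)\<^sup>2)"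
    by (rule Cauchy_Schwarz_ineq_sum)
  also have "\<dots> \<le> real CARD('n) * (\<Sum>i\<in>UNIV. \<Sum>j\<in>UNIV. (M i j)\<^sup>2)"
    by (auto intro!: mult_left_mono sum_mono member_le_sum)
  finally show ?thesis by simp
qed

text \<open>Completing the square against \<open>h\<close> and using only the trace keeps the full factor \<open>2 / n\<close>;
  splitting off the mixed term by Cauchy-Schwarz would lose part of it.\<close>

lemma hessian_square_lower_bound:
  fixes H h :: "'n::finite \<Rightarrow> 'n \<Rightarrow> real" and \<alpha> K B :: real
  assumes "\<alpha> > 0" and hh: "(\<Sum>i\<in>UNIV. \<Sum>j\<in>UNIV. (h i j)\<^sup>2) \<le> real CARD('n) * K\<^sup>2"
    and tr: "(\<Sum>i\<in>UNIV. h i i) \<ge> - real CARD('n) * K"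
    and B: "B = - (\<Sum>i\<in>UNIV. H i i)" "B \<ge> \<alpha> * real CARD('n) * K / 2"
  shows "2 * (\<Sum>i\<in>UNIV. \<Sum>j\<in>UNIV. (H i j)\<^sup>2) - 2 * \<alpha> * (\<Sum>i\<in>UNIV. \<Sum>j\<in>UNIV. h i j * H i j)
    \<ge> 2 / real CARD('n) * B\<^sup>2 - 2 * \<alpha> * K * B"
proof -
  define n where "n = real CARD('n)"
  have n: "n > 0" by (simp add: n_def)
  \<comment> \<open>Completing the square: 2 |H|^2 - 2 \<alpha> <h, H> = 2 |M|^2 - (\<alpha>^2 / 2)
    |h|^2.\<close>
  define M where "M i j = H i j - \<alpha> / 2 * h i j" for i j
  have M2: "(\<Sum>i\<in>UNIV. \<Sum>j\<in>UNIV. (M i j)\<^sup>2) = (\<Sum>i\<in>UNIV. \<Sum>j\<in>UNIV. (H i j)\<^sup>2)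
      - \<alpha> * (\<Sum>i\<in>UNIV. \<Sum>j\<in>UNIV. h i j * H i j) + \<alpha>\<^sup>2 / 4 * (\<Sum>i\<in>UNIV. \<Sum>j\<in>UNIV. (h i j)\<^sup>2)"
    by (simp add: M_def power2_eq_square algebra_simps sum.distrib sum_subtractf sum_distrib_left)
  \<comment> \<open>The smaller side must be nonnegative before squaring; this is what the lower
    bound on \<open>B\<close> is for.\<close>
  have "0 \<le> B - \<alpha> * n * K / 2" using B(2) by (simp add: n_def)
  moreover have "\<alpha> * (\<Sum>i\<in>UNIV. h i i) \<ge> \<alpha> * (- n * K)"
    using tr \<open>\<alpha> > 0\<close> unfolding n_def by (intro mult_left_mono) auto
  then have "B - \<alpha> * n * K / 2 \<le> B + \<alpha> / 2 * (\<Sum>i\<in>UNIV. h i i)" by (simp add: algebra_simps)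
  ultimately have "(B - \<alpha> * n * K / 2)\<^sup>2 \<le> (B + \<alpha> / 2 * (\<Sum>i\<in>UNIV. h i i))\<^sup>2"
    by (intro power_mono)
  also have "\<dots> = (\<Sum>i\<in>UNIV. M i i)\<^sup>2"
    unfolding M_def B(1) by (simp add: sum_subtractf sum_distrib_left power2_eq_square algebra_simps)
  also have "\<dots> \<le> n * (\<Sum>i\<in>UNIV. \<Sum>j\<in>UNIV. (M i j)\<^sup>2)"
    unfolding n_def by (rule trace_square_le)
  finally have "2 * (B - \<alpha> * n * K / 2)\<^sup>2 / n \<le> 2 * (\<Sum>i\<in>UNIV. \<Sum>j\<in>UNIV. (M i j)\<^sup>2)"
    using n by (simp add: divide_le_eq mult_ac)
  moreover have "\<alpha>\<^sup>2 / 2 * (\<Sum>i\<in>UNIV. \<Sum>j\<in>UNIV. (h i j)\<^sup>2) \<le> \<alpha>\<^sup>2 / 2 * (n * K\<^sup>2)"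
    using hh unfolding n_def by (intro mult_left_mono) auto
  \<comment> \<open>The constant of the expanded square equals the bound for the square of
    \<open>h\<close>, so no constant term survives.\<close>
  moreover have "2 * (B - \<alpha> * n * K / 2)\<^sup>2 / n - \<alpha>\<^sup>2 / 2 * (n * K\<^sup>2) = 2 / n * B\<^sup>2 - 2 * \<alpha> * K * B"
    using n by (simp add: power2_eq_square field_simps)
  ultimately show ?thesis using M2 unfolding n_def[symmetric] by linarith
qed

text \<open>A symmetric form bounded by \<open>K\<close> has operator norm at most \<open>K\<close>,
  so each of its n columns has square sum at most K^2.\<close>

lemma symmetric_form_square_sum_le:
  fixes h :: "'n::finite \<Rightarrow> 'n \<Rightarrow> real" and K :: real
  assumes sym: "\<And>i j. h i j = h j i"
    and bd: "\<And>v. \<bar>\<Sum>i\<in>UNIV. \<Sum>j\<in>UNIV. h i j * v i * v j\<bar> \<le> K * (\<Sum>i\<in>UNIV. (v i)\<^sup>2)"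
  shows "(\<Sum>i\<in>UNIV. \<Sum>j\<in>UNIV. (h i j)\<^sup>2) \<le> real CARD('n) * K\<^sup>2"
proof -
  define q where "q v w = (\<Sum>i\<in>UNIV. \<Sum>j\<in>UNIV. h i j * v i * w j)" for v w :: "'n \<Rightarrow> real"
  define N where "N v = (\<Sum>i\<in>UNIV. (v i)\<^sup>2)" for v :: "'n \<Rightarrow> real"
  have N0: "N v \<ge> 0" for v by (simp add: N_def sum_nonneg)
  have qsym: "q v w = q w v" for v w
    unfolding q_def by (subst sum.swap) (intro sum.cong refl, subst sym, simp add: mult_ac)
  \<comment> \<open>Polarization carries the bound from equal to different arguments; this step
    rests on the symmetry of \<open>h\<close>.\<close>
  have pol: "4 * q v w = q (\<lambda>i. v i + w i) (\<lambda>i. v i + w i) - q (\<lambda>i. v i - w i) (\<lambda>i. v i - w i)" for v w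
    using qsym[of v w] unfolding q_def by (simp add: algebra_simps sum.distrib sum_subtractf)
  have qle: "2 * q v w \<le> K * (N v + N w)" for v w
  proof -
    have "4 * q v w \<le> K * N (\<lambda>i. v i + w i) + K * N (\<lambda>i. v i - w i)"
      using pol[of v w] bd[of "\<lambda>i. v i + w i"] bd[of "\<lambda>i. v i - w i"] unfolding q_def N_def by linarith
    also have "\<dots> = 2 * K * (N v + N w)"
      unfolding N_def by (simp add: power2_eq_square algebra_simps sum.distrib sum_subtractf sum_distrib_left)
    finally show ?thesis by simp
  qed
  have row: "(\<Sum>i\<in>UNIV. (h i j)\<^sup>2) \<le> K\<^sup>2" for j
  proof -
    define s where "s = (\<Sum>i\<in>UNIV. (h i j)\<^sup>2)"
    define e where "e = (\<lambda>k. if k = j then 1 else 0 :: real)"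
    have s0: "s \<ge> 0" by (simp add: s_def sum_nonneg)
    have Ne: "N e = 1" by (simp add: N_def e_def if_distrib[of "\<lambda>x. x^2"] cong: if_cong)
    have K0: "K \<ge> 0" using order_trans[OF abs_ge_zero bd[of e]] Ne by (simp add: N_def)
    have qe: "q (\<lambda>i. c * h i j) e = c * s" for c
      unfolding q_def e_def s_def
      by (simp add: if_distrib[of "\<lambda>x. _ * x"] power2_eq_square sum_distrib_left mult_ac cong: if_cong)
    have Nc: "N (\<lambda>i. c * h i j) = c\<^sup>2 * s" for c
      unfolding N_def s_def by (simp add: power_mult_distrib sum_distrib_left)
    show ?thesis
    proof (cases "s = 0")
      case False
      then have "s > 0" using s0 by simp
      \<comment> \<open>The test vectors are the column normalised to length 1 and the basis vector
        that selects it.\<close>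
      have "2 * (1 / sqrt s * s) \<le> K * ((1 / sqrt s)\<^sup>2 * s + 1)"
        using qle[of "\<lambda>i. 1 / sqrt s * h i j" e] unfolding qe Nc Ne .
      then have "sqrt s \<le> K" using \<open>s > 0\<close>
        by (simp add: power_divide real_div_sqrt)
      then have "(sqrt s)\<^sup>2 \<le> K\<^sup>2" using s0 by (intro power_mono) auto
      then show ?thesis using s0 by (simp add: s_def)
    qed (simp add: s_def)
  qed
  have "(\<Sum>i\<in>UNIV. \<Sum>j\<in>UNIV. (h i j)\<^sup>2) = (\<Sum>j\<in>UNIV. \<Sum>i\<in>UNIV. (h i j)\<^sup>2)" by (rule sum.swap)
  also have "\<dots> \<le> (\<Sum>j\<in>(UNIV :: 'n set). K\<^sup>2)" by (intro sum_mono row)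
  finally show ?thesis by simp
qed

lemma sum_mult_le_sqrt:
  fixes a x :: "'n::finite \<Rightarrow> real"
  assumes "(\<Sum>k\<in>UNIV. (a k)\<^sup>2) \<le> C\<^sup>2" "C \<ge> 0"
  shows "\<bar>\<Sum>k\<in>UNIV. a k * x k\<bar> \<le> C * sqrt (\<Sum>k\<in>UNIV. (x k)\<^sup>2)"
proof -
  have "(\<Sum>k\<in>UNIV. a k * x k)\<^sup>2 \<le> (\<Sum>k\<in>UNIV. (a k)\<^sup>2) * (\<Sum>k\<in>UNIV. (x k)\<^sup>2)"
    by (rule Cauchy_Schwarz_ineq_sum)
  also have "\<dots> \<le> C\<^sup>2 * (\<Sum>k\<in>UNIV. (x k)\<^sup>2)" using assms by (intro mult_right_mono sum_nonneg) auto
  finally have "sqrt ((\<Sum>k\<in>UNIV. a k * x k)\<^sup>2) \<le> sqrt (C\<^sup>2 * (\<Sum>k\<in>UNIV. (x k)\<^sup>2))"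
    by (rule real_sqrt_le_mono)
  then show ?thesis using assms(2) by (simp add: real_sqrt_mult)
qed

text \<open>Applied to the divergence of \<open>h\<close> minus half the gradient of its trace. Each
  trace costs a factor \<open>sqrt n\<close>, and 3/2 is 1 + 1/2.\<close>

lemma divergence_term_bound:
  fixes d :: "'n::finite \<Rightarrow> 'n \<Rightarrow> 'n \<Rightarrow> real" and x :: "'n \<Rightarrow> real"
  assumes d: "(\<Sum>k\<in>UNIV. \<Sum>i\<in>UNIV. \<Sum>j\<in>UNIV. (d k i j)\<^sup>2) \<le> K\<^sup>2" and K: "K \<ge> 0"
  shows "(\<Sum>k\<in>UNIV. ((\<Sum>i\<in>UNIV. d i i k) - (\<Sum>i\<in>UNIV. d k i i) / 2) * x k)
    \<le> 3 / 2 * sqrt (real CARD('n)) * K * sqrt (\<Sum>k\<in>UNIV. (x k)\<^sup>2)"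
proof -
  let ?n = "real CARD('n)"
  have 1: "(\<Sum>k\<in>UNIV. (\<Sum>i\<in>UNIV. d i i k)\<^sup>2) \<le> (sqrt ?n * K)\<^sup>2"
  proof -
    have "(\<Sum>k\<in>UNIV. (\<Sum>i\<in>UNIV. d i i k)\<^sup>2) \<le> (\<Sum>k\<in>UNIV. ?n * (\<Sum>i\<in>UNIV. \<Sum>j\<in>UNIV. (d i j k)\<^sup>2))"
      by (intro sum_mono trace_square_le)
    also have "\<dots> = ?n * (\<Sum>k\<in>UNIV. \<Sum>i\<in>UNIV. \<Sum>j\<in>UNIV. (d i j k)\<^sup>2)"
      by (simp add: sum_distrib_left)
    also have "(\<Sum>k\<in>UNIV. \<Sum>i\<in>UNIV. \<Sum>j\<in>UNIV. (d i j k)\<^sup>2) = (\<Sum>i\<in>UNIV. \<Sum>j\<in>UNIV. \<Sum>k\<in>UNIV. (d i j k)\<^sup>2)"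
      by (subst sum.swap, rule sum.cong, simp, rule sum.swap)
    finally show ?thesis using d by (simp add: power_mult_distrib mult_left_mono order_trans)
  qed
  have 2: "(\<Sum>k\<in>UNIV. (\<Sum>i\<in>UNIV. d k i i)\<^sup>2) \<le> (sqrt ?n * K)\<^sup>2"
  proof -
    have "(\<Sum>k\<in>UNIV. (\<Sum>i\<in>UNIV. d k i i)\<^sup>2) \<le> (\<Sum>k\<in>UNIV. ?n * (\<Sum>i\<in>UNIV. \<Sum>j\<in>UNIV. (d k i j)\<^sup>2))"
      by (intro sum_mono trace_square_le)
    also have "\<dots> = ?n * (\<Sum>k\<in>UNIV. \<Sum>i\<in>UNIV. \<Sum>j\<in>UNIV. (d k i j)\<^sup>2)"
      by (simp add: sum_distrib_left)
    finally show ?thesis using d by (simp add: power_mult_distrib mult_left_mono order_trans)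
  qed
  have "(\<Sum>k\<in>UNIV. ((\<Sum>i\<in>UNIV. d i i k) - (\<Sum>i\<in>UNIV. d k i i) / 2) * x k)
     = (\<Sum>k\<in>UNIV. (\<Sum>i\<in>UNIV. d i i k) * x k) - (\<Sum>k\<in>UNIV. (\<Sum>i\<in>UNIV. d k i i) * x k) / 2"
    by (simp add: left_diff_distrib sum_subtractf flip: sum_divide_distrib)
  moreover have "sqrt ?n * K \<ge> 0" using K by simp
  ultimately show ?thesis
    using sum_mult_le_sqrt[OF 1, of x] sum_mult_le_sqrt[OF 2, of x] by (simp add: mult.assoc)
qed

text \<open>Otherwise \<open>S * (S - L)\<close> would exceed the square of
  \<open>a + b + c\<close>, which is at least the sum of the three squares. The constants thus enter
  the bound as separate roots.\<close>

lemma quadratic_root_bound: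
  fixes S L a b c :: real
  assumes "S\<^sup>2 \<le> L * S + a\<^sup>2 + b\<^sup>2 + c\<^sup>2" "L \<ge> 0" "a \<ge> 0" "b \<ge> 0" "c \<ge> 0"
  shows "S \<le> L + a + b + c"
proof (rule ccontr)
  assume "\<not> ?thesis"
  then have "(a + b + c) * (a + b + c) < S * (S - L)"
    using assms by (intro mult_strict_mono') auto
  moreover have "(a + b + c) * (a + b + c) \<ge> a\<^sup>2 + b\<^sup>2 + c\<^sup>2"
    using assms by (simp add: power2_eq_square algebra_simps)
  ultimately show False using assms(1) by (simp add: power2_eq_square algebra_simps)
qed

text \<open>\<open>G\<close> is the value of \<open>P\<close> at the maximum, \<open>y\<close> is
  |grad f|^2, \<open>B\<close> is -\<Delta> f and \<open>\<tau>\<close> the elapsed time. The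
  quantity \<open>S = G + (\<alpha> - 1) * y = \<alpha> * B\<close> dominates \<open>G\<close> and
  \<open>s = (\<alpha> - 1) * y\<close> separately, so all linear terms merge into one multiple of
  \<open>S\<close>.\<close>

lemma gradient_estimate_scalar:
  fixes G y n \<alpha> \<tau> K K1 K3 K4 \<gamma> \<theta> lam Lam Sig B :: real
  assumes n: "n > 0" and \<alpha>: "\<alpha> > 1" and G: "G > 0" and y: "y \<ge> 0" and \<tau>: "\<tau> > 0"
    and nonneg: "K \<ge> 0" "K1 \<ge> 0" "K3 \<ge> 0" "K4 \<ge> 0" "\<gamma> \<ge> 0" "\<theta> \<ge> 0" "lam \<ge> 0" "Lam \<ge> 0" "Sig \<ge> 0"
    and B: "B = (G + (\<alpha> - 1) * y) / \<alpha>"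
    and ineq: "2 / n * B\<^sup>2 - 2 * \<alpha> * K * B \<le> G / \<tau> + 2 * K1 * y + 2 * (\<alpha> - 1) * \<gamma> * sqrt y + \<alpha> * \<theta>
      + 2 * (\<alpha> - 1) * K3 * y + 3 * \<alpha> * sqrt n * K4 * sqrt y + lam * G + (\<alpha> - 1) * Lam * y + \<alpha> * Sig * y"
  shows "G \<le> n * \<alpha>\<^sup>2 / (2 * \<tau>) + (n * \<alpha>\<^sup>2 / (\<alpha> - 1) * (K1 + (\<alpha> - 1) * K3 + K4)
        + n * \<alpha>\<^sup>2 * (K + 3 / 4 * sqrt (2 * K4))
        + \<alpha> powr (3/2) * sqrt (n * \<theta>)
        + (n * \<alpha>\<^sup>2 / 2 * (\<alpha> - 1) powr (1/2) + sqrt n * \<alpha> * (\<alpha> - 1) powr (1/4)) * \<gamma> powr (2/3)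
        + n * \<alpha>\<^sup>2 / 2 * (lam + Lam) + n * \<alpha> ^ 3 / (2 * (\<alpha> - 1)) * Sig)"
proof -
  \<comment> \<open>Chosen so that the powers 1/2 and 1/4 of \<open>\<alpha> - 1\<close> and 2/3 of
    \<open>\<gamma>\<close> become integer powers of \<open>p\<close> and \<open>c\<close>.\<close>
  define p where "p = (\<alpha> - 1) powr (1/4)"
  define c where "c = \<gamma> powr (1/3)"
  have p: "p \<ge> 0" "p\<^sup>2 = (\<alpha> - 1) powr (1/2)" "p ^ 4 = \<alpha> - 1"
    using \<alpha> by (auto simp: p_def powr_power)
  have c: "c \<ge> 0" "c\<^sup>2 = \<gamma> powr (2/3)" "c ^ 3 = \<gamma>"
    using nonneg by (cases "\<gamma> = 0"; simp add: c_def powr_power)+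
  define S where "S = G + (\<alpha> - 1) * y"
  define s where "s = (\<alpha> - 1) * y"
  have s: "0 \<le> s" "s \<le> S" "G \<le> S" "0 \<le> S" using \<alpha> y G by (auto simp: S_def s_def)
  \<comment> \<open>This factor turns \<open>2 / n * B\<^sup>2\<close> into
    \<open>S\<^sup>2\<close>.\<close>
  define M where "M = n * \<alpha>\<^sup>2 / 2"
  have M: "M > 0" using n \<alpha> by (simp add: M_def)
  define L where "L = M * (2 * K + 1 / \<tau> + lam + 2 * K1 / (\<alpha> - 1) + 2 * K3 + Lam + \<alpha> * Sig / (\<alpha> - 1)
      + 2 * K4 / (\<alpha> - 1) + p\<^sup>2 * c\<^sup>2)"
  \<comment> \<open>The weights are chosen so that the part with \<open>s\<close> yields the term
    with \<open>(\<alpha> - 1) powr (1/2)\<close>, and the constant part the one with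
    \<open>(\<alpha> - 1) powr (1/4)\<close>, both times the same power of
    \<open>\<gamma>\<close>.\<close>
  have g\<gamma>: "2 * (\<alpha> - 1) * \<gamma> * sqrt y \<le> p\<^sup>2 * c\<^sup>2 * s + p\<^sup>2 * c ^ 4"
  proof -
    have "0 \<le> (p ^ 3 * c * sqrt y - p * c\<^sup>2)\<^sup>2" by simp
    also have "\<dots> = p ^ 6 * c\<^sup>2 * (sqrt y)\<^sup>2 - 2 * p ^ 4 * c ^ 3 * sqrt y + p\<^sup>2 * c ^ 4"
      by (simp add: power2_eq_square power3_eq_cube power4_eq_xxxx algebra_simps eval_nat_numeral)
    also have "\<dots> = p\<^sup>2 * c\<^sup>2 * (p ^ 4 * y) - 2 * p ^ 4 * c ^ 3 * sqrt y + p\<^sup>2 * c ^ 4"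
      using y by (simp add: eval_nat_numeral algebra_simps)
    finally show ?thesis unfolding p(3) c(3) s_def by simp
  qed
  \<comment> \<open>The coefficient 2 of \<open>K4 * y\<close> puts \<open>K4\<close> beside
    \<open>K1\<close> in the final bound; the constant 9/8 = 2 * (3/4)^2 is then the origin of
    \<open>3 / 4 * sqrt (2 * K4)\<close>.\<close>
  have gK: "3 * \<alpha> * sqrt n * K4 * sqrt y \<le> 2 * K4 * y + 9 / 8 * \<alpha>\<^sup>2 * n * K4"
  proof -
    have "0 \<le> K4 * (4 * sqrt y - 3 * \<alpha> * sqrt n)\<^sup>2 / 8" using nonneg by simp
    also have "K4 * (4 * a - 3 * \<alpha> * b)\<^sup>2 / 8 = 2 * K4 * a\<^sup>2 + 9 / 8 * \<alpha>\<^sup>2 * b\<^sup>2 * K4 - 3 * \<alpha> * b * K4 * a" for a b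
      by (simp add: power2_eq_square field_simps)
    finally show ?thesis using y n by simp
  qed
  have "2 / n * B\<^sup>2 \<le> 2 * K * S + G / \<tau> + 2 * K1 * y + (p\<^sup>2 * c\<^sup>2 * s + p\<^sup>2 * c ^ 4) + \<alpha> * \<theta>
      + 2 * (\<alpha> - 1) * K3 * y + (2 * K4 * y + 9 / 8 * \<alpha>\<^sup>2 * n * K4) + lam * G + (\<alpha> - 1) * Lam * y + \<alpha> * Sig * y"
  proof -
    have "2 * \<alpha> * K * B = 2 * K * S" using \<alpha> by (simp add: B S_def)
    then show ?thesis using ineq g\<gamma> gK by linarith
  qed
  also have "\<dots> = 2 * K * S + (1 / \<tau> + lam) * G + (2 * K1 / (\<alpha> - 1) + 2 * K3 + Lam + \<alpha> * Sig / (\<alpha> - 1)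
      + 2 * K4 / (\<alpha> - 1) + p\<^sup>2 * c\<^sup>2) * s + (p\<^sup>2 * c ^ 4 + \<alpha> * \<theta> + 9 / 8 * \<alpha>\<^sup>2 * n * K4)"
  proof -
    have e: "2 * (\<alpha> - 1) * K3 * y = 2 * K3 * s" "(\<alpha> - 1) * Lam * y = Lam * s"
      "2 * K1 * y = 2 * K1 / (\<alpha> - 1) * s" "2 * K4 * y = 2 * K4 / (\<alpha> - 1) * s"
      "\<alpha> * Sig * y = \<alpha> * Sig / (\<alpha> - 1) * s"
      using \<alpha> by (simp_all add: s_def)
    show ?thesis unfolding e distrib_right by simp
  qed
  also have "\<dots> \<le> 2 * K * S + (1 / \<tau> + lam) * S + (2 * K1 / (\<alpha> - 1) + 2 * K3 + Lam + \<alpha> * Sig / (\<alpha> - 1)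
      + 2 * K4 / (\<alpha> - 1) + p\<^sup>2 * c\<^sup>2) * S + (p\<^sup>2 * c ^ 4 + \<alpha> * \<theta> + 9 / 8 * \<alpha>\<^sup>2 * n * K4)"
    using nonneg n \<tau> \<alpha> s by (intro add_mono mult_left_mono add_nonneg_nonneg divide_nonneg_nonneg mult_nonneg_nonneg) auto
  finally have "M * (2 / n * B\<^sup>2) \<le> M * (2 * K * S + (1 / \<tau> + lam) * S + (2 * K1 / (\<alpha> - 1) + 2 * K3 + Lam + \<alpha> * Sig / (\<alpha> - 1)
      + 2 * K4 / (\<alpha> - 1) + p\<^sup>2 * c\<^sup>2) * S + (p\<^sup>2 * c ^ 4 + \<alpha> * \<theta> + 9 / 8 * \<alpha>\<^sup>2 * n * K4))"
    using M by (intro mult_left_mono) auto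
  also have "\<dots> = L * S + M * (p\<^sup>2 * c ^ 4) + M * (\<alpha> * \<theta>) + M * (9 / 8 * \<alpha>\<^sup>2 * n * K4)"
    by (simp add: L_def algebra_simps)
  also have "M * (2 / n * B\<^sup>2) = S\<^sup>2"
    using n \<alpha> by (simp add: M_def B S_def power_divide field_simps)
  finally have S2: "S\<^sup>2 \<le> L * S + M * (p\<^sup>2 * c ^ 4) + M * (\<alpha> * \<theta>) + M * (9 / 8 * \<alpha>\<^sup>2 * n * K4)" .
  \<comment> \<open>Each of the three constant terms is half the square of the matching term of the
    bound.\<close>
  have c1: "M * (p\<^sup>2 * c ^ 4) \<le> (sqrt n * \<alpha> * p * c\<^sup>2)\<^sup>2"
  proof -
    have "(sqrt n * \<alpha> * p * c\<^sup>2)\<^sup>2 = 2 * (M * (p\<^sup>2 * c ^ 4))"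
      using n by (simp add: M_def power_mult_distrib flip: power_mult)
    then show ?thesis using M by simp
  qed
  have c2: "M * (\<alpha> * \<theta>) \<le> (\<alpha> powr (3/2) * sqrt (n * \<theta>))\<^sup>2"
  proof -
    have "(\<alpha> powr (3/2))\<^sup>2 = \<alpha> ^ 3" using \<alpha> by (simp add: powr_power)
    then have "(\<alpha> powr (3/2) * sqrt (n * \<theta>))\<^sup>2 = 2 * (M * (\<alpha> * \<theta>))"
      using n nonneg by (simp add: M_def power_mult_distrib) (simp add: power2_eq_square power3_eq_cube)
    then show ?thesis using M \<alpha> nonneg by simp
  qed
  have c3: "M * (9 / 8 * \<alpha>\<^sup>2 * n * K4) \<le> (n * \<alpha>\<^sup>2 * (3 / 4 * sqrt (2 * K4)))\<^sup>2"
  proof -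
    have "(n * \<alpha>\<^sup>2 * (3 / 4 * sqrt (2 * K4)))\<^sup>2 = 2 * (M * (9 / 8 * \<alpha>\<^sup>2 * n * K4))"
      using nonneg by (simp add: M_def power_mult_distrib power_divide) (simp add: power2_eq_square)
    moreover have "0 \<le> M * (9 / 8 * \<alpha>\<^sup>2 * n * K4)" using M n nonneg by simp
    ultimately show ?thesis by linarith
  qed
  have L: "L \<ge> 0"
    unfolding L_def using M \<alpha> nonneg \<tau> by (intro mult_nonneg_nonneg add_nonneg_nonneg divide_nonneg_nonneg) auto
  have "S \<le> L + sqrt n * \<alpha> * p * c\<^sup>2 + \<alpha> powr (3/2) * sqrt (n * \<theta>) + n * \<alpha>\<^sup>2 * (3 / 4 * sqrt (2 * K4))"
  proof (rule quadratic_root_bound[OF _ L])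
    show "S\<^sup>2 \<le> L * S + (sqrt n * \<alpha> * p * c\<^sup>2)\<^sup>2 + (\<alpha> powr (3/2) * sqrt (n * \<theta>))\<^sup>2
        + (n * \<alpha>\<^sup>2 * (3 / 4 * sqrt (2 * K4)))\<^sup>2"
      using S2 c1 c2 c3 by linarith
  qed (use n \<alpha> p(1) nonneg in simp_all)
  then have "G \<le> L + sqrt n * \<alpha> * p * c\<^sup>2 + \<alpha> powr (3/2) * sqrt (n * \<theta>) + n * \<alpha>\<^sup>2 * (3 / 4 * sqrt (2 * K4))"
    using s by linarith
  also have "L = n * \<alpha>\<^sup>2 / (2 * \<tau>) + n * \<alpha>\<^sup>2 / (\<alpha> - 1) * (K1 + (\<alpha> - 1) * K3 + K4)
      + n * \<alpha>\<^sup>2 * K + n * \<alpha>\<^sup>2 / 2 * p\<^sup>2 * c\<^sup>2 + n * \<alpha>\<^sup>2 / 2 * (lam + Lam) + n * \<alpha> ^ 3 / (2 * (\<alpha> - 1)) * Sig"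
  proof -
    have "L = M * (2 * K) + M * (1 / \<tau>) + M * lam + M * (2 * K1 / (\<alpha> - 1)) + M * (2 * K3) + M * Lam
        + M * (\<alpha> * Sig / (\<alpha> - 1)) + M * (2 * K4 / (\<alpha> - 1)) + M * (p\<^sup>2 * c\<^sup>2)"
      unfolding L_def by (simp only: distrib_left)
    moreover have "M * (1 / \<tau>) = n * \<alpha>\<^sup>2 / (2 * \<tau>)" by (simp add: M_def)
    moreover have "M * (2 * K1 / (\<alpha> - 1)) + M * (2 * K3) + M * (2 * K4 / (\<alpha> - 1))
        = n * \<alpha>\<^sup>2 / (\<alpha> - 1) * (K1 + (\<alpha> - 1) * K3 + K4)"
    proof -
      define b where "b = \<alpha> - 1"
      then have "b \<noteq> 0" using \<alpha> by simp
      then show ?thesis unfolding b_def[symmetric] M_def by (simp add: field_simps)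
    qed
    moreover have "M * (\<alpha> * Sig / (\<alpha> - 1)) = n * \<alpha> ^ 3 / (2 * (\<alpha> - 1)) * Sig"
      by (simp add: M_def power2_eq_square power3_eq_cube)
    moreover have "M * (2 * K) = n * \<alpha>\<^sup>2 * K" "M * (p\<^sup>2 * c\<^sup>2) = n * \<alpha>\<^sup>2 / 2 * p\<^sup>2 * c\<^sup>2"
      "M * lam + M * Lam = n * \<alpha>\<^sup>2 / 2 * (lam + Lam)"
      by (simp_all add: M_def distrib_left)
    ultimately show ?thesis by linarith
  qed
  finally show ?thesis unfolding p(2)[symmetric] c(2)[symmetric] p_def[symmetric]
    by (simp add: algebra_simps)
qed

context normal_point begin

text \<open>\<open>dq\<close> and \<open>dLq\<close> stand for the gradient and the Laplacian of
  \<open>q\<close>, \<open>A1\<close> and \<open>A2\<close> for the first and second derivative of s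
  -> A(e^s)/e^s at s = f. The conditions at the maximum bound the left side of
  \<open>evolution_identity\<close> by \<open>P z / \<tau>\<close>; the geometric bounds estimate
  its right side from below.\<close>

lemma estimate_at_maximum:
  fixes \<alpha> \<tau> K1 K2 K3 K4 \<gamma> \<theta> lam Lam Sig A1 A2 dLq :: real and dq :: "'n \<Rightarrow> real"
  defines "w \<equiv> \<lambda>y. Lap y + gradsq y"
  defines "r \<equiv> \<lambda>y. w y - Dt f y"
  defines "P \<equiv> \<lambda>y. gradsq y - \<alpha> * w y"
  defines "n \<equiv> real CARD('n)"
  assumes \<alpha>: "\<alpha> > 1" and \<tau>: "\<tau> > 0"
    and nonneg: "K2 \<ge> 0" "K1 \<ge> 0" "K3 \<ge> 0" "K4 \<ge> 0" "\<gamma> \<ge> 0" "\<theta> \<ge> 0" "lam \<ge> 0" "Lam \<ge> 0" "Sig \<ge> 0"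
    and crit: "\<And>k. D k P z = 0" "(\<Sum>k\<in>UNIV. D k (D k P) z) \<le> 0" "Dt P z \<ge> - P z / \<tau>"
    and pos: "P z > 0"
    and Ric: "\<And>v. (\<Sum>j\<in>UNIV. \<Sum>k\<in>UNIV. Rc j k * v j * v k) \<ge> - K1 * (\<Sum>i\<in>UNIV. (v i)\<^sup>2)"
    and h1: "\<And>v. (\<Sum>i\<in>UNIV. \<Sum>j\<in>UNIV. hh i j * v i * v j) \<ge> - K2 * (\<Sum>i\<in>UNIV. (v i)\<^sup>2)"
    and h2: "\<And>v. (\<Sum>i\<in>UNIV. \<Sum>j\<in>UNIV. hh i j * v i * v j) \<le> K3 * (\<Sum>i\<in>UNIV. (v i)\<^sup>2)"
    and dh: "(\<Sum>k\<in>UNIV. \<Sum>i\<in>UNIV. \<Sum>j\<in>UNIV. (dh k i j)\<^sup>2) \<le> K4\<^sup>2"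
    and dr: "\<And>k. D k r z = dq k + A1 * D k f z"
    and ddr: "(\<Sum>k\<in>UNIV. D k (D k r) z)
        = dLq + A1 * (\<Sum>k\<in>UNIV. D k (D k f) z) + A2 * (\<Sum>k\<in>UNIV. (D k f z)\<^sup>2)"
    and dq: "(\<Sum>k\<in>UNIV. (dq k)\<^sup>2) \<le> \<gamma>\<^sup>2" and dLq: "dLq \<le> \<theta>"
    and A: "- lam \<le> A1" "A1 \<le> Lam" "A2 \<le> Sig"
  shows "P z \<le> n * \<alpha>\<^sup>2 / (2 * \<tau>) + (n * \<alpha>\<^sup>2 / (\<alpha> - 1) * (K1 + (\<alpha> - 1) * K3 + K4)
        + n * \<alpha>\<^sup>2 * (max K2 K3 + 3 / 4 * sqrt (2 * K4))
        + \<alpha> powr (3/2) * sqrt (n * \<theta>)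
        + (n * \<alpha>\<^sup>2 / 2 * (\<alpha> - 1) powr (1/2) + sqrt n * \<alpha> * (\<alpha> - 1) powr (1/4)) * \<gamma> powr (2/3)
        + n * \<alpha>\<^sup>2 / 2 * (lam + Lam) + n * \<alpha> ^ 3 / (2 * (\<alpha> - 1)) * Sig)"
    (is "_ \<le> _ + ?C")
proof -
  define K where "K = max K2 K3"
  have K: "K \<ge> 0" "K2 \<le> K" "K3 \<le> K" using nonneg by (auto simp: K_def)
  have n: "n > 0" by (simp add: n_def)
  define y where "y = gradsq z"
  have y: "y = (\<Sum>k\<in>UNIV. (D k f z)\<^sup>2)"
    by (simp add: y_def gradsq_def gi_z mult.assoc power2_eq_square)
  have y0: "y \<ge> 0" unfolding y by (simp add: sum_nonneg)
  have Lap_z: "Lap z = (\<Sum>i\<in>UNIV. D i (D i f) z)"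
    by (simp add: Lap_def gi_z Chr_z)
  define B where "B = (P z + (\<alpha> - 1) * y) / \<alpha>"
  have B: "B = - (\<Sum>i\<in>UNIV. D i (D i f) z)"
    using \<alpha> unfolding B_def P_def w_def Lap_z[symmetric] y_def by (simp add: field_simps)
  have hsym: "hh i j = hh j i" for i j
    by (auto intro!: dd_cong[OF W] gm_sym)
  show ?thesis
  \<comment> \<open>The completed square needs \<open>B\<close> to be large. If it is not,
    \<open>P z \<le> \<alpha> * B\<close> already lies below the term with
    \<open>max K2 K3\<close>.\<close>
  proof (cases "B \<ge> \<alpha> * n * K / 2")
    case False
    have "P z \<le> \<alpha> * B" using \<alpha> y0 by (simp add: B_def)
    also have "\<dots> \<le> \<alpha> * (\<alpha> * n * K / 2)" using False \<alpha> by (intro mult_left_mono) auto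
    also have "\<dots> \<le> n * \<alpha>\<^sup>2 * K" using n K \<alpha> by (simp add: power2_eq_square)
    also have "\<dots> \<le> n * \<alpha>\<^sup>2 * (K + 3 / 4 * sqrt (2 * K4))" using n nonneg by (intro mult_left_mono) auto
    also have "\<dots> \<le> ?C"
    proof -
      have "0 \<le> n * \<alpha>\<^sup>2 / (\<alpha> - 1) * (K1 + (\<alpha> - 1) * K3 + K4)"
        "0 \<le> \<alpha> powr (3/2) * sqrt (n * \<theta>)" "0 \<le> n * \<alpha>\<^sup>2 / 2 * (lam + Lam)"
        "0 \<le> (n * \<alpha>\<^sup>2 / 2 * (\<alpha> - 1) powr (1/2) + sqrt n * \<alpha> * (\<alpha> - 1) powr (1/4)) * \<gamma> powr (2/3)"
        "0 \<le> n * \<alpha> ^ 3 / (2 * (\<alpha> - 1)) * Sig"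
        using n \<alpha> nonneg by simp_all
      then show ?thesis unfolding K_def by linarith
    qed
    also have "\<dots> \<le> n * \<alpha>\<^sup>2 / (2 * \<tau>) + ?C" using n \<tau> by simp
    finally show ?thesis .
  next
    case True
    have hK: "\<bar>\<Sum>i\<in>UNIV. \<Sum>j\<in>UNIV. hh i j * v i * v j\<bar> \<le> K * (\<Sum>i\<in>UNIV. (v i)\<^sup>2)" for v
    proof -
      have N: "(\<Sum>i\<in>UNIV. (v i)\<^sup>2) \<ge> 0" by (simp add: sum_nonneg)
      have "- K2 * (\<Sum>i\<in>UNIV. (v i)\<^sup>2) \<ge> - K * (\<Sum>i\<in>UNIV. (v i)\<^sup>2)"
        "K3 * (\<Sum>i\<in>UNIV. (v i)\<^sup>2) \<le> K * (\<Sum>i\<in>UNIV. (v i)\<^sup>2)"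
        using N K by (auto intro!: mult_right_mono)
      then show ?thesis using h1[of v] h2[of v] by linarith
    qed
    have h2n: "(\<Sum>i\<in>UNIV. \<Sum>j\<in>UNIV. (hh i j)\<^sup>2) \<le> n * K\<^sup>2"
      unfolding n_def using symmetric_form_square_sum_le[OF hsym hK] .
    have tr: "(\<Sum>i\<in>UNIV. hh i i) \<ge> - n * K"
    proof -
      have "hh m m \<ge> - K" for m
        using h1[of "\<lambda>i. if i = m then 1 else 0"] K
        by (simp add: if_distrib[of "\<lambda>x. x^2"] if_distrib[of "\<lambda>x. _ * x"] cong: if_cong)
      then have "(\<Sum>i\<in>UNIV. hh i i) \<ge> (\<Sum>i\<in>(UNIV :: 'n set). - K)" by (intro sum_mono) auto
      then show ?thesis by (simp add: n_def)
    qed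
    have hess: "2 * (\<Sum>i\<in>UNIV. \<Sum>j\<in>UNIV. (D i (D j f) z)\<^sup>2) - 2 * \<alpha> * (\<Sum>i\<in>UNIV. \<Sum>j\<in>UNIV. hh i j * D i (D j f) z)
      \<ge> 2 / n * B\<^sup>2 - 2 * \<alpha> * K * B"
      using hessian_square_lower_bound[where H = "\<lambda>i j. D i (D j f) z" and h = "\<lambda>i j. hh i j", OF _ h2n[unfolded n_def] tr[unfolded n_def] B] True \<alpha> unfolding n_def by simp
    have ric: "(\<Sum>j\<in>UNIV. \<Sum>k\<in>UNIV. Rc j k * D j f z * D k f z) \<ge> - K1 * y"
      unfolding y by (rule Ric)
    have hff: "(\<Sum>i\<in>UNIV. \<Sum>j\<in>UNIV. hh i j * D i f z * D j f z) \<le> K3 * y"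
      unfolding y by (rule h2)
    have div: "(\<Sum>k\<in>UNIV. ((\<Sum>i\<in>UNIV. dh i i k) - (\<Sum>i\<in>UNIV. dh k i i) / 2) * D k f z)
      \<le> 3 / 2 * sqrt n * K4 * sqrt y"
      unfolding y n_def by (rule divergence_term_bound[OF dh]) (rule nonneg)
    have grq: "(\<Sum>k\<in>UNIV. dq k * D k f z) \<le> \<gamma> * sqrt y"
      using sum_mult_le_sqrt[OF dq, of "\<lambda>k. D k f z"] nonneg unfolding y by simp
    have fr: "(\<Sum>k\<in>UNIV. D k f z * D k r z) = (\<Sum>k\<in>UNIV. dq k * D k f z) + A1 * y"
      unfolding y dr by (simp add: algebra_simps sum.distrib sum_distrib_left power2_eq_square)
    have Lr: "(\<Sum>k\<in>UNIV. D k (D k r) z) = dLq - A1 * B + A2 * y"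
      unfolding ddr y B by simp
    have id: "(\<Sum>k\<in>UNIV. D k (D k P) z) - Dt P z + 2 * (\<Sum>k\<in>UNIV. D k f z * D k P z) =
     2 * (\<Sum>k\<in>UNIV. \<Sum>i\<in>UNIV. (D k (D i f) z)\<^sup>2) + 2 * (\<Sum>j\<in>UNIV. \<Sum>k\<in>UNIV. Rc j k * D j f z * D k f z)
     - \<alpha> * (\<Sum>k\<in>UNIV. D k (D k r) z) - 2 * (\<alpha> - 1) * (\<Sum>k\<in>UNIV. D k f z * D k r z)
     - 2 * (\<alpha> - 1) * (\<Sum>i\<in>UNIV. \<Sum>j\<in>UNIV. hh i j * D i f z * D j f z)
     - 2 * \<alpha> * (\<Sum>i\<in>UNIV. \<Sum>j\<in>UNIV. hh i j * D i (D j f) z)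
     - 2 * \<alpha> * (\<Sum>k\<in>UNIV. ((\<Sum>i\<in>UNIV. dh i i k) - (\<Sum>i\<in>UNIV. dh k i i) / 2) * D k f z)"
      using evolution_identity[of \<alpha>] unfolding P_def r_def w_def .
    have m1: "2 * (\<alpha> - 1) * (\<Sum>i\<in>UNIV. \<Sum>j\<in>UNIV. hh i j * D i f z * D j f z) \<le> 2 * (\<alpha> - 1) * (K3 * y)"
      using hff \<alpha> by (intro mult_left_mono) auto
    have m2: "2 * \<alpha> * (\<Sum>k\<in>UNIV. ((\<Sum>i\<in>UNIV. dh i i k) - (\<Sum>i\<in>UNIV. dh k i i) / 2) * D k f z)
        \<le> 2 * \<alpha> * (3 / 2 * sqrt n * K4 * sqrt y)"
      using div \<alpha> by (intro mult_left_mono) auto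
    have m3: "2 * (\<alpha> - 1) * (\<Sum>k\<in>UNIV. D k f z * D k r z) \<le> 2 * (\<alpha> - 1) * (\<gamma> * sqrt y + A1 * y)"
      unfolding fr using grq \<alpha> by (intro mult_left_mono) auto
    have m4: "\<alpha> * (\<Sum>k\<in>UNIV. D k (D k r) z) \<le> \<alpha> * (\<theta> - A1 * B + Sig * y)"
      unfolding Lr using dLq mult_right_mono[OF A(3) y0] \<alpha> by (intro mult_left_mono) auto
    \<comment> \<open>The occurrences of \<open>A1\<close> in the Laplacian and in the gradient of
      \<open>r\<close> combine to this expression, the origin of \<open>lam + Lam\<close>. The first
      summand is estimated using \<open>P z > 0\<close>.\<close>
    have m5: "- A1 * P z + (\<alpha> - 1) * A1 * y \<le> lam * P z + (\<alpha> - 1) * Lam * y"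
    proof -
      have "- A1 * P z \<le> lam * P z" using A pos by (intro mult_right_mono) auto
      moreover have "(\<alpha> - 1) * A1 * y \<le> (\<alpha> - 1) * Lam * y" using A y0 \<alpha> by (intro mult_right_mono mult_left_mono) auto
      ultimately show ?thesis by simp
    qed
    have "\<alpha> * B = P z + (\<alpha> - 1) * y" using \<alpha> by (simp add: B_def)
    then have aB: "\<alpha> * (A1 * B) = A1 * P z + (\<alpha> - 1) * A1 * y"
      by (metis (no_types, opaque_lifting) distrib_left mult.assoc mult.left_commute)
    have lhs: "(\<Sum>k\<in>UNIV. D k (D k P) z) - Dt P z + 2 * (\<Sum>k\<in>UNIV. D k f z * D k P z) \<le> P z / \<tau>"
      using crit by simp
    have "2 / n * B\<^sup>2 - 2 * \<alpha> * K * B \<le> P z / \<tau> + 2 * K1 * y + \<alpha> * (\<theta> - A1 * B + Sig * y)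
        + 2 * (\<alpha> - 1) * (\<gamma> * sqrt y + A1 * y) + 2 * (\<alpha> - 1) * (K3 * y) + 2 * \<alpha> * (3 / 2 * sqrt n * K4 * sqrt y)"
      using lhs[unfolded id] hess ric m1 m2 m3 m4 by linarith
    also have "\<dots> = P z / \<tau> + 2 * K1 * y + 2 * (\<alpha> - 1) * \<gamma> * sqrt y + \<alpha> * \<theta>
      + 2 * (\<alpha> - 1) * K3 * y + 3 * \<alpha> * sqrt n * K4 * sqrt y + (- A1 * P z + (\<alpha> - 1) * A1 * y) + \<alpha> * Sig * y"
      using aB by (simp add: algebra_simps)
    also have "\<dots> \<le> P z / \<tau> + 2 * K1 * y + 2 * (\<alpha> - 1) * \<gamma> * sqrt y + \<alpha> * \<theta>
      + 2 * (\<alpha> - 1) * K3 * y + 3 * \<alpha> * sqrt n * K4 * sqrt y + lam * P z + (\<alpha> - 1) * Lam * y + \<alpha> * Sig * y"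
      using m5 by simp
    finally show ?thesis
      using gradient_estimate_scalar[OF n \<alpha> pos y0 \<tau> K(1) nonneg(2-9) B_def] unfolding K_def by simp
  qed
qed

end

section \<open>Normal coordinates\<close>

text \<open>Gram-Schmidt for the inner product given by \<open>G\<close>, by induction on the set of
  indices already treated; the values of \<open>e\<close> outside that set are irrelevant.\<close>

lemma orthonormal_family_exists:
  fixes G :: "real^'n^'n"
  assumes sym: "transpose G = G" and pos: "\<And>v. v \<noteq> 0 \<Longrightarrow> v \<bullet> (G *v v) > 0"
  shows "\<exists>e :: 'n \<Rightarrow> real^'n. \<forall>i\<in>I. \<forall>j\<in>I. e i \<bullet> (G *v e j) = (if i = j then 1 else 0)"
proof -
  have fin: "finite I" by simp
  have s: "v \<bullet> (G *v w) = w \<bullet> (G *v v)" for v w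
    using sym by (metis dot_lmul_matrix inner_commute transpose_matrix_vector vector_transpose_matrix)
  from fin show ?thesis
  proof (induction I rule: finite_induct)
    case (insert m I)
    then obtain e :: "'n \<Rightarrow> real^'n" where e: "\<And>i j. i \<in> I \<Longrightarrow> j \<in> I \<Longrightarrow> e i \<bullet> (G *v e j) = (if i = j then 1 else 0)"
      by blast
    \<comment> \<open>Fewer vectors than the dimension span a proper subspace, so a further vector
      exists.\<close>
    have "card I < CARD('n)"
      using insert.hyps by (metis UNIV_I finite_code psubsetI psubset_card_mono subset_UNIV)
    then have "dim (span (e ` I)) < DIM(real^'n)"
      using dim_le_card'[of "e ` I"] card_image_le[OF insert.hyps(1), of e] insert.hyps(1) by (simp add: dim_span)
    then obtain v where v: "v \<notin> span (e ` I)"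
      by (metis UNIV_eq_I dim_UNIV less_irrefl)
    define w where "w = v - (\<Sum>i\<in>I. (v \<bullet> (G *v e i)) *\<^sub>R e i)"
    have "(\<Sum>i\<in>I. (v \<bullet> (G *v e i)) *\<^sub>R e i) \<in> span (e ` I)"
      by (intro span_sum span_scale span_base imageI)
    then have "w \<noteq> 0" using v unfolding w_def by auto
    then have pw: "w \<bullet> (G *v w) > 0" by (rule pos)
    have orth: "w \<bullet> (G *v e j) = 0" if "j \<in> I" for j
    proof -
      have "(\<Sum>i\<in>I. (v \<bullet> (G *v e i)) * (e i \<bullet> (G *v e j))) = (\<Sum>i\<in>I. (v \<bullet> (G *v e i)) * (if i = j then 1 else 0))"
        using e that by (intro sum.cong) auto
      also have "\<dots> = v \<bullet> (G *v e j)" using that insert.hyps(1) by (simp add: if_distrib[of "\<lambda>x. _ * x"] cong: if_cong)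
      finally show ?thesis by (simp add: w_def inner_diff_left inner_sum_left)
    qed
    define b where "b = w /\<^sub>R sqrt (w \<bullet> (G *v w))"
    have bj: "b \<bullet> (G *v e j) = 0" if "j \<in> I" for j by (simp add: b_def orth that)
    have bb: "b \<bullet> (G *v b) = 1"
    proof -
      have "b \<bullet> (G *v b) = (w \<bullet> (G *v w)) / (sqrt (w \<bullet> (G *v w)) * sqrt (w \<bullet> (G *v w)))"
        unfolding b_def by (simp add: matrix_vector_mult_scaleR divide_inverse flip: inverse_mult_distrib)
      then show ?thesis using pw by simp
    qed
    have "\<forall>i\<in>insert m I. \<forall>j\<in>insert m I. (e(m := b)) i \<bullet> (G *v (e(m := b)) j) = (if i = j then 1 else 0)"
    proof (intro ballI)
      fix i j assume ij: "i \<in> insert m I" "j \<in> insert m I"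
      show "(e(m := b)) i \<bullet> (G *v (e(m := b)) j) = (if i = j then 1 else 0)"
      proof (cases "i = m"; cases "j = m")
        assume "i \<noteq> m" "j = m"
        then show ?thesis using ij bj[of i] s[of "e i" b] by simp
      qed (use ij e bj bb in auto)
    qed
    then show ?case by blast
  qed simp
qed

text \<open>The columns of \<open>L\<close> are a basis orthonormal for \<open>G\<close>.\<close>

lemma congruent_to_identity:
  fixes G :: "real^'n^'n"
  assumes "transpose G = G" "\<And>v. v \<noteq> 0 \<Longrightarrow> v \<bullet> (G *v v) > 0"
  shows "\<exists>L :: real^'n^'n. transpose L ** G ** L = mat 1"
proof -
  obtain e :: "'n \<Rightarrow> real^'n" where e: "\<And>i j. e i \<bullet> (G *v e j) = (if i = j then 1 else 0)"
    using orthonormal_family_exists[OF assms, of UNIV] by auto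
  define L :: "real^'n^'n" where "L = (\<chi> a i. e i $ a)"
  have "(transpose L ** G ** L) $ i $ j = e i \<bullet> (G *v e j)" for i j
  proof -
    have "(transpose L ** G ** L) $ i $ j = (transpose L ** (G ** L)) $ i $ j"
      by (simp add: matrix_mul_assoc)
    then show ?thesis
      by (simp add: matrix_matrix_mult_def matrix_vector_mult_def inner_vec_def transpose_def L_def)
  qed
  then have "transpose L ** G ** L = mat 1" by (simp add: e vec_eq_iff mat_def)
  then show ?thesis by blast
qed

lemma has_derivative_vec_lambda:
  fixes f :: "'n::finite \<Rightarrow> 'a::real_normed_vector \<Rightarrow> real"
  assumes "\<And>i. (f i has_derivative D i) F"
  shows "((\<lambda>x. \<chi> i. f i x) has_derivative (\<lambda>v. \<chi> i. D i v)) F"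
proof -
  have "(\<chi> i. x i) = (\<Sum>i\<in>UNIV. x i *\<^sub>R axis i 1)" for x :: "'n \<Rightarrow> real"
    by (simp add: vec_eq_iff axis_def if_distrib cong: if_cong)
  then show ?thesis
    by (simp add: has_derivative_sum has_derivative_scaleR_left assms)
qed

text \<open>A linear change of coordinates turns the metric at \<open>p\<close> into the identity; the quadratic change
  \<open>z \<mapsto> z - \<Gamma>(z, z) / 2\<close>, with \<open>\<Gamma>\<close> the Christoffel symbols at \<open>p\<close>, then cancels its first
  derivatives.\<close>

lemma normal_chart_exists:
  fixes c :: "('a, 'n::finite) chart" and G :: "('a, 'n) tensor2"
  assumes A: "smooth_structure X \<A>" and c: "c \<in> \<A>" and p: "p \<in> chart_dom c"
    and sym: "symmetric_tensor_field \<A> G"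
    and pos: "\<And>c p v. c \<in> \<A> \<Longrightarrow> p \<in> chart_dom c \<Longrightarrow> v \<noteq> 0 \<Longrightarrow> v \<bullet> (G c p *v v) > 0"
    and smooth: "\<And>c. c \<in> \<A> \<Longrightarrow> smooth_on (chart_image c) (\<lambda>x. G c (chart_inv c x))"
  obtains c' where "c' \<in> \<A>" "p \<in> chart_dom c'" "chart_map c' p = 0" "G c' p = mat 1"
    "\<And>i j k. dd (axis k 1) (\<lambda>x. G c' (chart_inv c' x) $ i $ j) 0 = 0"
proof -
  have tr: "G c p = transpose (jacobian c d p) ** G d p ** jacobian c d p"
    if "c \<in> \<A>" "d \<in> \<A>" "p \<in> chart_dom c" "p \<in> chart_dom d" for c d p
    using sym that unfolding symmetric_tensor_field_def by blast
  have st: "transpose (G c p) = G c p" if "c \<in> \<A>" "p \<in> chart_dom c" for c p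
    using sym that unfolding symmetric_tensor_field_def by blast
  have "\<exists>L :: real^'n^'n. transpose L ** G c p ** L = mat 1"
    by (rule congruent_to_identity) (simp_all add: st[OF c p] pos[OF c p])
  then obtain L :: "real^'n^'n" where L: "transpose L ** G c p ** L = mat 1" by blast
  have Linv: "invertible L" using L invertible_left_inverse by blast
  define \<psi>1 where "\<psi>1 z = chart_map c p + L *v z" for z
  have s1: "smooth_on UNIV \<psi>1"
    unfolding \<psi>1_def by (intro smooth_intros smooth_on_bounded_linear) (simp add: linear_linear[symmetric])
  have "(\<psi>1 has_derivative (\<lambda>v. L *v v)) (at z)" for z
    unfolding \<psi>1_def by (auto intro!: derivative_eq_intros bounded_linear_imp_has_derivative)
  then have d1: "matrix (frechet_derivative \<psi>1 (at z)) = L" for z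
    using frechet_derivative_at by (metis matrix_of_matrix_vector_mul)
  have ps1: "\<psi>1 0 = chart_map c p" by (simp add: \<psi>1_def)
  have inv1: "invertible (matrix (frechet_derivative \<psi>1 (at 0)))" using Linv by (simp add: d1)
  obtain c1 where c1: "c1 \<in> \<A>" "p \<in> chart_dom c1" "chart_map c1 p = 0" "chart_dom c1 \<subseteq> chart_dom c"
    and J1: "\<And>z. z \<in> chart_image c1 \<Longrightarrow> jacobian c1 c (chart_inv c1 z) = matrix (frechet_derivative \<psi>1 (at z))"
    using reparametrized_chart_exists[OF A c p s1 ps1 inv1] by metis
  have z1: "0 \<in> chart_image c1" "chart_inv c1 0 = p"
    using imageI[OF c1(2), of "chart_map c1"] chart_inv_map[OF smooth_structureD(1)[OF A c1(1)] c1(2)] c1(3) by simp_all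
  have G1: "G c1 p = mat 1"
    using tr[OF c1(1) c c1(2) p] J1[OF z1(1)] L by (simp add: z1 d1)
  define Gh where "Gh a b x = G c1 (chart_inv c1 x) $ a $ b" for a b x
  have sGh: "smooth_on (chart_image c1) (Gh a b)" for a b
    unfolding Gh_def by (intro smooth_intros smooth c1)
  have o1: "open (chart_image c1)" using is_chartD(2)[OF smooth_structureD(1)[OF A c1(1)]] .
  have Gh_sym: "Gh a b x = Gh b a x" if "x \<in> chart_image c1" for a b x
    using arg_cong[OF st[OF c1(1) chart_inv_in[OF that]], of "\<lambda>M. M $ b $ a"]
    by (simp add: transpose_def Gh_def)
  have Gh0: "Gh a b 0 = (if a = b then 1 else 0)" for a b
    by (simp add: Gh_def z1 G1 mat_def)
  define dG where "dG k a b = dd (axis k 1) (Gh a b) 0" for k a b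
  have dG_sym: "dG k a b = dG k b a" for k a b
    unfolding dG_def by (rule dd_cong[OF o1 z1(1) Gh_sym])
  \<comment> \<open>The Christoffel symbols at \<open>p\<close>; the inverse metric is absent
    because the first chart has made it the identity there.\<close>
  define \<Gamma> where "\<Gamma> a i j = (dG j i a + dG i j a - dG a i j) / 2" for a i j
  have \<Gamma>_sym: "\<Gamma> a i j = \<Gamma> a j i" for a i j
    unfolding \<Gamma>_def using dG_sym[of a i j] by simp
  define \<psi> :: "real^'n \<Rightarrow> real^'n" where "\<psi> z = z - (\<chi> a. (\<Sum>i\<in>UNIV. \<Sum>j\<in>UNIV. \<Gamma> a i j * (z $ i * z $ j)) / 2)" for z
  have s2: "smooth_on UNIV \<psi>"
    unfolding \<psi>_def by (intro smooth_intros) auto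
  have \<psi>0: "\<psi> 0 = 0" by (simp add: \<psi>_def vec_eq_iff)
  have "(\<psi> has_derivative (\<lambda>v. v - (\<chi> a. \<Sum>i\<in>UNIV. \<Sum>j\<in>UNIV. \<Gamma> a i j * (v $ i * z $ j)))) (at z)" for z
  proof -
    have "((\<lambda>z. (\<Sum>i\<in>UNIV. \<Sum>j\<in>UNIV. \<Gamma> a i j * (z $ i * z $ j)) / 2) has_derivative
        (\<lambda>v. (\<Sum>i\<in>UNIV. \<Sum>j\<in>UNIV. \<Gamma> a i j * (z $ i * v $ j + v $ i * z $ j)) / 2)) (at z)" for a
      by (intro bounded_linear.has_derivative[OF bounded_linear_divide] has_derivative_sum has_derivative_mult_right has_derivative_mult
           bounded_linear_imp_has_derivative bounded_linear_vec_nth)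
    \<comment> \<open>Symmetry of \<open>\<Gamma>\<close> in its last two indices absorbs the factor
      1/2.\<close>
    moreover have "(\<Sum>i\<in>UNIV. \<Sum>j\<in>UNIV. \<Gamma> a i j * (z $ i * v $ j + v $ i * z $ j)) / 2
        = (\<Sum>i\<in>UNIV. \<Sum>j\<in>UNIV. \<Gamma> a i j * (v $ i * z $ j))" for a v
    proof -
      have "(\<Sum>i\<in>UNIV. \<Sum>j\<in>UNIV. \<Gamma> a i j * (z $ i * v $ j)) = (\<Sum>i\<in>UNIV. \<Sum>j\<in>UNIV. \<Gamma> a i j * (v $ i * z $ j))"
        by (subst sum.swap) (simp add: \<Gamma>_sym[of a] mult_ac)
      then show ?thesis by (simp add: distrib_left sum.distrib)
    qed
    ultimately show ?thesis
      unfolding \<psi>_def by (intro has_derivative_diff has_derivative_ident has_derivative_vec_lambda) auto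
  qed
  note \<psi>d = frechet_derivative_at[OF this, symmetric]
  define J where "J z = matrix (frechet_derivative \<psi> (at z))" for z
  have J: "J z $ a $ i = (if a = i then 1 else 0) - (\<Sum>j\<in>UNIV. \<Gamma> a i j * z $ j)" for z a i
  proof -
    have "(\<Sum>m\<in>UNIV. \<Sum>j\<in>UNIV. \<Gamma> a m j * (axis i 1 $ m * z $ j)) = (\<Sum>m\<in>UNIV. (\<Sum>j\<in>UNIV. \<Gamma> a m j * z $ j) * (if m = i then 1 else 0))"
      by (intro sum.cong) (auto simp: axis_def)
    then show ?thesis unfolding J_def matrix_def \<psi>d by (simp add: axis_def)
  qed
  have J0: "J 0 = mat 1" by (simp add: vec_eq_iff J mat_def)
  have ps: "\<psi> 0 = chart_map c1 p" by (simp add: c1 \<psi>0)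
  have inv2: "invertible (matrix (frechet_derivative \<psi> (at 0)))"
    using J0 unfolding J_def by (simp add: invertible_right_inverse)
  obtain c2 where c2: "c2 \<in> \<A>" "p \<in> chart_dom c2" "chart_map c2 p = 0" "chart_dom c2 \<subseteq> chart_dom c1"
    and ci2: "\<And>z. z \<in> chart_image c2 \<Longrightarrow> chart_inv c2 z = chart_inv c1 (\<psi> z)"
    and im2: "\<And>z. z \<in> chart_image c2 \<Longrightarrow> \<psi> z \<in> chart_image c1"
    and J2: "\<And>z. z \<in> chart_image c2 \<Longrightarrow> jacobian c2 c1 (chart_inv c2 z) = J z"
    using reparametrized_chart_exists[OF A c1(1,2) s2 ps inv2] unfolding J_def by metis
  have z2: "0 \<in> chart_image c2" "chart_inv c2 0 = p"
    using imageI[OF c2(2), of "chart_map c2"] chart_inv_map[OF smooth_structureD(1)[OF A c2(1)] c2(2)] c2(3) by simp_all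
  have o2: "open (chart_image c2)" using is_chartD(2)[OF smooth_structureD(1)[OF A c2(1)]] .
  \<comment> \<open>The transformation law is stated on the whole chart image, because it is
    differentiated at 0.\<close>
  have G2: "G c2 (chart_inv c2 z) $ i $ j = (\<Sum>b\<in>UNIV. \<Sum>a\<in>UNIV. J z $ a $ i * Gh a b (\<psi> z) * J z $ b $ j)"
    if z: "z \<in> chart_image c2" for z i j
  proof -
    have "chart_inv c2 z \<in> chart_dom c1" using chart_inv_in[OF z] c2(4) by blast
    then have "G c2 (chart_inv c2 z) = transpose (J z) ** G c1 (chart_inv c2 z) ** J z"
      using tr[OF c2(1) c1(1) chart_inv_in[OF z]] J2[OF z] by simp
    then show ?thesis
      by (simp add: matrix_matrix_mult_def transpose_def Gh_def ci2[OF z] sum_distrib_right)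
  qed
  have "G c2 p = mat 1"
    using tr[OF c2(1) c1(1) c2(2) c1(2)] J2[OF z2(1)] G1 by (simp add: z2 J0 transpose_mat)
  moreover have "dd (axis k 1) (\<lambda>x. G c2 (chart_inv c2 x) $ i $ j) 0 = 0" for i j k
  proof -
    have dJ: "((\<lambda>z. J z $ a $ i) has_derivative (\<lambda>v. - (\<Sum>j\<in>UNIV. \<Gamma> a i j * v $ j))) (at 0)" for a i
    proof -
      have "((\<lambda>z. (if a = i then 1 else 0) - (\<Sum>j\<in>UNIV. \<Gamma> a i j * z $ j)) has_derivative
          (\<lambda>v. 0 - (\<Sum>j\<in>UNIV. \<Gamma> a i j * v $ j))) (at 0)"
        by (intro has_derivative_diff has_derivative_const has_derivative_sum has_derivative_mult_right
            bounded_linear_imp_has_derivative bounded_linear_vec_nth)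
      then show ?thesis unfolding J by simp
    qed
    have dJ1: "(\<lambda>z. J z $ a $ i) differentiable (at 0)" for a i
      using dJ differentiable_def by blast
    have dJ2: "dd (axis k 1) (\<lambda>z. J z $ a $ i) 0 = - \<Gamma> a i k" for a i
    proof -
      have "dd (axis k 1) (\<lambda>z. J z $ a $ i) 0 = - (\<Sum>j\<in>UNIV. \<Gamma> a i j * (if j = k then 1 else 0))"
        using dd_eqI[OF dJ] by (simp add: axis_def)
      then show ?thesis by simp
    qed
    have \<psi>0d: "(\<psi> has_derivative (\<lambda>v. v)) (at 0)"
      using smooth_on_frechet(1)[OF open_UNIV s2, of 0] unfolding \<psi>d by (simp add: zero_vec_def[symmetric])
    have "(Gh a b has_derivative (\<lambda>v. dd v (Gh a b) 0)) (at (\<psi> 0))" for a b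
      unfolding \<psi>0 by (intro differentiable_has_dd smooth_on_differentiable[OF o1 sGh z1(1)])
    from has_derivative_compose[OF \<psi>0d this]
    have dGh: "((\<lambda>z. Gh a b (\<psi> z)) has_derivative (\<lambda>v. dd v (Gh a b) 0)) (at 0)" for a b .
    have dGh1: "(\<lambda>z. Gh a b (\<psi> z)) differentiable (at 0)" for a b
      using dGh differentiable_def by blast
    have dGh2: "dd (axis k 1) (\<lambda>z. Gh a b (\<psi> z)) 0 = dG k a b" for a b
      using dd_eqI[OF dGh] by (simp add: dG_def)
    have sum_if: "(\<Sum>a\<in>UNIV. if Q then F a else 0) = (if Q then \<Sum>a\<in>UNIV. F a else 0)" for Q and F :: "'n \<Rightarrow> real"
      by simp
    have "dd (axis k 1) (\<lambda>x. G c2 (chart_inv c2 x) $ i $ j) 0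
       = dd (axis k 1) (\<lambda>z. \<Sum>b\<in>UNIV. \<Sum>a\<in>UNIV. J z $ a $ i * Gh a b (\<psi> z) * J z $ b $ j) 0"
      by (rule dd_cong[OF o2 z2(1) G2])
    also have "\<dots> = (\<Sum>b\<in>UNIV. \<Sum>a\<in>UNIV. dd (axis k 1) (\<lambda>z. J z $ a $ i * Gh a b (\<psi> z) * J z $ b $ j) 0)"
      by (simp add: dd_sum dJ1 dGh1 differentiable_mult differentiable_sum)
    also have "(\<Sum>b\<in>UNIV. \<Sum>a\<in>UNIV. dd (axis k 1) (\<lambda>z. J z $ a $ i * Gh a b (\<psi> z) * J z $ b $ j) 0)
       = (\<Sum>b\<in>UNIV. \<Sum>a\<in>UNIV. - \<Gamma> a i k * (if a = b then 1 else 0) * (if b = j then 1 else 0)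
        + (if a = i then 1 else 0) * dG k a b * (if b = j then 1 else 0)
        + (if a = i then 1 else 0) * (if a = b then 1 else 0) * - \<Gamma> b j k)"
      by (intro sum.cong refl, subst dd_triple_product[OF dJ1 dGh1 dJ1]) (simp add: dJ2 dGh2 J0 \<psi>0 Gh0 mat_def)
    also have "\<dots> = - \<Gamma> j i k + dG k i j - \<Gamma> i j k"
      by (simp add: sum_if sum.distrib sum_negf sum_subtractf mult.assoc if_distrib[of "\<lambda>x. _ * x"] if_distrib[of "\<lambda>x. x * _"] cong: if_cong)
    \<comment> \<open>Metric compatibility at \<open>p\<close>: the derivative of the metric is the
      sum of two Christoffel symbols with lowered index.\<close>
    also have "\<dots> = 0"
      unfolding \<Gamma>_def using dG_sym by (simp add: field_simps)
    finally show ?thesis .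
  qed
  ultimately show ?thesis using that c2 by blast
qed

section \<open>Evolving metrics in charts\<close>

lemma pd_eq_dd: "x \<in> chart_image c \<Longrightarrow> pd c i \<phi> (chart_inv c x) = dd (axis i 1) (\<lambda>x. \<phi> (chart_inv c x)) x"
  by (simp add: pd_def dd_def o_def)

lemma matrix_vector_inner_sum:
  fixes M :: "real^'n^'n"
  shows "v \<bullet> (M *v w) = (\<Sum>i\<in>UNIV. \<Sum>j\<in>UNIV. M $ i $ j * v $ i * w $ j)"
  by (simp add: inner_vec_def matrix_vector_mult_def sum_distrib_left mult_ac)

lemma positive_matrix_invertible:
  fixes M :: "real^'n^'n"
  assumes "\<And>v. v \<noteq> 0 \<Longrightarrow> v \<bullet> (M *v v) > 0"
  shows "invertible M"
proof -
  have "v = 0" if "M *v v = 0" for v using assms[of v] that by fastforce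
  then show ?thesis using matrix_left_invertible_ker invertible_left_inverse by blast
qed

text \<open>With v = M w the form becomes \<open>w \<bullet> (M *v w)\<close>. Squaring
  \<open>grad_norm\<close> therefore undoes its square root.\<close>

lemma positive_matrix_inv_nonneg:
  fixes M :: "real^'n^'n"
  assumes "\<And>v. v \<noteq> 0 \<Longrightarrow> v \<bullet> (M *v v) > 0"
  shows "v \<bullet> (matrix_inv M *v v) \<ge> 0"
proof -
  define w where "w = matrix_inv M *v v"
  have "v = M *v w"
    using matrix_inv_mult(1)[OF positive_matrix_invertible[OF assms]] by (simp add: w_def matrix_vector_mul_assoc)
  then have "v \<bullet> (matrix_inv M *v v) = w \<bullet> (M *v w)"
    by (metis inner_commute w_def)
  also have "\<dots> \<ge> 0" using assms[of w] by (cases "w = 0") auto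
  finally show ?thesis .
qed

locale evolving_metric =
  fixes X :: "'a topology" and \<A> :: "('a, 'n::finite) chart set"
    and g :: "real \<Rightarrow> ('a, 'n) tensor2" and u :: "'a \<Rightarrow> real \<Rightarrow> real" and T :: real
  assumes M: "closed_manifold X \<A>"
    and g: "smooth_metric_family \<A> T g"
    and u: "smooth_spacetime \<A> T u"
    and u_pos: "\<And>p t. p \<in> topspace X \<Longrightarrow> t \<in> {0..T} \<Longrightarrow> u p t > 0"
begin

text \<open>The time interval is open because \<open>dd\<close> needs a full neighbourhood in
  space-time; time \<open>T\<close> is reached by continuity.\<close>

definition W :: "('a, 'n) chart \<Rightarrow> ((real^'n) \<times> real) set" where "W c = chart_image c \<times> {0<..<T}"
definition gm where "gm c i j y = g (snd y) c (chart_inv c (fst y)) $ i $ j" for c :: "('a, 'n) chart" and i j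
definition gi where "gi c i j y = ginv (g (snd y)) c i j (chart_inv c (fst y))" for c :: "('a, 'n) chart" and i j
definition lu where "lu c y = ln (u (chart_inv c (fst y)) (snd y))" for c :: "('a, 'n) chart"

lemma atlas: "smooth_structure X \<A>"
  using M by (simp add: closed_manifold_def)

lemma dom_top: "c \<in> \<A> \<Longrightarrow> p \<in> chart_dom c \<Longrightarrow> p \<in> topspace X"
  using smooth_structureD(2)[OF atlas] by blast

lemma open_image: "c \<in> \<A> \<Longrightarrow> open (chart_image c)"
  using is_chartD(2) smooth_structureD(1)[OF atlas] by blast

lemma open_Wc: "c \<in> \<A> \<Longrightarrow> open (W c)"
  unfolding W_def by (intro open_Times open_image) auto

lemma g_sym: "t \<in> {0..T} \<Longrightarrow> symmetric_tensor_field \<A> (g t)"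
  using g by (simp add: smooth_metric_family_def)

lemma g_pos: "t \<in> {0..T} \<Longrightarrow> c \<in> \<A> \<Longrightarrow> p \<in> chart_dom c \<Longrightarrow> v \<noteq> 0 \<Longrightarrow> v \<bullet> (g t c p *v v) > 0"
  using g unfolding smooth_metric_family_def by blast

lemma g_invertible: "t \<in> {0..T} \<Longrightarrow> c \<in> \<A> \<Longrightarrow> p \<in> chart_dom c \<Longrightarrow> invertible (g t c p)"
  by (rule positive_matrix_invertible) (rule g_pos)

lemma g_smooth: "c \<in> \<A> \<Longrightarrow> smooth_on (chart_image c \<times> {0..T}) (\<lambda>y. g (snd y) c (chart_inv c (fst y)))"
  using g by (simp add: smooth_metric_family_def case_prod_beta')

lemma u_smooth: "c \<in> \<A> \<Longrightarrow> smooth_on (chart_image c \<times> {0..T}) (\<lambda>y. u (chart_inv c (fst y)) (snd y))"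
  using u by (simp add: smooth_spacetime_def case_prod_beta')

lemma W_subset: "W c \<subseteq> chart_image c \<times> {0..T}"
  by (auto simp: W_def)

lemma g_smooth_slice:
  "c \<in> \<A> \<Longrightarrow> t \<in> {0..T} \<Longrightarrow> smooth_on (chart_image c) (\<lambda>x. g t c (chart_inv c x))"
  using smooth_on_slice[OF g_smooth] by fastforce

lemma local_metric_chart: "c \<in> \<A> \<Longrightarrow> local_metric (W c) (gm c) (gi c) (lu c)"
proof
  assume c: "c \<in> \<A>"
  show "open (W c)" by (rule open_Wc[OF c])
  have gW: "smooth_on (W c) (\<lambda>y. g (snd y) c (chart_inv c (fst y)))"
    by (rule smooth_on_subset[OF g_smooth[OF c] W_subset])
  have in_dom: "chart_inv c (fst y) \<in> chart_dom c" "snd y \<in> {0..T}" if "y \<in> W c" for y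
    using that by (auto simp: W_def)
  show "smooth_on (W c) (gm c i j)" for i j
    unfolding gm_def[abs_def] by (intro smooth_intros gW)
  show "smooth_on (W c) (gi c i j)" for i j
    unfolding gi_def[abs_def] ginv_def by (intro smooth_intros gW g_invertible c in_dom)
  show "smooth_on (W c) (lu c)"
    unfolding lu_def[abs_def] using in_dom dom_top[OF c] u_pos
    by (intro smooth_intros smooth_on_subset[OF u_smooth[OF c] W_subset]) blast
  show "(\<Sum>j\<in>UNIV. gi c i j y * gm c j k y) = (if i = k then 1 else 0)" if "y \<in> W c" for y i k
  proof -
    have "(matrix_inv (g (snd y) c (chart_inv c (fst y))) ** g (snd y) c (chart_inv c (fst y))) $ i $ k
        = (mat 1 :: real^'n^'n) $ i $ k"
      using matrix_inv_mult(2)[OF g_invertible[OF in_dom(2)[OF that] c in_dom(1)[OF that]]] by simp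
    then show ?thesis by (simp add: matrix_matrix_mult_def gi_def gm_def ginv_def mat_def)
  qed
  show "gm c i j y = gm c j i y" if "y \<in> W c" for y i j
  proof -
    have "transpose (g (snd y) c (chart_inv c (fst y))) = g (snd y) c (chart_inv c (fst y))"
      using g_sym[OF in_dom(2)[OF that]] c in_dom(1)[OF that] unfolding symmetric_tensor_field_def by blast
    from arg_cong[OF this, of "\<lambda>M. M $ j $ i"] show ?thesis by (simp add: transpose_def gm_def)
  qed
qed

text \<open>Transfers \<open>pd\<close> at a frozen time to \<open>dd\<close> on space-time. Since
  \<open>\<phi>\<close> is to be represented by \<open>\<Phi>\<close> on the whole chart image, the
  lemma can be applied again to the resulting derivative.\<close>

lemma pd_eq_spacetime:
  assumes c: "c \<in> \<A>" and y: "(x, t) \<in> W c" and s: "smooth_on (W c) \<Phi>"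
    and eq: "\<And>y. y \<in> chart_image c \<Longrightarrow> \<phi> (chart_inv c y) = \<Phi> (y, t)"
  shows "pd c i \<phi> (chart_inv c x) = dd (axis i 1, 0) \<Phi> (x, t)"
proof -
  have x: "x \<in> chart_image c" using y by (simp add: W_def)
  have "pd c i \<phi> (chart_inv c x) = dd (axis i 1) (\<lambda>y. \<phi> (chart_inv c y)) x" by (rule pd_eq_dd[OF x])
  also have "\<dots> = dd (axis i 1) (\<lambda>y. \<Phi> (y, t)) x" by (rule dd_cong[OF open_image[OF c] x eq])
  also have "\<dots> = dd (axis i 1, 0) \<Phi> (x, t)"
    by (rule dd_slice_fst[OF smooth_on_differentiable[OF open_Wc[OF c] s y]])
  finally show ?thesis .
qed

section \<open>Geometric quantities in a fixed chart, expressed by the logarithm of u\<close>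

context
  fixes c :: "('a, 'n) chart"
  assumes c: "c \<in> \<A>"
begin

interpretation L: local_metric "W c" "gm c" "gi c" "lu c"
  by (rule local_metric_chart[OF c])

lemma W_image: "(x, t) \<in> W c \<Longrightarrow> y \<in> chart_image c \<Longrightarrow> (y, t) \<in> W c"
  by (simp add: W_def)

lemma christoffel_eq: "(x, t) \<in> W c \<Longrightarrow> christoffel (g t) c k i j (chart_inv c x) = L.Chr k i j (x, t)"
proof -
  assume y: "(x, t) \<in> W c"
  have "pd c i (\<lambda>x. g t c x $ j $ l) (chart_inv c x) = dd (axis i 1, 0) (gm c j l) (x, t)" for i j l
    by (rule pd_eq_spacetime[OF c y L.s_gm]) (simp add: gm_def)
  then show ?thesis by (simp add: christoffel_def L.Chr_def gi_def)
qed

lemma riemann_eq: "(x, t) \<in> W c \<Longrightarrow> riemann (g t) c l i j k (chart_inv c x)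
    = dd (axis i 1, 0) (L.Chr l j k) (x, t) - dd (axis j 1, 0) (L.Chr l i k) (x, t)
      + (\<Sum>m\<in>UNIV. L.Chr m j k (x, t) * L.Chr l i m (x, t) - L.Chr m i k (x, t) * L.Chr l j m (x, t))"
proof -
  assume y: "(x, t) \<in> W c"
  have "pd c i (christoffel (g t) c l j k) (chart_inv c x) = dd (axis i 1, 0) (L.Chr l j k) (x, t)" for i j
    by (rule pd_eq_spacetime[OF c y L.s_Chr]) (rule christoffel_eq[OF W_image[OF y]])
  then show ?thesis by (simp add: riemann_def christoffel_eq[OF y])
qed

lemma hessian_eq:
  assumes y: "(x, t) \<in> W c" and s: "smooth_on (W c) \<Phi>"
    and eq: "\<And>y. y \<in> chart_image c \<Longrightarrow> \<phi> (chart_inv c y) = \<Phi> (y, t)"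
  shows "hessian (g t) c \<phi> i j (chart_inv c x) = dd (axis i 1, 0) (dd (axis j 1, 0) \<Phi>) (x, t)
    - (\<Sum>k\<in>UNIV. L.Chr k i j (x, t) * dd (axis k 1, 0) \<Phi> (x, t))"
proof -
  have 1: "pd c j \<phi> (chart_inv c y) = dd (axis j 1, 0) \<Phi> (y, t)" if "y \<in> chart_image c" for j y
    by (rule pd_eq_spacetime[OF c W_image[OF y that] s eq])
  have "pd c i (pd c j \<phi>) (chart_inv c x) = dd (axis i 1, 0) (dd (axis j 1, 0) \<Phi>) (x, t)"
    by (rule pd_eq_spacetime[OF c y L.s_dd[OF s] 1])
  then show ?thesis
    using 1[of x] y by (simp add: hessian_def christoffel_eq[OF y] W_def)
qed

lemma u_eq_exp: "(x, t) \<in> W c \<Longrightarrow> u (chart_inv c x) t = exp (lu c (x, t))"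
  using u_pos dom_top[OF c] by (auto simp: lu_def W_def)

lemma smooth_u: "smooth_on (W c) (\<lambda>y. exp (lu c y))"
proof -
  have "smooth_on (W c) (\<lambda>y. u (chart_inv c (fst y)) (snd y))"
    by (rule smooth_on_subset[OF u_smooth[OF c] W_subset])
  then show ?thesis using u_eq_exp by (subst smooth_on_cong) auto
qed

lemma dd_u: "y \<in> W c \<Longrightarrow> dd v (\<lambda>y. exp (lu c y)) y = exp (lu c y) * dd v (lu c) y"
  by (intro dd_compose smooth_on_differentiable[OF L.open_W L.s_f] DERIV_exp)

lemma pd_u: "(x, t) \<in> W c \<Longrightarrow> pd c i (\<lambda>x. u x t) (chart_inv c x) = exp (lu c (x, t)) * dd (axis i 1, 0) (lu c) (x, t)"
  using pd_eq_spacetime[OF c _ smooth_u, of x t "\<lambda>x. u x t"] u_eq_exp W_image by (simp add: dd_u)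

text \<open>The chain rule gives du = u df; nonnegativity of the inverse metric removes the square
  root in \<open>grad_norm\<close>.\<close>

lemma grad_norm_u: "(x, t) \<in> W c \<Longrightarrow>
    (grad_norm (g t) c (\<lambda>x. u x t) (chart_inv c x))\<^sup>2 / (u (chart_inv c x) t)\<^sup>2 = L.gradsq (x, t)"
proof -
  assume y: "(x, t) \<in> W c"
  define G where "G = g t c (chart_inv c x)"
  have t: "t \<in> {0..T}" and x: "chart_inv c x \<in> chart_dom c" using y by (auto simp: W_def)
  define v :: "real^'n" where "v = (\<chi> i. pd c i (\<lambda>x. u x t) (chart_inv c x))"
  have "0 \<le> v \<bullet> (matrix_inv G *v v)"
    unfolding G_def by (rule positive_matrix_inv_nonneg) (rule g_pos[OF t c x])
  then have "(grad_norm (g t) c (\<lambda>x. u x t) (chart_inv c x))\<^sup>2 = v \<bullet> (matrix_inv G *v v)"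
    unfolding grad_norm_def by (simp add: matrix_vector_inner_sum v_def ginv_def G_def)
  also have "\<dots> = (u (chart_inv c x) t)\<^sup>2 * L.gradsq (x, t)"
    by (simp add: matrix_vector_inner_sum v_def G_def L.gradsq_def gi_def ginv_def pd_u[OF y] u_eq_exp[OF y]
        sum_distrib_left power2_eq_square mult_ac)
  finally show ?thesis using u_eq_exp[OF y] by simp
qed

text \<open>The second derivatives of e^f contain the extra product of two first derivatives, whose
  trace is \<open>gradsq\<close>.\<close>

lemma laplacian_u: "(x, t) \<in> W c \<Longrightarrow>
    laplacian (g t) c (\<lambda>x. u x t) (chart_inv c x) = u (chart_inv c x) t * (L.Lap (x, t) + L.gradsq (x, t))"
proof -
  assume y: "(x, t) \<in> W c"
  let ?f = "lu c" let ?D = "\<lambda>k. dd (axis k 1, 0)"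
  have dd2: "?D i (?D j (\<lambda>y. exp (?f y))) (x, t)
      = exp (?f (x, t)) * (?D i (?D j ?f) (x, t) + ?D i ?f (x, t) * ?D j ?f (x, t))" for i j
  proof -
    have "?D i (?D j (\<lambda>y. exp (?f y))) (x, t) = ?D i (\<lambda>y. exp (?f y) * ?D j ?f y) (x, t)"
      by (rule dd_cong[OF L.open_W y dd_u])
    also have "\<dots> = exp (?f (x, t)) * (?D i (?D j ?f) (x, t) + ?D i ?f (x, t) * ?D j ?f (x, t))"
      by (subst dd_mult) (auto intro!: smooth_on_differentiable[OF L.open_W _ y] smooth_u L.s_dd L.s_f
          simp: dd_u[OF y] algebra_simps)
    finally show ?thesis .
  qed
  have "laplacian (g t) c (\<lambda>x. u x t) (chart_inv c x) = (\<Sum>i\<in>UNIV. \<Sum>j\<in>UNIV. gi c i j (x, t)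
     * (exp (?f (x, t)) * (?D i (?D j ?f) (x, t) + ?D i ?f (x, t) * ?D j ?f (x, t))
       - (\<Sum>k\<in>UNIV. L.Chr k i j (x, t) * (exp (?f (x, t)) * ?D k ?f (x, t)))))"
    unfolding laplacian_def
    by (subst hessian_eq[OF y smooth_u]) (use u_eq_exp W_image[OF y] y in \<open>auto simp: dd2 dd_u gi_def\<close>)
  also have "\<dots> = exp (?f (x, t)) * (L.Lap (x, t) + L.gradsq (x, t))"
    unfolding L.Lap_def L.gradsq_def
    by (simp add: sum_distrib_left algebra_simps sum.distrib sum_subtractf)
  finally show ?thesis by (simp add: u_eq_exp[OF y])
qed

text \<open>At an interior time the derivative within the closed interval is the full derivative.
  This identifies \<open>h\<close> with half the time derivative of the metric components.\<close>

lemma time_deriv_eq: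
  assumes y: "(x, t) \<in> W c" and s: "smooth_on (W c) \<Phi>"
    and eq: "\<And>s. s \<in> {0<..<T} \<Longrightarrow> \<phi> s = \<Phi> (x, s)"
    and d: "(\<phi> has_vector_derivative d) (at t within {0..T})"
  shows "d = dd (0, 1) \<Phi> (x, t)"
proof -
  have t: "t \<in> {0<..<T}" using y by (simp add: W_def)
  have "((\<lambda>t. \<Phi> (x, t)) has_real_derivative dd (0, 1) \<Phi> (x, t)) (at t)"
    by (rule has_derivative_slice_snd[OF smooth_on_differentiable[OF L.open_W s y]])
  then have 1: "(\<phi> has_vector_derivative dd (0, 1) \<Phi> (x, t)) (at t)"
    unfolding has_real_derivative_iff_has_vector_derivative
    by (rule has_vector_derivative_transform_within_open[of _ _ _ "{0<..<T}"]) (use t eq in auto)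
  have "at t within {0..T} = at t"
    using t by (intro at_within_interior) simp
  then show ?thesis using 1 d vector_derivative_unique_at by metis
qed

lemma time_deriv_u: "(x, t) \<in> W c \<Longrightarrow> time_deriv T u (chart_inv c x) t = u (chart_inv c x) t * dd (0, 1) (lu c) (x, t)"
proof -
  assume y: "(x, t) \<in> W c"
  have t: "t \<in> {0<..<T}" and x: "x \<in> chart_image c" using y by (auto simp: W_def)
  have "((\<lambda>t. exp (lu c (x, t))) has_real_derivative dd (0, 1) (\<lambda>y. exp (lu c y)) (x, t)) (at t)"
    by (rule has_derivative_slice_snd[OF smooth_on_differentiable[OF L.open_W smooth_u y]])
  then have "(u (chart_inv c x) has_vector_derivative dd (0, 1) (\<lambda>y. exp (lu c y)) (x, t)) (at t)"
    unfolding has_real_derivative_iff_has_vector_derivative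
    by (rule has_vector_derivative_transform_within_open[of _ _ _ "{0<..<T}"])
      (use t x u_eq_exp in \<open>auto simp: W_def\<close>)
  moreover have "at t within {0..T} = at t"
    using t by (intro at_within_interior) simp
  ultimately show ?thesis
    unfolding time_deriv_def by (simp add: vector_derivative_at dd_u[OF y] u_eq_exp[OF y])
qed

end

end

text \<open>Maximality is asked along a single line, so that time can stay frozen. A positive second
  derivative would make the first derivative positive just after \<open>z\<close>, and the mean
  value theorem would give a larger value.\<close>

lemma local_max_along_line:
  assumes W: "open W" "z \<in> W" and P: "smooth_on W P"
    and max: "\<And>s. z + s *\<^sub>R v \<in> W \<Longrightarrow> P (z + s *\<^sub>R v) \<le> P z"
  shows "dd v P z = 0" "dd v (dd v P) z \<le> 0"
proof -
  have "open ((\<lambda>s. z + s *\<^sub>R v) -` W)"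
    by (intro open_vimage W continuous_intros)
  then obtain d where d: "d > 0" "ball 0 d \<subseteq> (\<lambda>s. z + s *\<^sub>R v) -` W"
    using W(2) by (metis (mono_tags, lifting) add.right_neutral open_contains_ball scale_zero_left vimage_eq)
  have inW: "z + s *\<^sub>R v \<in> W" if "\<bar>s\<bar> < d" for s
    using d(2) that by (auto simp: subset_eq dist_real_def)
  have D1: "((\<lambda>s. P (z + s *\<^sub>R v)) has_real_derivative dd v P (z + s *\<^sub>R v)) (at s)" if "\<bar>s\<bar> < d" for s
    by (intro DERIV_along_line smooth_on_differentiable[OF W(1) P] inW that)
  show 0: "dd v P z = 0"
    using DERIV_local_max[OF D1[of 0] d(1)] inW max d(1) by simp
  show "dd v (dd v P) z \<le> 0"
  proof (rule ccontr)
    assume "\<not> ?thesis"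
    then have pos: "dd v (dd v P) z > 0" by simp
    have "((\<lambda>s. dd v P (z + s *\<^sub>R v)) has_real_derivative dd v (dd v P) (z + 0 *\<^sub>R v)) (at 0)"
      by (rule DERIV_along_line) (simp add: smooth_on_differentiable[OF W(1) smooth_on_dd[OF W(1) P] W(2)])
    from DERIV_pos_inc_right[OF this] pos obtain e where e: "e > 0"
      "\<And>s. 0 < s \<Longrightarrow> s < e \<Longrightarrow> dd v P (z + s *\<^sub>R v) > 0"
      using 0 by auto
    define s where "s = min d e / 2"
    have s: "0 < s" "s < d" "s < e" using d(1) e(1) by (auto simp: s_def)
    have "\<exists>\<xi>. 0 < \<xi> \<and> \<xi> < s \<and> P (z + s *\<^sub>R v) - P (z + 0 *\<^sub>R v) = (s - 0) * dd v P (z + \<xi> *\<^sub>R v)"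
      by (rule MVT2[OF s(1)]) (use D1 s in auto)
    then obtain \<xi> where \<xi>: "0 < \<xi>" "\<xi> < s" "P (z + s *\<^sub>R v) - P (z + 0 *\<^sub>R v) = (s - 0) * dd v P (z + \<xi> *\<^sub>R v)"
      by blast
    then have "P (z + s *\<^sub>R v) > P z" using e(2)[of \<xi>] s by (simp add: algebra_simps)
    then show False using max[OF inW[of s]] s by simp
  qed
qed

text \<open>At a normal point the sixfold contraction in \<open>cov_deriv_norm\<close> is a plain
  sum of squares.\<close>

lemma sum_delta6:
  fixes Y :: "'n::finite \<Rightarrow> 'n \<Rightarrow> 'n \<Rightarrow> real"
  shows "(\<Sum>k\<in>UNIV. \<Sum>k'\<in>UNIV. \<Sum>i\<in>UNIV. \<Sum>i'\<in>UNIV. \<Sum>j\<in>UNIV. \<Sum>j'\<in>UNIV.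
     (if k = k' then 1 else 0) * (if i = i' then 1 else 0) * (if j = j' then 1 else 0) * Y k i j * Y k' i' j')
    = (\<Sum>k\<in>UNIV. \<Sum>i\<in>UNIV. \<Sum>j\<in>UNIV. (Y k i j)\<^sup>2)"
proof -
  have "(\<Sum>j\<in>UNIV. \<Sum>j'\<in>UNIV. (if k = k' then 1 else 0) * (if i = i' then 1 else 0) * (if j = j' then 1 else 0) * Y k i j * Y k' i' j')
    = (if k = k' then 1 else 0) * ((if i = i' then 1 else 0) * (\<Sum>j\<in>UNIV. Y k i j * Y k' i' j))" for k k' i i'
    by (cases "k = k'"; cases "i = i'") (simp_all add: mult.assoc)
  then show ?thesis
    by (simp add: power2_eq_square flip: sum_distrib_left)
qed

text \<open>\<open>Ck_on\<close> asserts the existence of derivatives; on the open half-line they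
  are the values of \<open>deriv\<close>, in which the bounds \<open>lam\<close>, \<open>Lam\<close>
  and \<open>Sig\<close> are expressed.\<close>

lemma C2_has_derivatives:
  assumes A: "Ck_on 2 {0<..} (A :: real \<Rightarrow> real)" and y: "y > 0"
  shows "(A has_real_derivative deriv A y) (at y)" "(deriv A has_real_derivative deriv (deriv A) y) (at y)"
proof -
  have A2: "Ck_on (Suc (Suc 0)) {0<..} A" using A by (simp only: numeral_2_eq_2)
  have eq: "deriv A x = dd 1 A x" if "x > 0" for x
  proof -
    have "((\<lambda>a. A (0 + a *\<^sub>R 1)) has_real_derivative dd 1 A (0 + x *\<^sub>R 1)) (at x)"
      by (rule DERIV_along_line) (use Ck_on_Suc_differentiable[OF _ A2, of x] that in simp)
    then show ?thesis by (simp add: DERIV_imp_deriv)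
  qed
  have "Ck_on (Suc 0) {0<..} (deriv A)"
    using Ck_on_dd[OF _ A2, of 1] eq by (subst Ck_on_cong) auto
  then have "deriv A differentiable (at y)" "A differentiable (at y)"
    using Ck_on_Suc_differentiable[OF _ A2, of y] Ck_on_Suc_differentiable[of "{0<..}" 0 "deriv A" y] y by auto
  then show "(A has_real_derivative deriv A y) (at y)" "(deriv A has_real_derivative deriv (deriv A) y) (at y)"
    by (metis DERIV_imp_deriv real_differentiableE)+
qed

lemma C2_continuous_derivatives:
  assumes A: "Ck_on 2 {0<..} (A :: real \<Rightarrow> real)"
  shows "continuous_on {0<..} A" "continuous_on {0<..} (deriv A)" "continuous_on {0<..} (deriv (deriv A))"
proof -
  have A2: "Ck_on (Suc (Suc 0)) {0<..} A" using A by (simp only: numeral_2_eq_2)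
  have dd1: "deriv F x = dd 1 F x" if "(F has_real_derivative deriv F x) (at x)" for F and x :: real
    using dd_eqI[OF that[unfolded has_field_derivative_def], of 1] by simp
  have D: "Ck_on (Suc 0) {0<..} (deriv A)"
    using Ck_on_dd[OF _ A2, of 1] dd1[OF C2_has_derivatives(1)[OF A]] by (subst Ck_on_cong) auto
  have "Ck_on 0 {0<..} (deriv (deriv A))"
    using Ck_on_dd[OF _ D, of 1] dd1[OF C2_has_derivatives(2)[OF A]] by (subst Ck_on_cong) auto
  then show "continuous_on {0<..} (deriv (deriv A))" by simp
  show "continuous_on {0<..} A" "continuous_on {0<..} (deriv A)"
    using Ck_on_continuous[OF A2] Ck_on_continuous[OF D] by auto
qed

section \<open>Independence of the chart, and the estimated quantity in terms of ln u\<close>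

context evolving_metric begin

lemma u_smooth_slice:
  "c \<in> \<A> \<Longrightarrow> t \<in> {0..T} \<Longrightarrow> smooth_on (chart_image c) (\<lambda>x. u (chart_inv c x) t)"
  using smooth_on_slice[OF u_smooth] by fastforce

text \<open>The chain rule on the overlap: a differential is a covector, so its components transform
  by the transposed Jacobian.\<close>

lemma pd_transition:
  assumes c: "c \<in> \<A>" "d \<in> \<A>" and p: "p \<in> chart_dom c" "p \<in> chart_dom d"
    and \<phi>: "(\<lambda>x. \<phi> (chart_inv d x)) differentiable (at (chart_map d p))"
  shows "(\<chi> i. pd c i \<phi> p) = transpose (jacobian c d p) *v (\<chi> i. pd d i \<phi> p)"
proof -
  have ch: "is_chart X c" "is_chart X d" using smooth_structureD(1)[OF atlas] c by blast+
  let ?O = "chart_map c ` (chart_dom c \<inter> chart_dom d)"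
  define \<tau> where "\<tau> = chart_map d \<circ> chart_inv c"
  define x where "x = chart_map c p"
  have O: "open ?O" by (rule open_chart_overlap[OF ch])
  have xO: "x \<in> ?O" using p by (simp add: x_def)
  have ix: "chart_inv c x = p" using chart_inv_map[OF ch(1) p(1)] by (simp add: x_def)
  have \<tau>x: "\<tau> x = chart_map d p" by (simp add: \<tau>_def ix)
  have "smooth_on ?O \<tau>" using smooth_structureD(3)[OF atlas c] by (simp add: smooth_transition_def \<tau>_def)
  from smooth_on_frechet(1)[OF O this xO]
  have d\<tau>: "(\<tau> has_derivative frechet_derivative \<tau> (at x)) (at x)" .
  define \<Phi> where "\<Phi> = (\<lambda>x. \<phi> (chart_inv d x))"
  have d\<Phi>: "(\<Phi> has_derivative (\<lambda>v. dd v \<Phi> (chart_map d p))) (at (\<tau> x))"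
    unfolding \<tau>x \<Phi>_def by (rule differentiable_has_dd[OF \<phi>])
  have J: "frechet_derivative \<tau> (at x) v = jacobian c d p *v v" for v
    using frechet_derivative_matrix[of \<tau> x v] d\<tau> differentiable_def by (auto simp: jacobian_def \<tau>_def x_def)
  have "pd c i \<phi> p = (\<Sum>a\<in>UNIV. jacobian c d p $ a $ i * pd d a \<phi> p)" for i
  proof -
    have xI: "x \<in> chart_image c" and dI: "chart_map d p \<in> chart_image d" using p by (simp_all add: x_def)
    have "pd c i \<phi> p = dd (axis i 1) (\<lambda>x. \<phi> (chart_inv c x)) x"
      using pd_eq_dd[OF xI, of i \<phi>] ix by simp
    also have "\<dots> = dd (axis i 1) (\<lambda>x. \<Phi> (\<tau> x)) x"
      by (rule dd_cong[OF O xO]) (use chart_inv_map[OF ch(1)] chart_inv_map[OF ch(2)] in \<open>auto simp: \<Phi>_def \<tau>_def\<close>)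
    also have "\<dots> = dd (jacobian c d p *v axis i 1) \<Phi> (chart_map d p)"
      using dd_eqI[OF has_derivative_compose[OF d\<tau> d\<Phi>]] by (simp add: J)
    also have "jacobian c d p *v axis i 1 = (\<Sum>a\<in>UNIV. jacobian c d p $ a $ i *\<^sub>R axis a 1)"
      by (simp add: vec_eq_iff axis_def matrix_vector_mult_basis[unfolded axis_def] column_def if_distrib cong: if_cong)
    also have "dd \<dots> \<Phi> (chart_map d p) = (\<Sum>a\<in>UNIV. jacobian c d p $ a $ i * dd (axis a 1) \<Phi> (chart_map d p))"
    proof -
      have lin: "linear (\<lambda>v. dd v \<Phi> (chart_map d p))" using d\<Phi> has_derivative_linear by blast
      show ?thesis by (simp add: linear_sum[OF lin] linear_cmul[OF lin])
    qed
    also have "\<dots> = (\<Sum>a\<in>UNIV. jacobian c d p $ a $ i * pd d a \<phi> p)"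
      using pd_eq_dd[OF dI, of _ \<phi>] chart_inv_map[OF ch(2) p(2)] by (simp add: \<Phi>_def)
    finally show ?thesis .
  qed
  then show ?thesis by (simp add: vec_eq_iff matrix_vector_mult_def transpose_def)
qed

text \<open>Needed to glue the chartwise left-hand side to one function on the manifold. The vector
  \<open>w\<close>, the gradient in the coordinates of \<open>c\<close>, is shown to solve
  \<open>Gc *v w = transpose J *v b\<close>; no formula for the inverse of a product is
  involved.\<close>

lemma grad_norm_chart_independent:
  assumes c: "c \<in> \<A>" "d \<in> \<A>" and p: "p \<in> chart_dom c" "p \<in> chart_dom d" and t: "t \<in> {0..T}"
    and \<phi>: "(\<lambda>x. \<phi> (chart_inv d x)) differentiable (at (chart_map d p))"
  shows "grad_norm (g t) c \<phi> p = grad_norm (g t) d \<phi> p"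
proof -
  define J where "J = jacobian c d p"
  define Gc where "Gc = g t c p"
  define Gd where "Gd = g t d p"
  have GJ: "Gc = transpose J ** Gd ** J"
    using g_sym[OF t] c p unfolding symmetric_tensor_field_def J_def Gc_def Gd_def by blast
  have iG: "invertible Gc" "invertible Gd" using g_invertible[OF t] c p unfolding Gc_def Gd_def by blast+
  have iJ: "invertible J" using iG(1) GJ by (simp add: invertible_det_nz det_mul)
  define b where "b = (\<chi> i. pd d i \<phi> p)"
  have a: "(\<chi> i. pd c i \<phi> p) = transpose J *v b"
    unfolding b_def J_def by (rule pd_transition[OF c p \<phi>])
  have nrm: "grad_norm (g t) e \<phi> p = sqrt ((\<chi> i. pd e i \<phi> p) \<bullet> (matrix_inv (g t e p) *v (\<chi> i. pd e i \<phi> p)))" for e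
    unfolding grad_norm_def by (simp add: matrix_vector_inner_sum ginv_def)
  define w where "w = matrix_inv J *v (matrix_inv Gd *v b)"
  have Jw: "J *v w = matrix_inv Gd *v b"
    using matrix_inv_mult(1)[OF iJ] by (simp add: w_def matrix_vector_mul_assoc matrix_mul_assoc)
  have "Gc *v w = transpose J *v (Gd *v (J *v w))"
    by (simp add: GJ matrix_vector_mul_assoc matrix_mul_assoc)
  also have "\<dots> = transpose J *v b"
    unfolding Jw using matrix_inv_mult(1)[OF iG(2)] by (simp add: matrix_vector_mul_assoc)
  finally have "matrix_inv Gc *v (transpose J *v b) = w"
    using matrix_inv_mult(2)[OF iG(1)] by (metis matrix_vector_mul_assoc matrix_vector_mul_lid)
  then have "(transpose J *v b) \<bullet> (matrix_inv Gc *v (transpose J *v b)) = b \<bullet> (J *v w)"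
    by (simp add: dot_lmul_matrix[symmetric])
  then show ?thesis unfolding nrm a b_def[symmetric] Jw by (simp add: Gc_def Gd_def)
qed

end

text \<open>Of \<open>lam\<close>, \<open>Lam\<close> and \<open>Sig\<close> only the pointwise
  bounds are kept; compactness provides them from the infimum and the suprema in the
  theorem.\<close>

locale heat_setting = evolving_metric X \<A> g u T
  for X :: "'a topology" and \<A> :: "('a, 'n::finite) chart set" and g u T +
  fixes h :: "real \<Rightarrow> ('a, 'n) tensor2" and q :: "'a \<Rightarrow> real \<Rightarrow> real" and A :: "real \<Rightarrow> real"
    and K1 K2 K3 K4 \<gamma> \<theta> \<alpha> lam Lam Sig :: real
  assumes T: "T > 0"
    and flow: "\<And>c p t. c \<in> \<A> \<Longrightarrow> p \<in> chart_dom c \<Longrightarrow> t \<in> {0..T} \<Longrightarrow>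
        ((\<lambda>s. g s c p) has_vector_derivative 2 *\<^sub>R h t c p) (at t within {0..T})"
    and nonneg: "K1 \<ge> 0" "K2 \<ge> 0" "K3 \<ge> 0" "K4 \<ge> 0" "\<gamma> \<ge> 0" "\<theta> \<ge> 0" "lam \<ge> 0" "Lam \<ge> 0" "Sig \<ge> 0"
    and Ric: "\<And>c p t. c \<in> \<A> \<Longrightarrow> p \<in> chart_dom c \<Longrightarrow> t \<in> {0..T} \<Longrightarrow>
        tensor_le (- K1 *\<^sub>R g t c p) (ricci (g t) c p)"
    and h_bounds: "\<And>c p t. c \<in> \<A> \<Longrightarrow> p \<in> chart_dom c \<Longrightarrow> t \<in> {0..T} \<Longrightarrow>
        tensor_le (- K2 *\<^sub>R g t c p) (h t c p) \<and> tensor_le (h t c p) (K3 *\<^sub>R g t c p)"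
    and grad_h: "\<And>c p t. c \<in> \<A> \<Longrightarrow> p \<in> chart_dom c \<Longrightarrow> t \<in> {0..T} \<Longrightarrow> cov_deriv_norm (g t) c (h t) p \<le> K4"
    and A2: "Ck_on 2 {0<..} A"
    and q: "C21_spacetime X \<A> T q"
    and grad_q: "\<And>c p t. c \<in> \<A> \<Longrightarrow> p \<in> chart_dom c \<Longrightarrow> t \<in> {0..T} \<Longrightarrow> grad_norm (g t) c (\<lambda>x. q x t) p \<le> \<gamma>"
    and lap_q: "\<And>c p t. c \<in> \<A> \<Longrightarrow> p \<in> chart_dom c \<Longrightarrow> t \<in> {0..T} \<Longrightarrow> laplacian (g t) c (\<lambda>x. q x t) p \<le> \<theta>"
    and eq: "\<And>c p t. c \<in> \<A> \<Longrightarrow> p \<in> chart_dom c \<Longrightarrow> t \<in> {0..T} \<Longrightarrow>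
        laplacian (g t) c (\<lambda>x. u x t) p - q p t * u p t - time_deriv T u p t = A (u p t)"
    and lam: "\<And>p t. p \<in> topspace X \<Longrightarrow> t \<in> {0..T} \<Longrightarrow> - lam \<le> deriv A (u p t) - A (u p t) / u p t"
    and Lam: "\<And>p t. p \<in> topspace X \<Longrightarrow> t \<in> {0..T} \<Longrightarrow> deriv A (u p t) - A (u p t) / u p t \<le> Lam"
    and Sig: "\<And>p t. p \<in> topspace X \<Longrightarrow> t \<in> {0..T} \<Longrightarrow>
        u p t * deriv (deriv A) (u p t) - deriv A (u p t) + A (u p t) / u p t \<le> Sig"
    and \<alpha>: "\<alpha> > 1"
begin

definition li_yau :: "('a, 'n) chart \<Rightarrow> 'a \<Rightarrow> real \<Rightarrow> real" where
  "li_yau c p t = (grad_norm (g t) c (\<lambda>x. u x t) p)\<^sup>2 / (u p t)\<^sup>2 - \<alpha> * time_deriv T u p t / u p t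
        - \<alpha> * q p t - \<alpha> * A (u p t) / u p t"

text \<open>The right-hand side without its term in 1/t, so that the dependence on time is explicit
  when limits are taken.\<close>

definition li_yau_const :: real where
  "li_yau_const = real CARD('n) * \<alpha>\<^sup>2 / (\<alpha> - 1) * (K1 + (\<alpha> - 1) * K3 + K4)
        + real CARD('n) * \<alpha>\<^sup>2 * (max K2 K3 + 3 / 4 * sqrt (2 * K4))
        + \<alpha> powr (3/2) * sqrt (real CARD('n) * \<theta>)
        + (real CARD('n) * \<alpha>\<^sup>2 / 2 * (\<alpha> - 1) powr (1/2) + sqrt (real CARD('n)) * \<alpha> * (\<alpha> - 1) powr (1/4)) * \<gamma> powr (2/3)
        + real CARD('n) * \<alpha>\<^sup>2 / 2 * (lam + Lam) + real CARD('n) * \<alpha> ^ 3 / (2 * (\<alpha> - 1)) * Sig"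

lemma li_yau_chart_independent:
  assumes "c \<in> \<A>" "d \<in> \<A>" "p \<in> chart_dom c" "p \<in> chart_dom d" "t \<in> {0..T}"
  shows "li_yau c p t = li_yau d p t"
proof -
  have "(\<lambda>x. u (chart_inv d x) t) differentiable (at (chart_map d p))"
    by (rule smooth_on_differentiable[OF open_image[OF assms(2)] u_smooth_slice[OF assms(2,5)]]) (use assms in simp)
  from grad_norm_chart_independent[OF assms, of "\<lambda>x. u x t", OF this] show ?thesis by (simp add: li_yau_def)
qed

definition lap_lu where "lap_lu c = local_metric.Lap (gm c) (gi c) (lu c)"
definition gsq_lu where "gsq_lu c = local_metric.gradsq (gi c) (lu c)"

lemma heat_equation_lu:
  assumes c: "c \<in> \<A>" and y: "(x, t) \<in> W c"
  shows "lap_lu c (x, t) + gsq_lu c (x, t) - dd (0, 1) (lu c) (x, t)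
    = q (chart_inv c x) t + A (exp (lu c (x, t))) / exp (lu c (x, t))"
proof -
  have t: "t \<in> {0..T}" and p: "chart_inv c x \<in> chart_dom c" using y by (auto simp: W_def)
  have "u (chart_inv c x) t > 0" by (rule u_pos[OF dom_top[OF c p] t])
  then show ?thesis
    using eq[OF c p t] laplacian_u[OF c y] time_deriv_u[OF c y] u_eq_exp[OF c y]
    unfolding lap_lu_def gsq_lu_def by (simp add: field_simps)
qed

text \<open>The equation divided by \<open>u\<close> replaces f_t + q + A(u)/u by
  \<open>lap_lu\<close> plus \<open>gsq_lu\<close>. The result no longer mentions \<open>q\<close>,
  hence is smooth on \<open>W c\<close>.\<close>

lemma li_yau_eq:
  assumes c: "c \<in> \<A>" and y: "(x, t) \<in> W c"
  shows "li_yau c (chart_inv c x) t = gsq_lu c (x, t) - \<alpha> * (lap_lu c (x, t) + gsq_lu c (x, t))"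
proof -
  have t: "t \<in> {0..T}" and p: "chart_inv c x \<in> chart_dom c" using y by (auto simp: W_def)
  have up: "u (chart_inv c x) t > 0" by (rule u_pos[OF dom_top[OF c p] t])
  have "li_yau c (chart_inv c x) t = gsq_lu c (x, t) - \<alpha> * (dd (0, 1) (lu c) (x, t) + q (chart_inv c x) t
      + A (exp (lu c (x, t))) / exp (lu c (x, t)))"
    using up grad_norm_u[OF c y] time_deriv_u[OF c y] u_eq_exp[OF c y]
    unfolding li_yau_def gsq_lu_def by (simp add: field_simps)
  then show ?thesis using heat_equation_lu[OF assms] by (simp add: algebra_simps)
qed

end

section \<open>The estimate at an interior maximum\<close>

text \<open>Applied on a time slice, where \<open>q\<close> is of class C^2, with F(s) = A(e^s)/e^s
  and \<open>f\<close> the logarithm of the solution.\<close>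

lemma dd_dd_compose_sum:
  assumes V: "open V" "x \<in> V" and q: "Ck_on 2 V q" and f: "smooth_on V f"
    and r: "\<And>y. y \<in> V \<Longrightarrow> r y = q y + F (f y)"
    and F: "\<And>y. y \<in> V \<Longrightarrow> (F has_real_derivative F1 (f y)) (at (f y))"
    and F1: "(F1 has_real_derivative F2) (at (f x))"
  shows "dd v r x = dd v q x + F1 (f x) * dd v f x"
    "dd v (dd v r) x = dd v (dd v q) x + F1 (f x) * dd v (dd v f) x + F2 * (dd v f x)\<^sup>2"
proof -
  have q2: "Ck_on (Suc (Suc 0)) V q" using q by (simp only: numeral_2_eq_2)
  have dq: "q differentiable (at y)" if "y \<in> V" for y by (rule Ck_on_Suc_differentiable[OF V(1) q2 that])
  have ddq: "dd v q differentiable (at x)"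
    by (rule Ck_on_Suc_differentiable[OF V(1) Ck_on_dd[OF V(1) q2] V(2)])
  note df = smooth_on_differentiable[OF V(1) f]
  have dF: "(\<lambda>y. F (f y)) differentiable (at y)" if "y \<in> V" for y
    using has_derivative_compose[OF differentiable_has_dd[OF df[OF that]] F[OF that, unfolded has_field_derivative_def]]
      differentiable_def by blast
  have dF1: "(\<lambda>y. F1 (f y)) differentiable (at x)"
    using has_derivative_compose[OF differentiable_has_dd[OF df[OF V(2)]] F1[unfolded has_field_derivative_def]]
      differentiable_def by blast
  have 1: "dd v r y = dd v q y + F1 (f y) * dd v f y" if y: "y \<in> V" for y
  proof -
    have "dd v r y = dd v (\<lambda>y. q y + F (f y)) y" by (rule dd_cong[OF V(1) y r])
    also have "\<dots> = dd v q y + dd v (\<lambda>y. F (f y)) y" by (rule dd_add[OF dq[OF y] dF[OF y]])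
    also have "dd v (\<lambda>y. F (f y)) y = F1 (f y) * dd v f y" by (rule dd_compose[OF df[OF y] F[OF y]])
    finally show ?thesis .
  qed
  show "dd v r x = dd v q x + F1 (f x) * dd v f x" by (rule 1[OF V(2)])
  have "dd v (dd v r) x = dd v (\<lambda>y. dd v q y + F1 (f y) * dd v f y) x" by (rule dd_cong[OF V 1])
  also have "\<dots> = dd v (dd v q) x + dd v (\<lambda>y. F1 (f y) * dd v f y) x"
    by (rule dd_add[OF ddq]) (intro differentiable_mult dF1 smooth_on_differentiable[OF V(1) smooth_on_dd[OF V(1) f] V(2)])
  also have "dd v (\<lambda>y. F1 (f y) * dd v f y) x = dd v (\<lambda>y. F1 (f y)) x * dd v f x + F1 (f x) * dd v (dd v f) x"
    by (rule dd_mult[OF dF1 smooth_on_differentiable[OF V(1) smooth_on_dd[OF V(1) f] V(2)]])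
  also have "dd v (\<lambda>y. F1 (f y)) x = F2 * dd v f x" by (rule dd_compose[OF df[OF V(2)] F1])
  finally show "dd v (dd v r) x = dd v (dd v q) x + F1 (f x) * dd v (dd v f) x + F2 * (dd v f x)\<^sup>2"
    by (simp add: power2_eq_square)
qed

context heat_setting begin

text \<open>The left-hand side as a function on the manifold; by
  \<open>li_yau_chart_independent\<close> the chosen chart is immaterial.\<close>

definition Q :: "'a \<Rightarrow> real \<Rightarrow> real" where
  "Q p t = li_yau (SOME c. c \<in> \<A> \<and> p \<in> chart_dom c) p t"

lemma li_yau_eq_Q:
  assumes "c \<in> \<A>" "p \<in> chart_dom c" "t \<in> {0..T}"
  shows "li_yau c p t = Q p t"
proof -
  have "(SOME c. c \<in> \<A> \<and> p \<in> chart_dom c) \<in> \<A> \<and> p \<in> chart_dom (SOME c. c \<in> \<A> \<and> p \<in> chart_dom c)"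
    by (rule someI) (use assms in blast)
  then show ?thesis unfolding Q_def using li_yau_chart_independent assms by blast
qed

text \<open>In time, maximality is asked only backwards from \<open>t0\<close>, as a maximum over a
  closed interval provides it even at its right end. Every hypothesis is evaluated in a chart normal
  for \<open>g t0\<close> at \<open>p0\<close> and handed to
  \<open>estimate_at_maximum\<close>.\<close>

lemma Q_at_maximum:
  assumes p0: "p0 \<in> topspace X" and t0: "t0 \<in> {0<..<T}" and \<epsilon>: "0 < \<epsilon>" "\<epsilon> < t0"
    and space: "\<And>p. p \<in> topspace X \<Longrightarrow> Q p t0 \<le> Q p0 t0"
    and time: "\<And>s. s \<in> {\<epsilon>..t0} \<Longrightarrow> (s - \<epsilon>) * Q p0 s \<le> (t0 - \<epsilon>) * Q p0 t0"
    and pos: "Q p0 t0 > 0"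
  shows "Q p0 t0 \<le> real CARD('n) * \<alpha>\<^sup>2 / (2 * (t0 - \<epsilon>)) + li_yau_const"
proof -
  have t0': "t0 \<in> {0..T}" using t0 by auto
  obtain c0 where c0: "c0 \<in> \<A>" "p0 \<in> chart_dom c0"
    using p0 smooth_structureD(2)[OF atlas] by blast
  have pos': "\<And>c p v. c \<in> \<A> \<Longrightarrow> p \<in> chart_dom c \<Longrightarrow> v \<noteq> 0 \<Longrightarrow> v \<bullet> (g t0 c p *v v) > 0"
    by (rule g_pos[OF t0'])
  have smooth': "\<And>c. c \<in> \<A> \<Longrightarrow> smooth_on (chart_image c) (\<lambda>x. g t0 c (chart_inv c x))"
    by (rule g_smooth_slice[OF _ t0'])
  obtain c where c: "c \<in> \<A>" "p0 \<in> chart_dom c" "chart_map c p0 = 0" and gI: "g t0 c p0 = mat 1"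
    and dg: "\<And>i j k. dd (axis k 1) (\<lambda>x. g t0 c (chart_inv c x) $ i $ j) 0 = 0"
    by (rule normal_chart_exists[OF atlas c0 g_sym[OF t0'] pos' smooth']) blast+
  have V: "open (chart_image c)" by (rule open_image[OF c(1)])
  have z0: "0 \<in> chart_image c" "chart_inv c 0 = p0"
    using imageI[OF c(2), of "chart_map c"] c(3)
      chart_inv_map[OF smooth_structureD(1)[OF atlas c(1)] c(2)] by simp_all
  define z where "z = (0 :: real^'n, t0)"
  have zW: "z \<in> W c" using z0 t0 by (simp add: z_def W_def)
  interpret L: local_metric "W c" "gm c" "gi c" "lu c" by (rule local_metric_chart[OF c(1)])
  have inW: "(x, t0) \<in> W c" if "x \<in> chart_image c" for x using that t0 by (simp add: W_def)
  interpret N: normal_point "W c" "gm c" "gi c" "lu c" z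
  proof
    show "z \<in> W c" by (rule zW)
    show "gm c i j z = (if i = j then 1 else 0)" for i j
      by (simp add: gm_def z_def z0 gI mat_def)
    show "dd (axis k 1, 0) (gm c i j) z = 0" for k i j
    proof -
      have "dd (axis k 1) (\<lambda>x. gm c i j (x, t0)) 0 = dd (axis k 1, 0) (gm c i j) z"
        unfolding z_def by (rule dd_slice_fst[OF smooth_on_differentiable[OF L.open_W L.s_gm zW[unfolded z_def]]])
      then show ?thesis using dg[of k i j] by (simp add: gm_def)
    qed
  qed
  have gsq: "L.gradsq = gsq_lu c" and lap: "L.Lap = lap_lu c" by (simp_all add: gsq_lu_def lap_lu_def)
  define P where "P = (\<lambda>y. L.gradsq y - \<alpha> * (L.Lap y + L.gradsq y))"
  have sP: "smooth_on (W c) P" unfolding P_def by (intro smooth_intros L.s_gradsq L.s_Lap)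
  have PQ: "P (x, t) = Q (chart_inv c x) t" if "(x, t) \<in> W c" for x t
    using li_yau_eq[OF c(1) that] li_yau_eq_Q[OF c(1), of "chart_inv c x" t] that
    by (auto simp: P_def gsq lap W_def)
  have Pz: "P z = Q p0 t0" using PQ zW z0 by (simp add: z_def)
  have line: "P (z + s *\<^sub>R (axis k 1, 0)) \<le> P z" if "z + s *\<^sub>R (axis k 1, 0) \<in> W c" for s and k :: 'n
  proof -
    have e: "z + s *\<^sub>R (axis k 1, 0) = (s *\<^sub>R axis k 1, t0)" by (simp add: z_def)
    have "chart_inv c (s *\<^sub>R axis k 1) \<in> topspace X"
      using that unfolding e W_def by (intro dom_top[OF c(1)] chart_inv_in) simp
    then show ?thesis using space PQ[of "s *\<^sub>R axis k 1" t0] that Pz unfolding e by simp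
  qed
  have crit1: "dd (axis k 1, 0) P z = 0" for k
    by (rule local_max_along_line(1)[OF L.open_W zW sP line])
  have crit2: "(\<Sum>k\<in>UNIV. dd (axis k 1, 0) (dd (axis k 1, 0) P) z) \<le> 0"
    by (intro sum_nonpos local_max_along_line(2)[OF L.open_W zW sP line])
  \<comment> \<open>If this failed, the derivative of \<open>(t - \<epsilon>) * P\<close> would be
    negative and the function larger slightly before \<open>t0\<close>.\<close>
  have crit3: "dd (0, 1) P z \<ge> - P z / (t0 - \<epsilon>)"
  proof (rule ccontr)
    assume "\<not> ?thesis"
    then have "dd (0, 1) P z < - P z / (t0 - \<epsilon>)" by simp
    then have neg: "P z + (t0 - \<epsilon>) * dd (0, 1) P z < 0"
      using \<epsilon> pos_less_divide_eq[of "t0 - \<epsilon>" "dd (0, 1) P z" "- P z"] by (simp add: mult.commute)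
    have "((\<lambda>t. P (0, t)) has_real_derivative dd (0, 1) P z) (at t0)"
      unfolding z_def by (rule has_derivative_slice_snd[OF smooth_on_differentiable[OF L.open_W sP zW[unfolded z_def]]])
    then have "((\<lambda>t. (t - \<epsilon>) * P (0, t)) has_real_derivative P z + (t0 - \<epsilon>) * dd (0, 1) P z) (at t0)"
      by (auto intro!: derivative_eq_intros simp: z_def)
    from DERIV_neg_dec_left[OF this neg] obtain d where d: "d > 0"
      "\<And>h. 0 < h \<Longrightarrow> h < d \<Longrightarrow> (t0 - \<epsilon>) * P (0, t0) < (t0 - h - \<epsilon>) * P (0, t0 - h)" by auto
    define h where "h = min d (t0 - \<epsilon>) / 2"
    have h: "0 < h" "h < d" "h < t0 - \<epsilon>" using d(1) \<epsilon> by (auto simp: h_def)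
    have "(0, t0 - h) \<in> W c" using h t0 \<epsilon> z0 by (auto simp: W_def)
    then have "(t0 - \<epsilon>) * Q p0 t0 < (t0 - h - \<epsilon>) * Q p0 (t0 - h)"
      using d(2)[OF h(1,2)] PQ[of 0 "t0 - h"] Pz z0 by (simp add: z_def)
    then show False using time[of "t0 - h"] h by simp
  qed
  have gin: "ginv (g t0) c i j p0 = (if i = j then 1 else 0)" for i j
    using N.gi_z[of i j] by (simp add: gi_def z_def z0)
  have chr: "christoffel (g t0) c k i j p0 = 0" for k i j
    using christoffel_eq[OF c(1) zW[unfolded z_def], of k i j] N.Chr_z[of k i j] z0 by (simp add: z_def)
  have Ric': "(\<Sum>j\<in>UNIV. \<Sum>k\<in>UNIV. N.Rc j k * v j * v k) \<ge> - K1 * (\<Sum>i\<in>UNIV. (v i)\<^sup>2)" for v :: "'n \<Rightarrow> real"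
  proof -
    define w :: "real^'n" where "w = (\<chi> i. v i)"
    have "ricci (g t0) c p0 $ j $ k = N.Rc j k" for j k
      unfolding N.Rc_def ricci_def using riemann_eq[OF c(1) zW[unfolded z_def]] z0 N.Chr_z
      by (simp add: z_def)
    moreover have "w \<bullet> ((- K1 *\<^sub>R g t0 c p0) *v w) \<le> w \<bullet> (ricci (g t0) c p0 *v w)"
      using Ric[OF c(1,2) t0'] by (simp add: tensor_le_def)
    moreover have "w \<bullet> ((k *\<^sub>R g t0 c p0) *v w) = k * (\<Sum>i\<in>UNIV. (v i)\<^sup>2)" for k
      by (simp add: gI scaleR_matrix_vector_assoc[symmetric] w_def inner_vec_def power2_eq_square sum_distrib_left mult_ac)
    moreover note this[of "- K1"]
    ultimately show ?thesis by (simp add: matrix_vector_inner_sum w_def)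
  qed
  have hflow: "((\<lambda>s. gm c i j (x, s)) has_vector_derivative 2 * h t c (chart_inv c x) $ i $ j) (at t within {0..T})"
    if "x \<in> chart_image c" "t \<in> {0..T}" for i j x t
  proof -
    have "bounded_linear (\<lambda>M :: real^'n^'n. M $ i $ j)"
      by (intro bounded_linear_compose[OF bounded_linear_vec_nth] bounded_linear_vec_nth)
    from bounded_linear.has_vector_derivative[OF this flow[OF c(1) chart_inv_in[OF that(1)] that(2)]]
    show ?thesis by (simp add: gm_def)
  qed
  \<comment> \<open>Proved on all of \<open>W c\<close>, since it is differentiated in space to
    obtain the covariant derivative of \<open>h\<close>.\<close>
  have Dtg: "dd (0, 1) (gm c i j) (x, t) / 2 = h t c (chart_inv c x) $ i $ j" if "(x, t) \<in> W c" for i j x t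
    using time_deriv_eq[OF c(1) that L.s_gm, of "\<lambda>s. gm c i j (x, s)"] hflow[of x t i j] that
    by (auto simp: W_def)
  have hz: "dd (0, 1) (gm c i j) z / 2 = h t0 c p0 $ i $ j" for i j
    using Dtg[OF zW[unfolded z_def]] z0 by (simp add: z_def)
  have h1: "(\<Sum>i\<in>UNIV. \<Sum>j\<in>UNIV. N.hh i j * v i * v j) \<ge> - K2 * (\<Sum>i\<in>UNIV. (v i)\<^sup>2)"
    and h2: "(\<Sum>i\<in>UNIV. \<Sum>j\<in>UNIV. N.hh i j * v i * v j) \<le> K3 * (\<Sum>i\<in>UNIV. (v i)\<^sup>2)" for v :: "'n \<Rightarrow> real"
  proof -
    define w :: "real^'n" where "w = (\<chi> i. v i)"
    have "w \<bullet> ((- K2 *\<^sub>R g t0 c p0) *v w) \<le> w \<bullet> (h t0 c p0 *v w)"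
      "w \<bullet> (h t0 c p0 *v w) \<le> w \<bullet> ((K3 *\<^sub>R g t0 c p0) *v w)"
      using h_bounds[OF c(1,2) t0'] by (auto simp: tensor_le_def)
    moreover have "w \<bullet> ((k *\<^sub>R g t0 c p0) *v w) = k * (\<Sum>i\<in>UNIV. (v i)\<^sup>2)" for k
      by (simp add: gI scaleR_matrix_vector_assoc[symmetric] w_def inner_vec_def power2_eq_square sum_distrib_left mult_ac)
    moreover have "w \<bullet> (h t0 c p0 *v w) = (\<Sum>i\<in>UNIV. \<Sum>j\<in>UNIV. N.hh i j * v i * v j)"
      unfolding matrix_vector_inner_sum hz by (simp add: w_def)
    ultimately show "(\<Sum>i\<in>UNIV. \<Sum>j\<in>UNIV. N.hh i j * v i * v j) \<ge> - K2 * (\<Sum>i\<in>UNIV. (v i)\<^sup>2)"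
      "(\<Sum>i\<in>UNIV. \<Sum>j\<in>UNIV. N.hh i j * v i * v j) \<le> K3 * (\<Sum>i\<in>UNIV. (v i)\<^sup>2)" by metis+
  qed
  have dh: "(\<Sum>k\<in>UNIV. \<Sum>i\<in>UNIV. \<Sum>j\<in>UNIV. (N.dh k i j)\<^sup>2) \<le> K4\<^sup>2"
  proof -
    have "pd c k (\<lambda>x. h t0 c x $ i $ j) p0 = N.dh k i j" for k i j
    proof -
      have "pd c k (\<lambda>x. h t0 c x $ i $ j) (chart_inv c 0) = dd (axis k 1, 0) (\<lambda>y. dd (0, 1) (gm c i j) y / 2) (0, t0)"
        by (rule pd_eq_spacetime[OF c(1) zW[unfolded z_def]])
          (auto intro!: smooth_intros L.s_dd L.s_gm simp: Dtg inW)
      also have "\<dots> = N.dh k i j"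
        unfolding z_def[symmetric] by (intro dd_divide_const N.diff L.s_dd L.s_gm)
      finally show ?thesis using z0 by simp
    qed
    then have cov: "cov_deriv (g t0) c (h t0) k i j p0 = N.dh k i j" for k i j
      by (simp add: cov_deriv_def chr)
    have "cov_deriv_norm (g t0) c (h t0) p0 = sqrt (\<Sum>k\<in>UNIV. \<Sum>i\<in>UNIV. \<Sum>j\<in>UNIV. (N.dh k i j)\<^sup>2)"
      unfolding cov_deriv_norm_def gin cov sum_delta6 ..
    then have "sqrt (\<Sum>k\<in>UNIV. \<Sum>i\<in>UNIV. \<Sum>j\<in>UNIV. (N.dh k i j)\<^sup>2) \<le> K4"
      using grad_h[OF c(1,2) t0'] by simp
    then show ?thesis by (rule sqrt_le_D)
  qed
  define qh where "qh x = q (chart_inv c x) t0" for x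
  define f where "f x = lu c (x, t0)" for x
  \<comment> \<open>Smooth on space-time by this definition, while by the equation it is q + A(u)/u
    on the slice at \<open>t0\<close>; the bounds on \<open>q\<close> enter through the second
    form.\<close>
  define r where "r = (\<lambda>y. (L.Lap y + L.gradsq y) - dd (0, 1) (lu c) y)"
  have sr: "smooth_on (W c) r" unfolding r_def by (intro smooth_intros L.s_gradsq L.s_Lap L.s_dd L.s_f)
  have slice: "dd (axis k 1) (\<lambda>x. \<Phi> (x, t0)) x = dd (axis k 1, 0) \<Phi> (x, t0)"
    if "smooth_on (W c) \<Phi>" "x \<in> chart_image c" for \<Phi> k x
    by (rule dd_slice_fst[OF smooth_on_differentiable[OF L.open_W that(1) inW[OF that(2)]]])
  have slice2: "dd (axis k 1) (dd (axis k 1) (\<lambda>x. \<Phi> (x, t0))) 0 = dd (axis k 1, 0) (dd (axis k 1, 0) \<Phi>) z"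
    if s: "smooth_on (W c) \<Phi>" for \<Phi> k
  proof -
    have "dd (axis k 1) (dd (axis k 1) (\<lambda>x. \<Phi> (x, t0))) 0 = dd (axis k 1) (\<lambda>x. dd (axis k 1, 0) \<Phi> (x, t0)) 0"
      by (rule dd_cong[OF V z0(1) slice[OF s]])
    also have "\<dots> = dd (axis k 1, 0) (dd (axis k 1, 0) \<Phi>) (0, t0)"
      by (rule slice[OF L.s_dd[OF s] z0(1)])
    finally show ?thesis by (simp add: z_def)
  qed
  have q2: "Ck_on 2 (chart_image c) qh"
    using q t0' c(1) unfolding C21_spacetime_def qh_def[abs_def] by blast
  have sf: "smooth_on (chart_image c) f"
    unfolding f_def lu_def using dom_top[OF c(1)] u_pos t0'
    by (auto intro!: smooth_intros u_smooth_slice[OF c(1)])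
  define U where "U = u p0 t0"
  have U: "U > 0" unfolding U_def by (rule u_pos[OF p0 t0'])
  have expf: "exp (f 0) = U" using u_eq_exp[OF c(1) zW[unfolded z_def]] z0 by (simp add: f_def U_def)
  \<comment> \<open>With F(s) = A(e^s)/e^s and u = e^s one has F' = A'(u) - A(u)/u and F'' = u
    A''(u) - A'(u) + A(u)/u, exactly the expressions bounded by \<open>lam\<close>,
    \<open>Lam\<close> and \<open>Sig\<close>.\<close>
  define F1 where "F1 s = deriv A (exp s) - A (exp s) / exp s" for s
  define F2 where "F2 = U * deriv (deriv A) U - deriv A U + A U / U"
  have dF: "((\<lambda>s. A (exp s) / exp s) has_real_derivative F1 s) (at s)" for s
  proof -
    have "((\<lambda>s. A (exp s)) has_real_derivative deriv A (exp s) * exp s) (at s)"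
      by (rule DERIV_chain2[OF C2_has_derivatives(1)[OF A2] DERIV_exp]) simp
    note DERIV_divide[OF this DERIV_exp exp_not_eq_zero]
    moreover have "(deriv A (exp s) * exp s * exp s - A (exp s) * exp s) / (exp s * exp s) = F1 s"
      by (simp add: F1_def diff_divide_distrib)
    ultimately show ?thesis by simp
  qed
  have dF1: "(F1 has_real_derivative F2) (at (f 0))"
  proof -
    have "((\<lambda>s. deriv A (exp s)) has_real_derivative deriv (deriv A) (exp (f 0)) * exp (f 0)) (at (f 0))"
      by (rule DERIV_chain2[OF C2_has_derivatives(2)[OF A2] DERIV_exp]) simp
    note DERIV_diff[OF this dF]
    moreover have "deriv (deriv A) (exp (f 0)) * exp (f 0) - F1 (f 0) = F2"
      by (simp add: F1_def F2_def expf)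
    ultimately show ?thesis unfolding F1_def[abs_def] by simp
  qed
  have rq: "r (x, t0) = qh x + A (exp (f x)) / exp (f x)" if "x \<in> chart_image c" for x
    using heat_equation_lu[OF c(1) inW[OF that]] by (simp add: r_def gsq lap qh_def f_def)
  note R = dd_dd_compose_sum[OF V z0(1) q2 sf rq dF dF1]
  have dr: "dd (axis k 1, 0) r z = dd (axis k 1) qh 0 + F1 (f 0) * dd (axis k 1, 0) (lu c) z" for k
    using R(1)[of "axis k 1"] slice[OF sr z0(1)] slice[OF L.s_f z0(1)] by (simp add: z_def f_def)
  have ddr: "(\<Sum>k\<in>UNIV. dd (axis k 1, 0) (dd (axis k 1, 0) r) z) = (\<Sum>k\<in>UNIV. dd (axis k 1) (dd (axis k 1) qh) 0)
      + F1 (f 0) * (\<Sum>k\<in>UNIV. dd (axis k 1, 0) (dd (axis k 1, 0) (lu c)) z)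
      + F2 * (\<Sum>k\<in>UNIV. (dd (axis k 1, 0) (lu c) z)\<^sup>2)"
  proof -
    have "dd (axis k 1, 0) (dd (axis k 1, 0) r) z = dd (axis k 1) (dd (axis k 1) qh) 0
        + F1 (f 0) * dd (axis k 1, 0) (dd (axis k 1, 0) (lu c)) z + F2 * (dd (axis k 1, 0) (lu c) z)\<^sup>2" for k
      using R(2)[of "axis k 1"] slice2[OF sr] slice2[OF L.s_f] slice[OF L.s_f z0(1)]
      by (simp add: z_def f_def[abs_def])
    then show ?thesis by (simp add: sum.distrib sum_distrib_left)
  qed
  have pdq: "pd c k (\<lambda>x. q x t0) (chart_inv c x) = dd (axis k 1) qh x" if "x \<in> chart_image c" for k x
    using pd_eq_dd[OF that] by (simp add: qh_def[abs_def])
  have dq: "(\<Sum>k\<in>UNIV. (dd (axis k 1) qh 0)\<^sup>2) \<le> \<gamma>\<^sup>2"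
  proof -
    have "grad_norm (g t0) c (\<lambda>x. q x t0) p0 = sqrt (\<Sum>k\<in>UNIV. (dd (axis k 1) qh 0)\<^sup>2)"
      using pdq[OF z0(1)] z0 by (simp add: grad_norm_def gin mult.assoc power2_eq_square)
    then show ?thesis using grad_q[OF c(1,2) t0'] by (metis sqrt_le_D)
  qed
  have lq: "(\<Sum>k\<in>UNIV. dd (axis k 1) (dd (axis k 1) qh) 0) \<le> \<theta>"
  proof -
    have "pd c i (pd c j (\<lambda>x. q x t0)) p0 = dd (axis i 1) (dd (axis j 1) qh) 0" for i j
    proof -
      have "pd c i (pd c j (\<lambda>x. q x t0)) (chart_inv c 0) = dd (axis i 1) (\<lambda>x. pd c j (\<lambda>x. q x t0) (chart_inv c x)) 0"
        by (rule pd_eq_dd[OF z0(1)])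
      also have "\<dots> = dd (axis i 1) (dd (axis j 1) qh) 0"
        by (rule dd_cong[OF V z0(1) pdq])
      finally show ?thesis using z0 by simp
    qed
    then have "laplacian (g t0) c (\<lambda>x. q x t0) p0 = (\<Sum>k\<in>UNIV. dd (axis k 1) (dd (axis k 1) qh) 0)"
      by (simp add: laplacian_def hessian_def gin chr)
    then show ?thesis using lap_q[OF c(1,2) t0'] by simp
  qed
  have F1b: "- lam \<le> F1 (f 0)" "F1 (f 0) \<le> Lam" and F2b: "F2 \<le> Sig"
    using lam[OF p0 t0'] Lam[OF p0 t0'] Sig[OF p0 t0'] by (auto simp: F1_def F2_def expf U_def)
  have \<tau>: "t0 - \<epsilon> > 0" using \<epsilon> by simp
  have "P z \<le> real CARD('n) * \<alpha>\<^sup>2 / (2 * (t0 - \<epsilon>)) + li_yau_const"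
    unfolding li_yau_const_def P_def
    by (rule N.estimate_at_maximum[OF \<alpha> \<tau> nonneg(2,1,3-9) crit1[unfolded P_def] crit2[unfolded P_def] crit3[unfolded P_def]
      _ Ric' h1 h2 dh dr[unfolded r_def] ddr[unfolded r_def] dq lq F1b F2b])
      (use pos Pz in \<open>simp add: P_def\<close>)
  then show ?thesis by (simp add: Pz)
qed

end

section \<open>Compactness and the conclusion\<close>

context evolving_metric begin

text \<open>Continuity is given in charts only. Pasting over the open sets
  \<open>chart_dom c \<times> J\<close> yields continuity for the product topology, in which the
  whole space is compact.\<close>

lemma compact_image_spacetime:
  fixes F :: "'a \<Rightarrow> real \<Rightarrow> real" and J :: "real set"
  assumes J: "compact J"
    and F: "\<And>c. c \<in> \<A> \<Longrightarrow> continuous_on (chart_image c \<times> J) (\<lambda>y. F (chart_inv c (fst y)) (snd y))"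
  shows "compact ((\<lambda>(p, t). F p t) ` (topspace X \<times> J))"
proof -
  let ?Y = "prod_topology X (top_of_set J)"
  have "continuous_map ?Y euclideanreal (\<lambda>(p, t). F p t)"
  proof (rule pasting_lemma[where I = \<A> and T = "\<lambda>c. chart_dom c \<times> J" and f = "\<lambda>_. (\<lambda>(p, t). F p t)"])
    fix c assume c: "c \<in> \<A>"
    have ch: "is_chart X c" using smooth_structureD(1)[OF atlas c] .
    show "openin ?Y (chart_dom c \<times> J)"
      using is_chartD(1)[OF ch] by (simp add: openin_prod_Times_iff)
    let ?Z = "prod_topology (subtopology X (chart_dom c)) (top_of_set J)"
    have Z: "subtopology ?Y (chart_dom c \<times> J) = ?Z"
      by (simp add: subtopology_Times subtopology_subtopology)
    have top: "topspace ?Z = chart_dom c \<times> J"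
      using openin_subset[OF is_chartD(1)[OF ch]] by auto
    have "continuous_map (subtopology X (chart_dom c)) (top_of_set (chart_image c)) (chart_map c)"
      using ch homeomorphic_imp_continuous_map unfolding is_chart_def by blast
    from continuous_map_pairedI[OF continuous_map_compose[OF continuous_map_fst this] continuous_map_snd[of _ "top_of_set J"]]
    have 1: "continuous_map ?Z (top_of_set (chart_image c \<times> J)) (\<lambda>y. (chart_map c (fst y), snd y))"
      by (simp add: o_def)
    have 2: "continuous_map (top_of_set (chart_image c \<times> J)) euclideanreal (\<lambda>y. F (chart_inv c (fst y)) (snd y))"
      using F[OF c] by simp
    have "continuous_map ?Z euclideanreal (\<lambda>y. F (chart_inv c (chart_map c (fst y))) (snd y))"
      using continuous_map_compose[OF 1 2] by (simp add: o_def)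
    then have "continuous_map ?Z euclideanreal (\<lambda>(p, t). F p t)"
    proof (rule continuous_map_eq)
      fix y assume "y \<in> topspace ?Z"
      then show "F (chart_inv c (chart_map c (fst y))) (snd y) = (case y of (p, t) \<Rightarrow> F p t)"
        using top chart_inv_map[OF ch] by auto
    qed
    then show "continuous_map (subtopology ?Y (chart_dom c \<times> J)) euclideanreal (\<lambda>(p, t). F p t)"
      unfolding Z .
  next
    show "\<exists>j. j \<in> \<A> \<and> x \<in> chart_dom j \<times> J \<and> (case x of (p, t) \<Rightarrow> F p t) = (case x of (p, t) \<Rightarrow> F p t)"
      if "x \<in> topspace ?Y" for x
    proof -
      have "fst x \<in> topspace X" "snd x \<in> J" using that by auto
      then obtain c where "c \<in> \<A>" "fst x \<in> chart_dom c" using smooth_structureD(2)[OF atlas] by blast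
      then show ?thesis using \<open>snd x \<in> J\<close> by (intro exI[of _ c]) (simp add: mem_Times_iff)
    qed
  qed auto
  moreover have "compactin ?Y (topspace X \<times> J)"
    using M J by (simp add: compactin_Times closed_manifold_def compact_space_def)
  ultimately show ?thesis using image_compactin compactin_euclidean_iff by blast
qed

lemma continuous_on_u: "c \<in> \<A> \<Longrightarrow> continuous_on (chart_image c \<times> {0..T}) (\<lambda>y. u (chart_inv c (fst y)) (snd y))"
  by (rule smooth_on_continuous[OF u_smooth])

text \<open>Makes the infimum and the suprema of the theorem range over bounded sets, so that they
  are genuine bounds.\<close>

lemma bounded_function_of_u:
  assumes "continuous_on {0<..} \<phi>"
  shows "compact ((\<lambda>(p, t). \<phi> (u p t) :: real) ` (topspace X \<times> {0..T}))"
proof (rule compact_image_spacetime)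
  fix c assume c: "c \<in> \<A>"
  show "continuous_on (chart_image c \<times> {0..T}) (\<lambda>y. \<phi> (u (chart_inv c (fst y)) (snd y)))"
    by (rule continuous_on_compose2[OF assms continuous_on_u[OF c]])
      (use u_pos dom_top[OF c] in auto)
qed simp

text \<open>Serves the passage to t = T. The derivative within the closed slab that
  \<open>Ck_on\<close> supplies is continuous up to the end times, and its values in space and time
  directions are the two kinds of partial derivative.\<close>

lemma continuous_on_pd_u:
  assumes c: "c \<in> \<A>" and p: "p \<in> chart_dom c" and T: "T > 0"
  shows "continuous_on {0..T} (\<lambda>t. pd c i (\<lambda>x. u x t) p)" "continuous_on {0..T} (\<lambda>t. time_deriv T u p t)"
proof -
  let ?S = "chart_image c \<times> {0..T}"
  define \<Phi> where "\<Phi> y = u (chart_inv c (fst y)) (snd y)" for y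
  have "Ck_on (Suc 0) ?S \<Phi>" using u_smooth[OF c] unfolding smooth_on_def \<Phi>_def by blast
  then obtain D where D: "\<And>y. y \<in> ?S \<Longrightarrow> (\<Phi> has_derivative D y) (at y within ?S)"
    "\<And>v. Ck_on 0 ?S (\<lambda>y. D y v)" using Ck_on_SucE by blast
  define x where "x = chart_map c p"
  have x: "x \<in> chart_image c" "chart_inv c x = p"
    using p chart_inv_map[OF smooth_structureD(1)[OF atlas c] p] by (auto simp: x_def)
  have cont: "continuous_on {0..T} (\<lambda>t. D (x, t) v)" for v
    by (rule continuous_on_compose2[of ?S "\<lambda>y. D y v"]) (use D(2)[of v] x in \<open>auto intro!: continuous_intros\<close>)
  have pd: "pd c i (\<lambda>x. u x t) p = D (x, t) (axis i 1, 0)" if t: "t \<in> {0..T}" for t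
  proof -
    have sub: "(\<lambda>y. (y, t)) ` chart_image c \<subseteq> ?S" using t by auto
    have "((\<lambda>y. (y, t)) has_derivative (\<lambda>v. (v, 0))) (at x within chart_image c)"
      by (auto intro!: derivative_eq_intros)
    from has_derivative_in_compose2[OF D(1) sub x(1) this]
    have "((\<lambda>y. \<Phi> (y, t)) has_derivative (\<lambda>v. D (x, t) (v, 0))) (at x within chart_image c)" .
    then have "((\<lambda>y. \<Phi> (y, t)) has_derivative (\<lambda>v. D (x, t) (v, 0))) (at x)"
      using at_within_open[OF x(1) open_image[OF c]] by simp
    from dd_eqI[OF this] show ?thesis
      using pd_eq_dd[OF x(1), of i "\<lambda>x. u x t"] x(2) by (simp add: \<Phi>_def)
  qed
  show "continuous_on {0..T} (\<lambda>t. pd c i (\<lambda>x. u x t) p)"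
    using cont[of "(axis i 1, 0)"] pd by (subst continuous_on_cong[OF refl pd]) auto
  have td: "time_deriv T u p t = D (x, t) (0, 1)" if t: "t \<in> {0..T}" for t
  proof -
    have sub: "(\<lambda>s. (x, s)) ` {0..T} \<subseteq> ?S" using x by auto
    have "((\<lambda>s. (x, s)) has_derivative (\<lambda>v. (0, v))) (at t within {0..T})"
      by (auto intro!: derivative_eq_intros)
    from has_derivative_in_compose2[OF D(1) sub t this]
    have d: "((\<lambda>s. \<Phi> (x, s)) has_derivative (\<lambda>v. D (x, t) (0, v))) (at t within {0..T})" .
    have lin: "linear (D (x, t))" using D(1)[of "(x, t)"] x t has_derivative_linear by blast
    have "D (x, t) (0, v) = v *\<^sub>R D (x, t) (0, 1)" for v
      using linear_cmul[OF lin, of v "(0, 1)"] by simp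
    then have "(\<lambda>v. D (x, t) (0, v)) = (\<lambda>v. v *\<^sub>R D (x, t) (0, 1))" by (rule ext)
    moreover have "(\<lambda>s. \<Phi> (x, s)) = u p" by (simp add: \<Phi>_def x(2))
    ultimately have "(u p has_vector_derivative D (x, t) (0, 1)) (at t within {0..T})"
      using d unfolding has_vector_derivative_def by metis
    then show ?thesis
      unfolding time_deriv_def by (rule vector_derivative_within_closed_interval[OF T t])
  qed
  show "continuous_on {0..T} (\<lambda>t. time_deriv T u p t)"
    using cont[of "(0, 1)"] by (subst continuous_on_cong[OF refl td]) auto
qed

lemma continuous_on_ginv:
  assumes c: "c \<in> \<A>" and p: "p \<in> chart_dom c"
  shows "continuous_on {0..T} (\<lambda>t. ginv (g t) c i j p)"
proof -
  let ?S = "chart_image c \<times> {0..T}"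
  have "smooth_on ?S (\<lambda>y. ginv (g (snd y)) c i j (chart_inv c (fst y)))"
    unfolding ginv_def by (intro smooth_intros g_smooth[OF c] g_invertible c) auto
  then have "continuous_on ?S (\<lambda>y. ginv (g (snd y)) c i j (chart_inv c (fst y)))"
    by (rule smooth_on_continuous)
  then have "continuous_on {0..T} (\<lambda>t. ginv (g (snd (chart_map c p, t))) c i j (chart_inv c (fst (chart_map c p, t))))"
    by (rule continuous_on_compose2) (use p in \<open>auto intro!: continuous_intros\<close>)
  then show ?thesis using chart_inv_map[OF smooth_structureD(1)[OF atlas c] p] by simp
qed

end

section \<open>From the estimate at the maximum to all points and times\<close>

context heat_setting begin

lemma li_yau_const_nonneg: "li_yau_const \<ge> 0"
  unfolding li_yau_const_def using \<alpha> nonneg by (intro add_nonneg_nonneg) simp_all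

text \<open>The weight vanishes at \<open>\<epsilon>\<close>, so a positive maximum lies later, and
  \<open>{\<epsilon>..t1}\<close> stays inside the open interval where \<open>Q\<close> is smooth in
  charts. Multiplied by \<open>t0 - \<epsilon>\<close>, the bound at the maximum is nondecreasing in
  \<open>t0\<close>, which may then be replaced by \<open>t1\<close>.\<close>

lemma Q_bound_shifted:
  assumes p: "p \<in> topspace X" and \<epsilon>: "0 < \<epsilon>" "\<epsilon> < t1" and t1: "t1 < T"
  shows "(t1 - \<epsilon>) * Q p t1 \<le> real CARD('n) * \<alpha>\<^sup>2 / 2 + (t1 - \<epsilon>) * li_yau_const"
proof -
  define \<Phi> where "\<Phi> p t = (t - \<epsilon>) * Q p t" for p t
  let ?J = "{\<epsilon>..t1}"
  have "compact ((\<lambda>(p, t). \<Phi> p t) ` (topspace X \<times> ?J))"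
  proof (rule compact_image_spacetime)
    fix c assume c: "c \<in> \<A>"
    interpret L: local_metric "W c" "gm c" "gi c" "lu c" by (rule local_metric_chart[OF c])
    have sub: "chart_image c \<times> ?J \<subseteq> W c" using \<epsilon> t1 by (auto simp: W_def)
    have "smooth_on (W c) (\<lambda>y. (snd y - \<epsilon>) * (gsq_lu c y - \<alpha> * (lap_lu c y + gsq_lu c y)))"
      unfolding gsq_lu_def lap_lu_def
      by (intro smooth_intros L.s_gradsq L.s_Lap smooth_on_bounded_linear bounded_linear_snd)
    then have "continuous_on (chart_image c \<times> ?J) (\<lambda>y. (snd y - \<epsilon>) * (gsq_lu c y - \<alpha> * (lap_lu c y + gsq_lu c y)))"
      using smooth_on_continuous continuous_on_subset sub by blast
    moreover have "\<Phi> (chart_inv c (fst y)) (snd y) = (snd y - \<epsilon>) * (gsq_lu c y - \<alpha> * (lap_lu c y + gsq_lu c y))"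
      if "y \<in> chart_image c \<times> ?J" for y
      using li_yau_eq[OF c, of "fst y" "snd y"] li_yau_eq_Q[OF c, of "chart_inv c (fst y)" "snd y"] that sub \<epsilon> t1
      by (auto simp: \<Phi>_def subset_eq)
    ultimately show "continuous_on (chart_image c \<times> ?J) (\<lambda>y. \<Phi> (chart_inv c (fst y)) (snd y))"
      by (subst continuous_on_cong[OF refl]) auto
  qed simp
  moreover have "(\<lambda>(p, t). \<Phi> p t) ` (topspace X \<times> ?J) \<noteq> {}" using p \<epsilon> by auto
  ultimately have "\<exists>s\<in>(\<lambda>(p, t). \<Phi> p t) ` (topspace X \<times> ?J). \<forall>r\<in>(\<lambda>(p, t). \<Phi> p t) ` (topspace X \<times> ?J). r \<le> s"
    by (rule compact_attains_sup)
  then obtain p0 t0 where p0: "p0 \<in> topspace X" and t0: "t0 \<in> ?J"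
    and max: "\<And>p t. p \<in> topspace X \<Longrightarrow> t \<in> ?J \<Longrightarrow> \<Phi> p t \<le> \<Phi> p0 t0"
    by fastforce
  have le: "\<Phi> p t1 \<le> \<Phi> p0 t0" using max p \<epsilon> by simp
  have n2: "real CARD('n) * \<alpha>\<^sup>2 / 2 \<ge> 0" "(t1 - \<epsilon>) * li_yau_const \<ge> 0" using \<epsilon> li_yau_const_nonneg by auto
  show ?thesis
  proof (cases "\<Phi> p0 t0 > 0")
    case False
    then show ?thesis using le n2 unfolding \<Phi>_def by linarith
  next
    case True
    have t0\<epsilon>: "t0 > \<epsilon>" and Qpos: "Q p0 t0 > 0"
      using True t0 by (auto simp: \<Phi>_def zero_less_mult_iff)
    have "Q p0 t0 \<le> real CARD('n) * \<alpha>\<^sup>2 / (2 * (t0 - \<epsilon>)) + li_yau_const"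
    proof (rule Q_at_maximum[OF p0 _ \<epsilon>(1) t0\<epsilon> _ _ Qpos])
      show "t0 \<in> {0<..<T}" using t0 \<epsilon> t1 by auto
      show "Q p t0 \<le> Q p0 t0" if "p \<in> topspace X" for p
        using max[OF that t0] t0\<epsilon> by (simp add: \<Phi>_def)
      show "(s - \<epsilon>) * Q p0 s \<le> (t0 - \<epsilon>) * Q p0 t0" if "s \<in> {\<epsilon>..t0}" for s
        using max[OF p0, of s] that t0 by (simp add: \<Phi>_def)
    qed
    then have "(t0 - \<epsilon>) * Q p0 t0 \<le> (t0 - \<epsilon>) * (real CARD('n) * \<alpha>\<^sup>2 / (2 * (t0 - \<epsilon>)) + li_yau_const)"
      using t0\<epsilon> by (intro mult_left_mono) auto
    also have "\<dots> = real CARD('n) * \<alpha>\<^sup>2 / 2 + (t0 - \<epsilon>) * li_yau_const"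
    proof -
      have "d * (N / (2 * d) + b) = N / 2 + d * b" if "d > 0" for d N b :: real
        using that by (simp add: field_simps)
      from this[of "t0 - \<epsilon>"] show ?thesis using t0\<epsilon> by (metis diff_gt_0_iff_gt)
    qed
    also have "\<dots> \<le> real CARD('n) * \<alpha>\<^sup>2 / 2 + (t1 - \<epsilon>) * li_yau_const"
      using t0 li_yau_const_nonneg by (intro add_left_mono mult_right_mono) auto
    finally show ?thesis using le by (simp add: \<Phi>_def)
  qed
qed

lemma Q_bound_interior:
  assumes p: "p \<in> topspace X" and t: "0 < t" "t < T"
  shows "Q p t \<le> real CARD('n) * \<alpha>\<^sup>2 / (2 * t) + li_yau_const"
proof -
  have "((\<lambda>\<epsilon>. (t - \<epsilon>) * Q p t) \<longlongrightarrow> (t - 0) * Q p t) (at_right 0)"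
    "((\<lambda>\<epsilon>. real CARD('n) * \<alpha>\<^sup>2 / 2 + (t - \<epsilon>) * li_yau_const) \<longlongrightarrow> real CARD('n) * \<alpha>\<^sup>2 / 2 + (t - 0) * li_yau_const) (at_right 0)"
    by (intro tendsto_intros)+
  moreover have "eventually (\<lambda>\<epsilon>. (t - \<epsilon>) * Q p t \<le> real CARD('n) * \<alpha>\<^sup>2 / 2 + (t - \<epsilon>) * li_yau_const) (at_right 0)"
    by (rule eventually_at_rightI[of 0 t]) (use Q_bound_shifted[OF p] t in auto)
  ultimately have "(t - 0) * Q p t \<le> real CARD('n) * \<alpha>\<^sup>2 / 2 + (t - 0) * li_yau_const"
    using tendsto_le[OF trivial_limit_at_right_real] by blast
  then show ?thesis using t by (simp add: field_simps)
qed

text \<open>For t = T, at a fixed point and in a fixed chart, the left-hand side is continuous on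
  the closed time interval; here the regularity of \<open>q\<close> in time enters.\<close>

lemma li_yau_bound:
  assumes c: "c \<in> \<A>" and p: "p \<in> chart_dom c" and t: "t \<in> {0<..T}"
  shows "li_yau c p t \<le> real CARD('n) * \<alpha>\<^sup>2 / (2 * t) + li_yau_const"
proof (cases "t < T")
  case True
  then show ?thesis using Q_bound_interior[OF dom_top[OF c p]] li_yau_eq_Q[OF c p, of t] t by auto
next
  case False
  then have tT: "t = T" using t by auto
  have up: "u p s > 0" if "s \<in> {0..T}" for s using u_pos[OF dom_top[OF c p] that] .
  have cu: "continuous_on {0..T} (u p)"
  proof -
    have "continuous_on {0..T} (\<lambda>s. u (chart_inv c (fst (chart_map c p, s))) (snd (chart_map c p, s)))"
      by (rule continuous_on_compose2[OF continuous_on_u[OF c]]) (use p in \<open>auto intro!: continuous_intros\<close>)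
    then show ?thesis using chart_inv_map[OF smooth_structureD(1)[OF atlas c] p] by simp
  qed
  have cq: "continuous_on {0..T} (q p)"
    using q dom_top[OF c p] Ck_on_continuous unfolding C21_spacetime_def by blast
  have cA: "continuous_on {0..T} (\<lambda>s. A (u p s))"
    by (rule continuous_on_compose2[OF C2_continuous_derivatives(1)[OF A2] cu]) (use up in auto)
  have "continuous_on {0..T} (\<lambda>s. li_yau c p s)"
    unfolding li_yau_def grad_norm_def
    by (intro continuous_intros continuous_on_ginv[OF c p] continuous_on_pd_u[OF c p T] cu cq cA)
      (use up in \<open>auto simp: less_imp_neq[THEN not_sym]\<close>)
  \<comment> \<open>Starting at \<open>T/2\<close> keeps the term in 1/s continuous.\<close>
  then have "continuous_on {T/2..T} (\<lambda>s. li_yau c p s - real CARD('n) * \<alpha>\<^sup>2 / (2 * s))"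
    using T by (intro continuous_intros) (auto intro: continuous_on_subset)
  moreover have cl: "closure {T/2<..<T} = {T/2..T}" using T by simp
  ultimately have cont: "continuous_on (closure {T/2<..<T}) (\<lambda>s. li_yau c p s - real CARD('n) * \<alpha>\<^sup>2 / (2 * s))"
    by simp
  have "li_yau c p T - real CARD('n) * \<alpha>\<^sup>2 / (2 * T) \<le> li_yau_const"
  proof (rule continuous_le_on_closure[OF cont])
    show "T \<in> closure {T/2<..<T}" using cl T by simp
    fix s assume s: "s \<in> {T/2<..<T}"
    then have s': "0 < s" "s < T" using T by auto
    then show "li_yau c p s - real CARD('n) * \<alpha>\<^sup>2 / (2 * s) \<le> li_yau_const"
      using Q_bound_interior[OF dom_top[OF c p] s'] li_yau_eq_Q[OF c p, of s] by simp
  qed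
  then show ?thesis by (simp add: tT)
qed

end

theorem theorem2p7:
  fixes X :: "'a topology"
    and \<A> :: "('a, 'n::finite) chart set"
    and g h :: "real \<Rightarrow> ('a, 'n) tensor2"
    and u q :: "'a \<Rightarrow> real \<Rightarrow> real"
    and A :: "real \<Rightarrow> real"
    and T K1 K2 K3 K4 \<gamma> \<theta> \<alpha> lam Lam Sig n :: real
  assumes M: "closed_manifold X \<A>"
    and n: "n = real CARD('n)"
    and T: "T > 0"
    and g: "smooth_metric_family \<A> T g"
    and h: "\<forall>t\<in>{0..T}. symmetric_tensor_field \<A> (h t)"
    and flow: "\<forall>c\<in>\<A>. \<forall>p\<in>chart_dom c. \<forall>t\<in>{0..T}.
        ((\<lambda>s. g s c p) has_vector_derivative 2 *\<^sub>R h t c p) (at t within {0..T})"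
    and nonneg: "K1 \<ge> 0" "K2 \<ge> 0" "K3 \<ge> 0" "K4 \<ge> 0" "\<gamma> \<ge> 0" "\<theta> \<ge> 0"
    and Ric: "\<forall>c\<in>\<A>. \<forall>p\<in>chart_dom c. \<forall>t\<in>{0..T}.
        tensor_le (- K1 *\<^sub>R g t c p) (ricci (g t) c p)"
    and h_bounds: "\<forall>c\<in>\<A>. \<forall>p\<in>chart_dom c. \<forall>t\<in>{0..T}.
        tensor_le (- K2 *\<^sub>R g t c p) (h t c p) \<and> tensor_le (h t c p) (K3 *\<^sub>R g t c p)"
    and grad_h: "\<forall>c\<in>\<A>. \<forall>p\<in>chart_dom c. \<forall>t\<in>{0..T}. cov_deriv_norm (g t) c (h t) p \<le> K4"
    and A: "Ck_on 2 {0<..} A"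
    and q: "C21_spacetime X \<A> T q"
    and grad_q: "\<forall>c\<in>\<A>. \<forall>p\<in>chart_dom c. \<forall>t\<in>{0..T}. grad_norm (g t) c (\<lambda>x. q x t) p \<le> \<gamma>"
    and lap_q: "\<forall>c\<in>\<A>. \<forall>p\<in>chart_dom c. \<forall>t\<in>{0..T}. laplacian (g t) c (\<lambda>x. q x t) p \<le> \<theta>"
    and u: "smooth_spacetime \<A> T u"
    and u_pos: "\<forall>p\<in>topspace X. \<forall>t\<in>{0..T}. u p t > 0"
    and eq: "\<forall>c\<in>\<A>. \<forall>p\<in>chart_dom c. \<forall>t\<in>{0..T}.
        laplacian (g t) c (\<lambda>x. u x t) p - q p t * u p t - time_deriv T u p t = A (u p t)"
    and lam: "lam = - min 0 (INF (p, t)\<in>topspace X \<times> {0..T}. deriv A (u p t) - A (u p t) / u p t)"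
    and Lam: "Lam = max 0 (SUP (p, t)\<in>topspace X \<times> {0..T}. deriv A (u p t) - A (u p t) / u p t)"
    and Sig: "Sig = max 0 (SUP (p, t)\<in>topspace X \<times> {0..T}.
        u p t * deriv (deriv A) (u p t) - deriv A (u p t) + A (u p t) / u p t)"
    and \<alpha>: "\<alpha> > 1"
  shows "\<forall>c\<in>\<A>. \<forall>p\<in>chart_dom c. \<forall>t\<in>{0<..T}.
      (grad_norm (g t) c (\<lambda>x. u x t) p)\<^sup>2 / (u p t)\<^sup>2 - \<alpha> * time_deriv T u p t / u p t
        - \<alpha> * q p t - \<alpha> * A (u p t) / u p t
      \<le> n * \<alpha>\<^sup>2 / (2 * t) + n * \<alpha>\<^sup>2 / (\<alpha> - 1) * (K1 + (\<alpha> - 1) * K3 + K4)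
        + n * \<alpha>\<^sup>2 * (max K2 K3 + 3 / 4 * sqrt (2 * K4))
        + \<alpha> powr (3/2) * sqrt (n * \<theta>)
        + (n * \<alpha>\<^sup>2 / 2 * (\<alpha> - 1) powr (1/2) + sqrt n * \<alpha> * (\<alpha> - 1) powr (1/4)) * \<gamma> powr (2/3)
        + n * \<alpha>\<^sup>2 / 2 * (lam + Lam) + n * \<alpha> ^ 3 / (2 * (\<alpha> - 1)) * Sig"
proof -
  interpret E: evolving_metric X \<A> g u T
    using M g u u_pos by unfold_locales auto
  have cA: "continuous_on {0<..} A" "continuous_on {0<..} (deriv A)" "continuous_on {0<..} (deriv (deriv A))"
    using C2_continuous_derivatives[OF A] by blast+
  have c1: "continuous_on {0<..} (\<lambda>y. deriv A y - A y / y)"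
    "continuous_on {0<..} (\<lambda>y. y * deriv (deriv A) y - deriv A y + A y / y)"
    by (intro continuous_intros cA; simp)+
  \<comment> \<open>Boundedness is what turns \<open>INF\<close> and \<open>SUP\<close> into lower
    and upper bounds for the individual values.\<close>
  note b1 = compact_imp_bounded[OF E.bounded_function_of_u[OF c1(1)]]
    and b2 = compact_imp_bounded[OF E.bounded_function_of_u[OF c1(2)]]
  have lam1: "- lam \<le> deriv A (u p t) - A (u p t) / u p t"
    and Lam1: "deriv A (u p t) - A (u p t) / u p t \<le> Lam"
    and Sig1: "u p t * deriv (deriv A) (u p t) - deriv A (u p t) + A (u p t) / u p t \<le> Sig"
    if "p \<in> topspace X" "t \<in> {0..T}" for p t
  proof -
    have pt: "(p, t) \<in> topspace X \<times> {0..T}" using that by simp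
    show "- lam \<le> deriv A (u p t) - A (u p t) / u p t"
      unfolding lam using cINF_lower[OF bounded_imp_bdd_below[OF b1] pt] by simp
    show "deriv A (u p t) - A (u p t) / u p t \<le> Lam"
      unfolding Lam using cSUP_upper[OF pt bounded_imp_bdd_above[OF b1]] by simp
    show "u p t * deriv (deriv A) (u p t) - deriv A (u p t) + A (u p t) / u p t \<le> Sig"
      unfolding Sig using cSUP_upper[OF pt bounded_imp_bdd_above[OF b2]] by simp
  qed
  interpret H: heat_setting X \<A> g u T h q A K1 K2 K3 K4 \<gamma> \<theta> \<alpha> lam Lam Sig
  proof (intro heat_setting.intro heat_setting_axioms.intro E.evolving_metric_axioms)
    show "lam \<ge> 0" "Lam \<ge> 0" "Sig \<ge> 0" by (simp_all add: lam Lam Sig)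
    fix c p t assume cpt: "c \<in> \<A>" "p \<in> chart_dom c" "t \<in> {0..T}"
    show "((\<lambda>s. g s c p) has_vector_derivative 2 *\<^sub>R h t c p) (at t within {0..T})"
      using flow cpt by blast
    show "tensor_le (- K1 *\<^sub>R g t c p) (ricci (g t) c p)" using Ric cpt by blast
    show "tensor_le (- K2 *\<^sub>R g t c p) (h t c p) \<and> tensor_le (h t c p) (K3 *\<^sub>R g t c p)"
      using h_bounds cpt by blast
    show "cov_deriv_norm (g t) c (h t) p \<le> K4" using grad_h cpt by blast
    show "grad_norm (g t) c (\<lambda>x. q x t) p \<le> \<gamma>" using grad_q cpt by blast
    show "laplacian (g t) c (\<lambda>x. q x t) p \<le> \<theta>" using lap_q cpt by blast
    show "laplacian (g t) c (\<lambda>x. u x t) p - q p t * u p t - time_deriv T u p t = A (u p t)"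
      using eq cpt by blast
  qed (fact T nonneg A q lam1 Lam1 Sig1 \<alpha>)+
  show ?thesis
    using H.li_yau_bound unfolding H.li_yau_def H.li_yau_const_def n by (simp add: add.assoc)
qed

end
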